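(* Let $0\le\delta<\rho\le1$, $\mu\in\mathbb{R}$ and $\sigma\in S^\mu_{\rho,\delta}(\mathbb{Z}^n\times\mathbb{T}^n)$. Then there exists a symbol $\sigma^t\in S^\mu_{\rho,\delta}(\mathbb{Z}^n\times\mathbb{T}^n)$ such that the transpose operator $\mathrm{Op}(\sigma)^t$ is the pseudo-difference operator with symbol $\sigma^t$, i.e. $\mathrm{Op}(\sigma)^t=\mathrm{Op}(\sigma^t)$, and $$\sigma^t(k,x)\sim\sum_\alpha\frac{1}{\alpha!}\,\Delta_k^\alpha D_x^{(\alpha)}\big[\sigma(k,-x)\big],$$ where $D_x^{(\alpha)}$ is applied to the function $x\mapsto\sigma(k,-x)$; this means that for every $N\in\mathbb{N}$ $$\sigma^t(k,x)-\sum_{|\alpha|<N}\frac{1}{\alpha!}\,\Delta_k^\alpha D_x^{(\alpha)}\big[\sigma(k,-x)\big]\in S^{\mu-N(\rho-\delta)}_{\rho,\delta}(\mathbb{Z}^n\times\mathbb{T}^n).$$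
   Context: $\mathbb{T}^n=\mathbb{R}^n/\mathbb{Z}^n$ with normalised Lebesgue measure; $k\cdot x=\sum_j k_jx_j$; $\mathcal{S}(\mathbb{Z}^n)$ is the space of rapidly decreasing functions $f:\mathbb{Z}^n\to\mathbb{C}$ (for every $M$, $|f(k)|\le C_M(1+|k|)^{-M}$). The Fourier transform is $\widehat f(x)=\sum_{k\in\mathbb{Z}^n}e^{-2\pi i k\cdot x}f(k)$, $x\in\mathbb{T}^n$. For $\sigma:\mathbb{Z}^n\times\mathbb{T}^n\to\mathbb{C}$ the pseudo-difference operator with symbol $\sigma$ is $\mathrm{Op}(\sigma)f(k)=\int_{\mathbb{T}^n}e^{2\pi i k\cdot x}\sigma(k,x)\widehat f(x)\,dx$, $k\in\mathbb{Z}^n$. The transpose $T^t$ of a linear operator $T$ is defined by $\sum_{k}(T^tf)(k)g(k)=\sum_k f(k)(Tg)(k)$ for $f,g\in\mathcal{S}(\mathbb{Z}^n)$. Difference operators: $\Delta^\alpha=\Delta_1^{\alpha_1}\cdots\Delta_n^{\alpha_n}$, $\Delta_j\tau(k)=\tau(k+v_j)-\tau(k)$, $v_j$ the $j$-th standard unit vector; $\Delta_k^\alpha$ indicates action in the variable $k$. Derivatives: $D_x^{(\alpha)}=D_{x_1}^{(\alpha_1)}\cdots D_{x_n}^{(\alpha_n)}$, where $D_{x_j}^{(0)}=I$ and $D_{x_j}^{(\ell)}=\prod_{m=0}^{\ell-1}\big(\frac{1}{2\pi i}\frac{\partial}{\partial x_j}-m\big)$ for $\ell\ge1$. Symbol classes: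 for $\mu,\rho,\delta\in\mathbb{R}$, $S^\mu_{\rho,\delta}(\mathbb{Z}^n\times\mathbb{T}^n)$ is the set of $\sigma:\mathbb{Z}^n\times\mathbb{T}^n\to\mathbb{C}$ such that $\sigma(k,\cdot)\in C^\infty(\mathbb{T}^n)$ for all $k$ and for all multi-indices $\alpha,\beta$ there is $C_{\alpha,\beta}>0$ with $|D_x^{(\beta)}\Delta_k^\alpha\sigma(k,x)|\le C_{\alpha,\beta}(1+|k|)^{\mu-\rho|\alpha|+\delta|\beta|}$ for all $(k,x)\in\mathbb{Z}^n\times\mathbb{T}^n$. *)

theory Defs
  imports "HOL-Analysis.Analysis"
begin

text \<open>
  The dimension is \<open>CARD('n)\<close>; the linear order on the index type \<open>'n\<close> is the numbering of the
  coordinates, so that every finite dimension \<open>n \<ge> 1\<close> is covered. The lattice is \<open>int ^ 'n\<close>,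
  multi-indices are of type \<open>nat ^ 'n\<close>, and functions on the torus are functions on
  \<open>real ^ 'n\<close> that are periodic with respect to the integer lattice.
\<close>

definition lattice_vec :: "int ^ 'n \<Rightarrow> real ^ 'n" where
  "lattice_vec k = (\<chi> j. real_of_int (k $ j))"

definition weight :: "int ^ 'n::finite \<Rightarrow> real" where
  "weight k = 1 + norm (lattice_vec k)"

definition mi_order :: "nat ^ 'n::finite \<Rightarrow> nat" where
  "mi_order \<alpha> = (\<Sum>j\<in>UNIV. \<alpha> $ j)"

definition mi_fact :: "nat ^ 'n::finite \<Rightarrow> nat" where
  "mi_fact \<alpha> = (\<Prod>j\<in>UNIV. fact (\<alpha> $ j))"

lemma finite_mi_order_less: "finite {\<alpha> :: nat ^ 'n::finite. mi_order \<alpha> < N}"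
proof -
  have "{\<alpha> :: nat ^ 'n. mi_order \<alpha> < N} \<subseteq> vec_lambda ` (UNIV \<rightarrow>\<^sub>E {..<N})"
  proof
    fix \<alpha> :: "nat ^ 'n"
    assume *: "\<alpha> \<in> {\<alpha>. mi_order \<alpha> < N}"
    have "\<alpha> $ j < N" for j
    proof -
      have "\<alpha> $ j \<le> mi_order \<alpha>"
        unfolding mi_order_def by (rule member_le_sum) auto
      with * show ?thesis by simp
    qed
    then show "\<alpha> \<in> vec_lambda ` (UNIV \<rightarrow>\<^sub>E {..<N})"
      by (intro image_eqI[where x = "vec_nth \<alpha>"]) auto
  qed
  then show ?thesis
    by (rule finite_subset) (intro finite_imageI finite_PiE, auto)
qed

text \<open>
  If \<open>T j l\<close> is the operator of order \<open>l\<close> in the \<open>j\<close>-th variable and \<open>j1 < \<dots> < jn\<close> are the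
  elements of \<open>'n\<close>, then \<open>multi_op T \<alpha> f = T j1 (\<alpha> $ j1) (\<dots> (T jn (\<alpha> $ jn) f))\<close>.
\<close>

definition multi_op ::
    "('n \<Rightarrow> nat \<Rightarrow> 'f \<Rightarrow> 'f) \<Rightarrow> nat ^ 'n::{finite,linorder} \<Rightarrow> 'f \<Rightarrow> 'f" where
  "multi_op T \<alpha> f = foldr (\<lambda>j. T j (\<alpha> $ j)) (sorted_list_of_set UNIV) f"

definition diff_op :: "'n \<Rightarrow> (int ^ 'n \<Rightarrow> complex) \<Rightarrow> int ^ 'n::finite \<Rightarrow> complex" where
  "diff_op j \<tau> k = \<tau> (k + axis j 1) - \<tau> k"

definition Delta ::
    "nat ^ 'n::{finite,linorder} \<Rightarrow> (int ^ 'n::_ \<Rightarrow> complex) \<Rightarrow> int ^ 'n::_ \<Rightarrow> complex" where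
  "Delta = multi_op (\<lambda>j l. diff_op j ^^ l)"

definition partial_deriv :: "'n \<Rightarrow> (real ^ 'n \<Rightarrow> complex) \<Rightarrow> real ^ 'n::finite \<Rightarrow> complex" where
  "partial_deriv j g x = vector_derivative (\<lambda>t. g (x + t *\<^sub>R axis j 1)) (at 0)"

primrec falling_deriv ::
    "'n \<Rightarrow> nat \<Rightarrow> (real ^ 'n \<Rightarrow> complex) \<Rightarrow> real ^ 'n::finite \<Rightarrow> complex" where
  "falling_deriv j 0 g = g"
| "falling_deriv j (Suc l) g =
     (\<lambda>x. 1 / (2 * of_real pi * \<i>) * partial_deriv j (falling_deriv j l g) x
            - of_nat l * falling_deriv j l g x)"

definition Dx ::
    "nat ^ 'n::{finite,linorder} \<Rightarrow> (real ^ 'n::_ \<Rightarrow> complex) \<Rightarrow> real ^ 'n::_ \<Rightarrow> complex" where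
  "Dx = multi_op falling_deriv"

primrec C_order :: "nat \<Rightarrow> (real ^ 'n::finite \<Rightarrow> complex) \<Rightarrow> bool" where
  "C_order 0 g \<longleftrightarrow> continuous_on UNIV g"
| "C_order (Suc m) g \<longleftrightarrow>
     g differentiable_on UNIV \<and> (\<forall>j. C_order m (partial_deriv j g))"

definition smooth_torus :: "(real ^ 'n::finite \<Rightarrow> complex) \<Rightarrow> bool" where
  "smooth_torus g \<longleftrightarrow>
     (\<forall>x k. g (x + lattice_vec k) = g x) \<and> (\<forall>m. C_order m g)"

definition symbol_class ::
    "real \<Rightarrow> real \<Rightarrow> real \<Rightarrow> (int ^ 'n::{finite,linorder} \<Rightarrow> real ^ 'n::_ \<Rightarrow> complex) set" where
  "symbol_class \<mu> \<rho> \<delta> = {\<sigma>.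
     (\<forall>k. smooth_torus (\<sigma> k)) \<and>
     (\<forall>\<alpha> \<beta>. \<exists>C>0. \<forall>k x.
        norm (Dx \<beta> (\<lambda>y. Delta \<alpha> (\<lambda>l. \<sigma> l y) k) x)
          \<le> C * weight k powr (\<mu> - \<rho> * real (mi_order \<alpha>) + \<delta> * real (mi_order \<beta>)))}"

definition rapidly_decreasing :: "(int ^ 'n::finite \<Rightarrow> complex) \<Rightarrow> bool" where
  "rapidly_decreasing f \<longleftrightarrow> (\<forall>M::nat. \<exists>C. \<forall>k. norm (f k) \<le> C / weight k ^ M)"

definition fourier :: "(int ^ 'n::finite \<Rightarrow> complex) \<Rightarrow> real ^ 'n \<Rightarrow> complex" where
  "fourier f x =
     (\<Sum>\<^sub>\<infinity>k. exp (- (2 * of_real pi * \<i> * of_real (lattice_vec k \<bullet> x))) * f k)"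

text \<open>Integration over the torus is integration over the unit cube, which has measure one.\<close>

definition Op ::
    "(int ^ 'n::finite \<Rightarrow> real ^ 'n \<Rightarrow> complex) \<Rightarrow> (int ^ 'n \<Rightarrow> complex) \<Rightarrow> int ^ 'n \<Rightarrow> complex" where
  "Op \<sigma> f k =
     (LINT x:cbox 0 1|lborel.
        exp (2 * of_real pi * \<i> * of_real (lattice_vec k \<bullet> x)) * \<sigma> k x * fourier f x)"

text \<open>
  \<open>is_transpose T T'\<close> means that \<open>T'\<close> is the transpose of \<open>T\<close>, both regarded as operators on
  rapidly decreasing functions. Convergence of both series is part of the definition because
  the infinite sum of a family that is not summable is \<open>0\<close> by convention.
\<close>

definition is_transpose ::
    "((int ^ 'n::finite \<Rightarrow> complex) \<Rightarrow> int ^ 'n \<Rightarrow> complex) \<Rightarrow>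
     ((int ^ 'n \<Rightarrow> complex) \<Rightarrow> int ^ 'n \<Rightarrow> complex) \<Rightarrow> bool" where
  "is_transpose T T' \<longleftrightarrow>
     (\<forall>f g. rapidly_decreasing f \<longrightarrow> rapidly_decreasing g \<longrightarrow>
        (\<lambda>k. T' f k * g k) summable_on UNIV \<and>
        (\<lambda>k. f k * T g k) summable_on UNIV \<and>
        (\<Sum>\<^sub>\<infinity>k. T' f k * g k) = (\<Sum>\<^sub>\<infinity>k. f k * T g k))"

lemma is_transpose_unique:
  assumes "is_transpose T A" and "is_transpose T B" and f: "rapidly_decreasing f"
  shows "A f = B f"
proof
  fix j
  define g :: "int ^ 'a \<Rightarrow> complex" where "g = (\<lambda>k. if k = j then 1 else 0)"
  have pos: "weight k > 0" for k :: "int ^ 'a"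
    unfolding weight_def by (simp add: add_pos_nonneg)
  have g: "rapidly_decreasing g"
    unfolding rapidly_decreasing_def
  proof
    fix M
    have "norm (g k) \<le> weight j ^ M / weight k ^ M" for k
      using pos[of k] pos[of j] by (auto simp: g_def)
    then show "\<exists>C. \<forall>k. norm (g k) \<le> C / weight k ^ M" by blast
  qed
  have eval: "(\<Sum>\<^sub>\<infinity>k. h k * g k) = h j" for h
  proof -
    have "(\<Sum>\<^sub>\<infinity>k. h k * g k) = (\<Sum>\<^sub>\<infinity>k\<in>{j}. h k * g k)"
      by (rule infsum_cong_neutral) (auto simp: g_def)
    then show ?thesis by (simp add: g_def)
  qed
  have "(\<Sum>\<^sub>\<infinity>k. A f k * g k) = (\<Sum>\<^sub>\<infinity>k. B f k * g k)"
    using assms g unfolding is_transpose_def by metis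
  then show "A f j = B f j" by (simp only: eval)
qed

end

theory Submission
  imports Defs
begin

text \<open>
  Write \<open>a(k, m)\<close> for the Fourier coefficients of \<open>\<sigma>(k, \<cdot>)\<close> and \<open>b(k, m) = a(k, -m)\<close>. The kernel of
  \<open>Op \<sigma>\<close> is \<open>a(k, l - k)\<close>, so the transpose is the operator whose symbol has the Fourier
  coefficients \<open>b(k + m, m)\<close>. Expanding \<open>b(k + m, m)\<close> around \<open>k\<close> by the discrete Taylor formula, with
  falling factorials in \<open>m\<close> and differences in \<open>k\<close>, gives the asserted series, because falling
  factorials are the multipliers of the operators \<open>D\<^sup>\<alpha>\<close>. The remainder is estimated on
  the Fourier side: for \<open>m\<close> small compared to \<open>k\<close> by the differences of order \<open>N\<close>, and for the other
  \<open>m\<close> by the rapid decay of the coefficients, where \<open>\<delta> < 1\<close> enters. Summing the Fourier series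
  absolutely loses a fixed power of the weight, which is regained by expanding to a higher order.
\<close>

subsection \<open>Weights on the lattice\<close>

text \<open>Symbol estimates bound functions of x, whereas the shift from k to k + m acts on every
  frequency m separately. Two kinds of bounds are therefore kept: \<open>coef_symbol\<close> for
  suprema of trigonometric series and \<open>coef_decay\<close> for single coefficients. The first
  implies the second without loss, since a coefficient is at most the supremum of its function.
  Conversely, with n the dimension, absolute summation needs 2n extra powers of
  \<open>weight m\<close>; each costs \<delta> powers of \<open>weight k\<close>, so the loss is
  2n\<delta>. Single Taylor terms never leave \<open>coef_symbol\<close> and lose nothing, so only
  the remainder pays, and surplus terms of a longer expansion can be added back. The remainder of
  order 0 is b(k + m, m), so one estimate yields both the class of the transposed symbol and all its
  expansions. The hypothesis concerns smooth functions, the argument concerns coefficients; passing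
  between them requires Fourier inversion. It is derived from two facts: derivatives of periodic
  functions integrate to 0, and a continuous periodic function with vanishing coefficients is
  0.\<close>

lemma lattice_vec_simps [simp]:
  "lattice_vec (k + m) = lattice_vec k + lattice_vec m"
  "lattice_vec (- m) = - lattice_vec m"
  "lattice_vec (k - m) = lattice_vec k - lattice_vec m"
  "lattice_vec 0 = 0"
  "lattice_vec m $ j = of_int (m $ j)"
  by (simp_all add: lattice_vec_def vec_eq_iff)

lemma lattice_vec_axis [simp]: "lattice_vec (axis j 1) = axis j 1"
  by (simp add: lattice_vec_def vec_eq_iff axis_def)

lemma weight_ge_1: "1 \<le> weight k"
  by (simp add: weight_def)

lemma weight_pos [simp]: "0 < weight k"
  using weight_ge_1[of k] by linarith

lemma weight_nonneg [simp]: "0 \<le> weight k"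
  using weight_ge_1[of k] by linarith

lemma weight_neq_0 [simp]: "weight k \<noteq> 0"
  using weight_ge_1[of k] by linarith

lemma weight_minus [simp]: "weight (- k) = weight k"
  by (simp add: weight_def)

lemma abs_component_le_weight: "\<bar>real_of_int (m $ j)\<bar> \<le> weight m"
  using component_le_norm_cart[of "lattice_vec m" j] by (simp add: weight_def)

text \<open>The length of a shortest lattice path from 0 to \<open>m\<close>. Being a natural
  number, it supports induction along such a path.\<close>

definition l1 :: "int ^ 'n::finite \<Rightarrow> nat" where
  "l1 m = (\<Sum>j\<in>UNIV. nat \<bar>m $ j\<bar>)"

lemma real_l1: "real (l1 m) = (\<Sum>j\<in>UNIV. \<bar>real_of_int (m $ j)\<bar>)"
  by (simp add: l1_def)

lemma norm_le_l1: "norm (lattice_vec m) \<le> real (l1 m)"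
  using norm_le_l1_cart[of "lattice_vec m"] by (simp add: real_l1)

lemma l1_le_norm:
  fixes m :: "int ^ 'n::finite"
  shows "real (l1 m) \<le> real CARD('n) * norm (lattice_vec m)"
proof -
  have "real (l1 m) \<le> (\<Sum>j\<in>(UNIV::'n set). norm (lattice_vec m))"
    unfolding real_l1
    by (rule sum_mono) (metis component_le_norm_cart lattice_vec_simps(5))
  then show ?thesis by simp
qed

lemma l1_le_weight: "real (l1 (m :: int ^ 'n::finite)) \<le> real CARD('n) * weight m"
  using l1_le_norm[of m] by (simp add: weight_def algebra_simps)

text \<open>Derivatives in one direction only control powers of one coordinate of \<open>m\<close>;
  this turns such bounds into decay in \<open>weight m\<close>. The weight is at most a constant
  times the maximum of 1 and all |m_j|, and the M-th power of that maximum is one of the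
  summands.\<close>

lemma weight_power_le:
  fixes m :: "int ^ 'n::finite"
  shows "weight m ^ M \<le> (1 + real CARD('n)) ^ M * (1 + (\<Sum>j\<in>UNIV. \<bar>real_of_int (m $ j)\<bar> ^ M))"
proof -
  define w where "w = Max (insert 1 (range (\<lambda>j. \<bar>real_of_int (m $ j)\<bar>)))"
  have fin: "finite (insert 1 (range (\<lambda>j. \<bar>real_of_int (m $ j)\<bar>)))" by simp
  have w1: "1 \<le> w" unfolding w_def by (rule Max_ge[OF fin]) simp
  have wj: "\<bar>real_of_int (m $ j)\<bar> \<le> w" for j unfolding w_def by (rule Max_ge[OF fin]) simp
  have "real (l1 m) \<le> (\<Sum>j\<in>(UNIV::'n set). w)"
    unfolding real_l1 by (rule sum_mono) (rule wj)
  then have "weight m \<le> 1 + real CARD('n) * w"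
    using norm_le_l1[of m] by (simp add: weight_def)
  also have "\<dots> \<le> (1 + real CARD('n)) * w" using w1 by (simp add: algebra_simps)
  finally have "weight m ^ M \<le> ((1 + real CARD('n)) * w) ^ M"
    by (rule power_mono) simp
  also have "\<dots> = (1 + real CARD('n)) ^ M * w ^ M" by (simp add: power_mult_distrib)
  also have "w ^ M \<le> 1 + (\<Sum>j\<in>UNIV. \<bar>real_of_int (m $ j)\<bar> ^ M)"
  proof -
    have "w \<in> insert 1 (range (\<lambda>j. \<bar>real_of_int (m $ j)\<bar>))"
      unfolding w_def by (rule Max_in[OF fin]) simp
    then consider "w = 1" | j where "w = \<bar>real_of_int (m $ j)\<bar>" by auto
    then show ?thesis
    proof cases
      case 1 then show ?thesis by (simp add: sum_nonneg)
    next
      case (2 j)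
      have "\<bar>real_of_int (m $ j)\<bar> ^ M \<le> (\<Sum>j\<in>UNIV. \<bar>real_of_int (m $ j)\<bar> ^ M)"
        by (rule member_le_sum) auto
      then show ?thesis using 2 by simp
    qed
  qed
  finally show ?thesis by (simp add: mult_left_mono)
qed

text \<open>In this region \<open>weight k\<close> and \<open>weight (k + m)\<close> differ by a
  factor of at most 2, and the sign of \<open>s\<close> decides which of the two comparisons is
  used. The condition is put on \<open>l1\<close> so that all points of a shortest path to
  \<open>m\<close> inherit it.\<close>

lemma weight_powr_near:
  assumes "real (l1 m) \<le> norm (lattice_vec k) / 2"
  shows "weight (k + m) powr s \<le> 2 powr \<bar>s\<bar> * weight k powr s"
proof -
  have n: "norm (lattice_vec m) \<le> norm (lattice_vec k) / 2"
    using assms norm_le_l1[of m] by linarith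
  have "norm (lattice_vec (k + m)) \<le> norm (lattice_vec k) + norm (lattice_vec m)"
    by (simp add: norm_triangle_ineq)
  then have up: "weight (k + m) \<le> 2 * weight k"
    using n norm_ge_zero[of "lattice_vec k"] unfolding weight_def by argo
  have "norm (lattice_vec k) - norm (lattice_vec m) \<le> norm (lattice_vec (k + m))"
    by (simp add: norm_diff_ineq)
  then have lo: "weight k \<le> 2 * weight (k + m)"
    using n unfolding weight_def by argo
  show ?thesis
  proof (cases "0 \<le> s")
    case True
    have "weight (k + m) powr s \<le> (2 * weight k) powr s"
      using up True by (intro powr_mono2) auto
    then show ?thesis using True by (simp add: powr_mult)
  next
    case False
    have "weight (k + m) powr s \<le> (weight k / 2) powr s"
      using lo False by (intro powr_mono2') auto
    also have "\<dots> = 2 powr \<bar>s\<bar> * weight k powr s"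
      using False by (simp add: powr_divide powr_minus_divide)
    finally show ?thesis .
  qed
qed

text \<open>The region complementary to \<open>weight_powr_near\<close>. The dimension enters
  through the comparison of \<open>l1\<close> with the Euclidean norm.\<close>

lemma weight_le_far:
  fixes k m :: "int ^ 'n::finite"
  assumes "\<not> real (l1 m) \<le> norm (lattice_vec k) / 2"
  shows "weight k \<le> 2 * real CARD('n) * weight m"
proof -
  have "norm (lattice_vec k) < 2 * real (l1 m)" using assms by simp
  also have "2 * real (l1 m) \<le> 2 * (real CARD('n) * norm (lattice_vec m))"
    using l1_le_norm[of m] by simp
  finally have "weight k \<le> 1 + 2 * (real CARD('n) * norm (lattice_vec m))"
    by (simp add: weight_def)
  moreover have "1 \<le> 2 * real CARD('n)"
  proof -
    have "1 \<le> CARD('n)" by (simp add: Suc_leI)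
    then show ?thesis by linarith
  qed
  ultimately show ?thesis by (simp add: weight_def algebra_simps)
qed

lemma summable_on_int_inverse_square: "(\<lambda>z::int. 1 / (1 + (real_of_int z)\<^sup>2)) summable_on UNIV"
proof -
  have s: "summable (\<lambda>n::nat. norm (1 / (1 + (real n)\<^sup>2)))"
  proof (rule summable_comparison_test'[where N = 1])
    show "summable (\<lambda>n::nat. inverse (real n ^ 2))" by (rule inverse_power_summable) simp
  qed (auto simp: divide_simps add_nonneg_nonneg not_less)
  then have sn: "(\<lambda>n::nat. 1 / (1 + (real n)\<^sup>2)) summable_on UNIV"
    by (rule norm_summable_imp_summable_on)
  have 1: "(\<lambda>z::int. 1 / (1 + (real_of_int z)\<^sup>2)) summable_on range int"
    using sn by (subst summable_on_reindex) (auto simp: o_def)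
  have 2: "(\<lambda>z::int. 1 / (1 + (real_of_int z)\<^sup>2)) summable_on range (\<lambda>n. - int n)"
    using sn by (subst summable_on_reindex) (auto simp: o_def inj_on_def)
  have "(UNIV :: int set) = range int \<union> range (\<lambda>n. - int n)"
    by (auto simp: image_def) (metis int_cases)
  then show ?thesis using summable_on_union[OF 1 2] by simp
qed

text \<open>The exponent is 2n because each of the n factors \<open>(weight m)\<^sup>2\<close>
  dominates 1 + m_j^2, which bounds the summand by a product of summable one-dimensional
  terms.\<close>

lemma summable_on_inverse_weight_power:
  "(\<lambda>m :: int ^ 'n::finite. 1 / weight m ^ (2 * CARD('n))) summable_on UNIV"
proof -
  define h where "h z = 1 / (1 + (real_of_int z)\<^sup>2)" for z
  define H where "H = infsum h UNIV"
  have hpos: "0 \<le> h z" for z by (simp add: h_def)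
  have hs: "h summable_on UNIV"
    using summable_on_int_inverse_square unfolding h_def .
  have le: "1 / weight m ^ (2 * CARD('n)) \<le> (\<Prod>j\<in>UNIV. h (m $ j))" for m :: "int ^ 'n"
  proof -
    have "1 / weight m ^ (2 * CARD('n)) = (\<Prod>j\<in>(UNIV::'n set). 1 / (weight m)\<^sup>2)"
      by (simp add: power_mult power_one_over)
    also have "\<dots> \<le> (\<Prod>j\<in>UNIV. h (m $ j))"
    proof (rule prod_mono, safe)
      fix j
      have "\<bar>real_of_int (m $ j)\<bar> \<le> norm (lattice_vec m)"
        using component_le_norm_cart[of "lattice_vec m" j] by simp
      then have "(real_of_int (m $ j))\<^sup>2 \<le> (norm (lattice_vec m))\<^sup>2"
        by (metis abs_norm_cancel abs_le_square_iff)
      then have "1 + (real_of_int (m $ j))\<^sup>2 \<le> (weight m)\<^sup>2"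
        unfolding weight_def power2_sum by (simp add: add_increasing2)
      then show "1 / (weight m)\<^sup>2 \<le> h (m $ j)"
        unfolding h_def by (intro divide_left_mono) (auto intro!: mult_pos_pos add_pos_nonneg)
    qed simp
    finally show ?thesis .
  qed
  have "(\<lambda>m :: int ^ 'n. \<Prod>j\<in>UNIV. h (m $ j)) summable_on UNIV"
  proof (rule nonneg_bdd_above_summable_on)
    show "0 \<le> (\<Prod>j\<in>UNIV. h (m $ j))" for m :: "int ^ 'n" by (intro prod_nonneg) (simp add: hpos)
    show "bdd_above (sum (\<lambda>m :: int ^ 'n. \<Prod>j\<in>UNIV. h (m $ j)) ` {F. F \<subseteq> UNIV \<and> finite F})"
    proof (rule bdd_aboveI2[where M = "H ^ CARD('n)"], clarsimp)
      fix S :: "(int ^ 'n) set"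
      assume S: "finite S"
      \<comment> \<open>The finite set is enclosed in a product of n copies of the set of all
        occurring coordinates; over that product the sum factors.\<close>
      define B where "B = (\<Union>m\<in>S. range (vec_nth m))"
      have B: "finite B" unfolding B_def using S by (intro finite_UN_I finite_imageI) auto
      have "(\<Sum>m\<in>S. \<Prod>j\<in>UNIV. h (m $ j)) = (\<Sum>g\<in>vec_nth ` S. \<Prod>j\<in>UNIV. h (g j))"
        by (subst sum.reindex) (auto simp: inj_on_def vec_nth_inject)
      also have "\<dots> \<le> (\<Sum>g\<in>(UNIV::'n set) \<rightarrow>\<^sub>E B. \<Prod>j\<in>UNIV. h (g j))"
        using B by (intro sum_mono2 finite_PiE) (auto simp: B_def intro!: prod_nonneg hpos)
      also have "\<dots> = (\<Prod>j\<in>(UNIV::'n set). \<Sum>z\<in>B. h z)"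
        by (rule prod_sum_PiE[symmetric]) (auto simp: B)
      also have "\<dots> \<le> (\<Prod>j\<in>(UNIV::'n set). H)"
        by (rule prod_mono) (auto simp: H_def intro!: sum_nonneg hpos finite_sum_le_infsum hs B)
      finally show "(\<Sum>m\<in>S. \<Prod>j\<in>UNIV. h (m $ j)) \<le> H ^ CARD('n)" by simp
    qed
  qed
  then show ?thesis
    by (rule summable_on_comparison_test) (auto simp: le)
qed

text \<open>Otherwise the simplifier turns \<open>axis j 1 :: nat ^ 'n\<close> into \<open>axis j (Suc 0)\<close>.\<close>

declare One_nat_def [simp del]

subsection \<open>Multi-indices and finite differences\<close>

lemma mi_order_axis [simp]: "mi_order (\<alpha> + axis j 1) = Suc (mi_order \<alpha>)"
  by (simp add: mi_order_def axis_def sum.distrib)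

lemma mi_order_zero [simp]: "mi_order 0 = 0"
  by (simp add: mi_order_def)

lemma mi_order_add: "mi_order (\<alpha> + \<beta>) = mi_order \<alpha> + mi_order \<beta>"
  by (simp add: mi_order_def sum.distrib)

lemma mi_order_eq_0_iff [simp]: "mi_order \<alpha> = 0 \<longleftrightarrow> \<alpha> = 0"
  by (auto simp: mi_order_def vec_eq_iff)

lemma mi_decompose:
  fixes \<alpha> :: "nat ^ 'n::finite"
  assumes "\<alpha> $ j \<noteq> 0"
  obtains \<gamma> where "\<alpha> = \<gamma> + axis j 1"
proof
  show "\<alpha> = (\<chi> i. if i = j then \<alpha> $ j - 1 else \<alpha> $ i) + axis j 1"
    using assms by (auto simp: vec_eq_iff axis_def)
qed

text \<open>The multi-index operators and factors are known through recursions that raise one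
  coordinate, so induction adds one unit vector at a time.\<close>

lemma mi_induct [case_names zero step]:
  fixes \<alpha> :: "nat ^ 'n::finite"
  assumes "P 0" and "\<And>\<alpha> j. P \<alpha> \<Longrightarrow> P (\<alpha> + axis j 1)"
  shows "P \<alpha>"
proof (induction "mi_order \<alpha>" arbitrary: \<alpha>)
  case 0
  then show ?case using assms(1) by simp
next
  case (Suc r)
  then have "\<alpha> \<noteq> 0" by auto
  then obtain j where "\<alpha> $ j \<noteq> 0" by (auto simp: vec_eq_iff)
  then obtain \<gamma> where "\<alpha> = \<gamma> + axis j 1" by (rule mi_decompose)
  then show ?case using Suc assms(2)[of \<gamma> j] by simp
qed

lemma mi_fact_axis: "mi_fact (\<alpha> + axis j 1) = Suc (\<alpha> $ j) * mi_fact \<alpha>"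
proof -
  have "(\<Prod>i\<in>UNIV. fact ((\<alpha> + axis j 1) $ i)) =
      (\<Prod>i\<in>UNIV. (if i = j then Suc (\<alpha> $ j) else 1) * fact (\<alpha> $ i))"
    by (rule prod.cong) (auto simp: axis_def One_nat_def)
  also have "\<dots> = Suc (\<alpha> $ j) * (\<Prod>i\<in>UNIV. fact (\<alpha> $ i))"
    by (simp add: prod.distrib)
  finally show ?thesis by (simp add: mi_fact_def)
qed

lemma mi_fact_neq_0 [simp]: "mi_fact \<alpha> \<noteq> 0"
  by (simp add: mi_fact_def)

text \<open>Raising the j-th order inserts one extra \<open>D\<close> at the position of
  \<open>j\<close>. It commutes with all factors and can be moved innermost, onto \<open>f\<close>;
  distinctness makes this happen only once.\<close>

lemma foldr_multi_op_axis:
  assumes "distinct xs"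
    and comm: "\<And>i l f. T i l (D f) = D (T i l f)"
    and Suc: "\<And>l f. T j (Suc l) f = T j l (D f)"
  shows "foldr (\<lambda>i. T i ((\<alpha> + axis j 1) $ i)) xs f =
           foldr (\<lambda>i. T i (\<alpha> $ i)) xs (if j \<in> set xs then D f else f)"
  using assms(1)
proof (induction xs)
  case (Cons x xs)
  have D: "foldr (\<lambda>i. T i (\<alpha> $ i)) ys (D f) = D (foldr (\<lambda>i. T i (\<alpha> $ i)) ys f)" for ys
    by (induction ys) (simp_all add: comm)
  show ?case
  proof (cases "x = j")
    case True
    then show ?thesis using Cons by (simp add: Suc D axis_def One_nat_def)
  next
    case False
    then show ?thesis using Cons by (auto simp: axis_def)
  qed
qed simp

lemma multi_op_axis:
  fixes \<alpha> :: "nat ^ 'n::{finite,linorder}"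
  assumes "\<And>i l f. T i l (D f) = D (T i l f)"
    and "\<And>l f. T j (Suc l) f = T j l (D f)"
  shows "multi_op T (\<alpha> + axis j 1) f = multi_op T \<alpha> (D f)"
  unfolding multi_op_def
  by (subst foldr_multi_op_axis[where D = D and T = T]) (use assms in auto)

lemma diff_op_commute: "diff_op i (diff_op j h) = diff_op j (diff_op i h)"
  by (rule ext) (simp add: diff_op_def algebra_simps)

lemma funpow_diff_op_commute: "(diff_op i ^^ l) (diff_op j h) = diff_op j ((diff_op i ^^ l) h)"
  by (induction l) (simp_all add: diff_op_commute)

lemma Delta_axis: "Delta (\<alpha> + axis j 1) h = Delta \<alpha> (diff_op j h)"
  unfolding Delta_def
  by (rule multi_op_axis) (simp_all add: funpow_diff_op_commute)

lemma Delta_0 [simp]: "Delta 0 h = h"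
proof -
  have "foldr (\<lambda>j. diff_op j ^^ (0 $ j)) xs h = h" for xs :: "'a list"
    by (induction xs) simp_all
  then show ?thesis by (simp add: Delta_def multi_op_def)
qed

lemma diff_op_diff: "diff_op j (\<lambda>k. f k - g k) = (\<lambda>k. diff_op j f k - diff_op j g k)"
  by (rule ext) (simp add: diff_op_def)

lemma diff_op_cmult: "diff_op j (\<lambda>k. c * f k) = (\<lambda>k. c * diff_op j f k)"
  by (rule ext) (simp add: diff_op_def algebra_simps)

lemma diff_op_sum: "diff_op j (\<lambda>k. \<Sum>i\<in>I. f i k) = (\<lambda>k. \<Sum>i\<in>I. diff_op j (f i) k)"
  by (rule ext) (simp add: diff_op_def sum_subtractf)

lemma diff_op_shift: "diff_op j (\<lambda>l. h (l + c)) = (\<lambda>l. diff_op j h (l + c))"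
  by (rule ext) (simp add: diff_op_def algebra_simps)

lemma Delta_diff: "Delta \<alpha> (\<lambda>k. f k - g k) k = Delta \<alpha> f k - Delta \<alpha> g k"
  by (induction \<alpha> arbitrary: f g k rule: mi_induct) (simp_all add: Delta_axis diff_op_diff)

lemma diff_op_add: "diff_op j (\<lambda>k. f k + g k) = (\<lambda>k. diff_op j f k + diff_op j g k)"
  by (rule ext) (simp add: diff_op_def)

lemma Delta_add: "Delta \<alpha> (\<lambda>k. f k + g k) k = Delta \<alpha> f k + Delta \<alpha> g k"
  by (induction \<alpha> arbitrary: f g k rule: mi_induct) (simp_all add: Delta_axis diff_op_add)

lemma Delta_cmult: "Delta \<alpha> (\<lambda>k. c * f k) k = c * Delta \<alpha> f k"
  by (induction \<alpha> arbitrary: f k rule: mi_induct) (simp_all add: Delta_axis diff_op_cmult)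

lemma Delta_sum: "Delta \<alpha> (\<lambda>k. \<Sum>i\<in>I. f i k) k = (\<Sum>i\<in>I. Delta \<alpha> (f i) k)"
  by (induction \<alpha> arbitrary: f k rule: mi_induct) (simp_all add: Delta_axis diff_op_sum)

lemma Delta_shift: "Delta \<alpha> (\<lambda>l. h (l + c)) k = Delta \<alpha> h (k + c)"
  by (induction \<alpha> arbitrary: h k rule: mi_induct) (simp_all add: Delta_axis diff_op_shift)

lemma Delta_Delta: "Delta \<alpha> (Delta \<beta> h) = Delta (\<alpha> + \<beta>) h"
proof (induction \<alpha> arbitrary: h rule: mi_induct)
  case (step \<alpha> j)
  have D: "diff_op j (Delta \<beta> h) = Delta \<beta> (diff_op j h)" for h
    by (induction \<beta> arbitrary: h rule: mi_induct) (simp_all add: Delta_axis diff_op_commute)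
  have "Delta (\<alpha> + axis j 1) (Delta \<beta> h) = Delta \<alpha> (Delta \<beta> (diff_op j h))"
    by (simp add: Delta_axis D)
  also have "\<dots> = Delta (\<alpha> + \<beta> + axis j 1) h" by (simp add: step Delta_axis)
  finally show ?case by (simp add: algebra_simps)
qed simp

subsection \<open>Falling factorials\<close>

definition ff :: "nat ^ 'n::finite \<Rightarrow> int ^ 'n \<Rightarrow> complex" where
  "ff \<alpha> m = (\<Prod>j\<in>UNIV. \<Prod>i<\<alpha> $ j. of_int (m $ j) - of_nat i)"

lemma ff_0 [simp]: "ff 0 m = 1"
  by (simp add: ff_def)

lemma ff_axis: "ff (\<alpha> + axis j 1) m = (of_int (m $ j) - of_nat (\<alpha> $ j)) * ff \<alpha> m"
proof -
  have "ff (\<alpha> + axis j 1) m = (\<Prod>i\<in>UNIV. (if i = j then of_int (m $ j) - of_nat (\<alpha> $ j) else 1) *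
      (\<Prod>l<\<alpha> $ i. of_int (m $ i) - of_nat l))"
    unfolding ff_def by (rule prod.cong) (auto simp: axis_def One_nat_def)
  also have "\<dots> = (of_int (m $ j) - of_nat (\<alpha> $ j)) * ff \<alpha> m"
    by (simp add: prod.distrib ff_def)
  finally show ?thesis .
qed

lemma ff_at_0: "ff \<alpha> 0 = (if \<alpha> = 0 then 1 else 0)"
proof (cases "\<alpha> = 0")
  case False
  then obtain j where "\<alpha> $ j \<noteq> 0" by (auto simp: vec_eq_iff)
  then have "(\<Prod>i<\<alpha> $ j. of_int ((0 :: int ^ 'a) $ j) - of_nat i :: complex) = 0"
    by (intro prod_zero) auto
  then show ?thesis using False unfolding ff_def by (auto intro!: prod_zero)
qed simp

text \<open>The discrete counterpart of differentiating a power: the factor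
  \<open>Suc (\<gamma> $ j)\<close> later cancels against \<open>mi_fact\<close>.\<close>

lemma ff_shift:
  "ff (\<gamma> + axis j 1) (m + axis j 1) = ff (\<gamma> + axis j 1) m + of_nat (Suc (\<gamma> $ j)) * ff \<gamma> m"
proof -
  \<comment> \<open>After the shift, the first factor splits off and the rest is the unshifted
    product with one factor fewer.\<close>
  have 1: "(\<Prod>i<Suc r. (a + 1) - of_nat i) = (a + 1) * (\<Prod>i<r. a - of_nat i)"
    for a :: complex and r
    unfolding prod.lessThan_Suc_shift by (simp add: algebra_simps)
  have "ff (\<gamma> + axis j 1) (m + axis j 1) =
    (\<Prod>i\<in>UNIV. (if i = j then of_int (m $ j) + 1 else 1) * (\<Prod>l<\<gamma> $ i. of_int (m $ i) - of_nat l))"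
    unfolding ff_def
    by (rule prod.cong) (auto simp: axis_def 1 One_nat_def simp del: prod.lessThan_Suc)
  also have "\<dots> = (of_int (m $ j) + 1) * ff \<gamma> m"
    by (simp add: prod.distrib ff_def)
  finally show ?thesis by (simp add: ff_axis algebra_simps)
qed

lemma ff_shift_zero: "\<gamma> $ j = 0 \<Longrightarrow> ff \<gamma> (m + axis j 1) = ff \<gamma> m"
  unfolding ff_def by (rule prod.cong) (auto simp: axis_def)

lemma norm_ff_le: "\<exists>C>0. \<forall>m. norm (ff \<alpha> m) \<le> C * weight m ^ mi_order \<alpha>"
proof (induction \<alpha> rule: mi_induct)
  case zero
  show ?case by (intro exI[of _ 1]) simp
next
  case (step \<alpha> j)
  then obtain C where C: "C > 0" "\<And>m. norm (ff \<alpha> m) \<le> C * weight m ^ mi_order \<alpha>" by blast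
  have "norm (ff (\<alpha> + axis j 1) m) \<le> ((1 + real (\<alpha> $ j)) * C) * weight m ^ mi_order (\<alpha> + axis j 1)" for m
  proof -
    have "norm (of_int (m $ j) - of_nat (\<alpha> $ j) :: complex) \<le> \<bar>real_of_int (m $ j)\<bar> + real (\<alpha> $ j)"
      by (rule order_trans[OF norm_triangle_ineq4]) simp
    also have "\<dots> \<le> weight m + real (\<alpha> $ j) * weight m"
      using abs_component_le_weight[of m j] weight_ge_1[of m]
      by (intro add_mono) (simp_all add: mult_le_cancel_left1)
    finally have "norm (of_int (m $ j) - of_nat (\<alpha> $ j) :: complex) \<le> (1 + real (\<alpha> $ j)) * weight m"
      by (simp add: algebra_simps)
    then have "norm (ff (\<alpha> + axis j 1) m) \<le> ((1 + real (\<alpha> $ j)) * weight m) * (C * weight m ^ mi_order \<alpha>)"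
      unfolding ff_axis norm_mult by (intro mult_mono C(2)) auto
    then show ?thesis by (simp add: algebra_simps)
  qed
  then show ?case using C(1) by (intro exI[of _ "(1 + real (\<alpha> $ j)) * C"]) (simp add: add_pos_nonneg)
qed

text \<open>These are the polynomials in \<open>m\<close> of degree at most \<open>d\<close>,
  generated by the multipliers for which symbol estimates are given directly.\<close>

inductive ffspan :: "nat \<Rightarrow> (int ^ 'n::finite \<Rightarrow> complex) \<Rightarrow> bool" for d where
  base: "mi_order \<gamma> \<le> d \<Longrightarrow> ffspan d (ff \<gamma>)"
| add: "ffspan d P \<Longrightarrow> ffspan d Q \<Longrightarrow> ffspan d (\<lambda>m. P m + Q m)"
| scale: "ffspan d P \<Longrightarrow> ffspan d (\<lambda>m. c * P m)"

text \<open>On a generator, m_j - c splits into (m_j - \<gamma>_j) + (\<gamma>_j - c): the first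
  summand raises the falling factorial, the second only rescales it.\<close>

lemma ffspan_mult_linear: "ffspan d P \<Longrightarrow> ffspan (Suc d) (\<lambda>m. (of_int (m $ j) - c) * P m)"
proof (induction rule: ffspan.induct)
  case (base \<gamma>)
  have "(\<lambda>m. (of_int (m $ j) - c) * ff \<gamma> m) =
      (\<lambda>m. ff (\<gamma> + axis j 1) m + (of_nat (\<gamma> $ j) - c) * ff \<gamma> m)"
    by (rule ext) (simp add: ff_axis algebra_simps)
  moreover have "ffspan (Suc d) (\<lambda>m. ff (\<gamma> + axis j 1) m + (of_nat (\<gamma> $ j) - c) * ff \<gamma> m)"
    using base by (intro ffspan.intros) auto
  ultimately show ?case by simp
next
  case (add P Q)
  then show ?case using ffspan.add[OF add.IH] by (simp add: algebra_simps)
next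
  case (scale P a)
  then show ?case using ffspan.scale[OF scale.IH, of a] by (simp add: algebra_simps)
qed

lemma ffspan_one: "ffspan 0 (\<lambda>m :: int ^ 'n::finite. 1)"
proof -
  have "ff 0 = (\<lambda>m :: int ^ 'n. 1)" by (rule ext) simp
  moreover have "ffspan 0 (ff (0 :: nat ^ 'n))" by (rule ffspan.base) simp
  ultimately show ?thesis by metis
qed

lemma ffspan_component_power: "ffspan M (\<lambda>m. of_int (m $ j) ^ M)"
proof (induction M)
  case 0
  show ?case using ffspan_one by simp
next
  case (Suc M)
  show ?case using ffspan_mult_linear[OF Suc, of j 0] by simp
qed

lemma ffspan_mult_ff: "ffspan d P \<Longrightarrow> ffspan (mi_order \<beta> + d) (\<lambda>m. ff \<beta> m * P m)"
proof (induction \<beta> rule: mi_induct)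
  case (step \<beta> j)
  show ?case
    using ffspan_mult_linear[OF step(1)[OF step(2)], of j "of_nat (\<beta> $ j)"]
    by (simp add: ff_axis mult.assoc)
qed simp

text \<open>Negating \<open>m\<close> turns falling into rising factorials, which are in general not
  multiples of a single \<open>ff\<close> but still lie in the span of the same degree.\<close>

lemma ffspan_ff_uminus: "ffspan (mi_order \<beta>) (\<lambda>m. ff \<beta> (- m))"
proof (induction \<beta> rule: mi_induct)
  case zero
  show ?case using ffspan_one by simp
next
  case (step \<beta> j)
  have "ffspan (mi_order (\<beta> + axis j 1)) (\<lambda>m. (-1) * ((of_int (m $ j) - (- of_nat (\<beta> $ j))) * ff \<beta> (- m)))"
    using ffspan_mult_linear[OF step, of j "- of_nat (\<beta> $ j)"] by (intro ffspan.scale) simp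
  also have "(\<lambda>m. (-1) * ((of_int (m $ j) - (- of_nat (\<beta> $ j))) * ff \<beta> (- m))) = (\<lambda>m. ff (\<beta> + axis j 1) (- m))"
    by (rule ext) (simp add: ff_axis algebra_simps)
  finally show ?case .
qed

subsection \<open>The discrete Taylor formula\<close>

definition taylor_term :: "nat ^ 'n::{finite,linorder} \<Rightarrow> (int ^ 'n::_ \<Rightarrow> complex) \<Rightarrow> int ^ 'n::_ \<Rightarrow> int ^ 'n::_ \<Rightarrow> complex" where
  "taylor_term \<alpha> h k m = 1 / of_nat (mi_fact \<alpha>) * (ff \<alpha> m * Delta \<alpha> h k)"

definition taylor_rem :: "nat \<Rightarrow> (int ^ 'n::{finite,linorder} \<Rightarrow> complex) \<Rightarrow> int ^ 'n::_ \<Rightarrow> int ^ 'n::_ \<Rightarrow> complex" where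
  "taylor_rem N h k m = h (k + m) - (\<Sum>\<alpha> | mi_order \<alpha> < N. taylor_term \<alpha> h k m)"

text \<open>Terms with \<alpha> \<noteq> 0 vanish at 0 and the term with \<alpha> = 0 cancels
  \<open>h k\<close>. That term is present only from order 1 on, hence \<open>Suc N\<close>.\<close>

lemma taylor_rem_at_0: "taylor_rem (Suc N) h k 0 = 0"
proof -
  have "(\<Sum>\<alpha> | mi_order \<alpha> < Suc N. taylor_term \<alpha> h k 0) = (\<Sum>\<alpha>\<in>{0}. taylor_term \<alpha> h k 0)"
    by (rule sum.mono_neutral_right)
       (auto simp: finite_mi_order_less taylor_term_def ff_at_0 simp del: mi_order_eq_0_iff)
  then show ?thesis by (simp add: taylor_rem_def taylor_term_def mi_fact_def)
qed

lemma taylor_term_shift_axis: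
  "taylor_term (\<gamma> + axis j 1) h k (m + axis j 1) - taylor_term (\<gamma> + axis j 1) h k m =
     taylor_term \<gamma> (diff_op j h) k m"
proof -
  have "1 / (s * a) * ((F + s * f) * D) - 1 / (s * a) * (F * D) = 1 / a * (f * D)"
    if "a \<noteq> 0" "s \<noteq> 0" for a s F f D :: complex
    using that by (simp add: divide_simps) (simp add: algebra_simps)
  from this[of "of_nat (mi_fact \<gamma>)" "of_nat (Suc (\<gamma> $ j))"] show ?thesis
    unfolding taylor_term_def ff_shift mi_fact_axis Delta_axis of_nat_mult
    by (simp del: of_nat_Suc)
qed

text \<open>Terms with \<alpha>_j = 0 do not depend on m_j and drop out of the difference; the
  others are indexed by \<open>\<gamma> + axis j 1\<close> and become the Taylor terms of
  \<open>diff_op j h\<close>. A difference in \<open>m\<close> thus lowers the order of the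
  remainder by one.\<close>

lemma taylor_rem_shift:
  fixes h :: "int ^ 'n::{finite,linorder} \<Rightarrow> complex"
  shows "taylor_rem (Suc N) h k (m + axis j 1) - taylor_rem (Suc N) h k m = taylor_rem N (diff_op j h) k m"
proof -
  define D where "D \<alpha> = taylor_term \<alpha> h k (m + axis j 1) - taylor_term \<alpha> h k m" for \<alpha>
  have "(\<Sum>\<alpha> | mi_order \<alpha> < Suc N. D \<alpha>) = (\<Sum>\<alpha>\<in>(\<lambda>\<gamma>. \<gamma> + axis j 1) ` {\<gamma>. mi_order \<gamma> < N}. D \<alpha>)"
  proof (rule sum.mono_neutral_right)
    show "finite {\<alpha> :: nat ^ 'n::_. mi_order \<alpha> < Suc N}" by (rule finite_mi_order_less)
    show "\<forall>\<alpha>\<in>{\<alpha>. mi_order \<alpha> < Suc N} - (\<lambda>\<gamma>. \<gamma> + axis j 1) ` {\<gamma>. mi_order \<gamma> < N}. D \<alpha> = 0"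
    proof
      fix \<alpha> :: "nat ^ 'n::_" assume *: "\<alpha> \<in> {\<alpha>. mi_order \<alpha> < Suc N} - (\<lambda>\<gamma>. \<gamma> + axis j 1) ` {\<gamma>. mi_order \<gamma> < N}"
      have "\<alpha> $ j = 0"
      proof (rule ccontr)
        assume "\<alpha> $ j \<noteq> 0"
        then obtain \<gamma> where "\<alpha> = \<gamma> + axis j 1" by (rule mi_decompose)
        with * show False by auto
      qed
      then show "D \<alpha> = 0" by (simp add: D_def taylor_term_def ff_shift_zero)
    qed
  qed auto
  also have "\<dots> = (\<Sum>\<gamma> | mi_order \<gamma> < N. D (\<gamma> + axis j 1))"
    by (subst sum.reindex) (auto simp: inj_on_def)
  also have "\<dots> = (\<Sum>\<gamma> | mi_order \<gamma> < N. taylor_term \<gamma> (diff_op j h) k m)"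
    by (simp add: D_def taylor_term_shift_axis)
  finally have "(\<Sum>\<alpha> | mi_order \<alpha> < Suc N. taylor_term \<alpha> h k (m + axis j 1)) -
      (\<Sum>\<alpha> | mi_order \<alpha> < Suc N. taylor_term \<alpha> h k m) = (\<Sum>\<gamma> | mi_order \<gamma> < N. taylor_term \<gamma> (diff_op j h) k m)"
    by (simp add: D_def sum_subtractf)
  moreover have "h (k + (m + axis j 1)) - h (k + m) = diff_op j h (k + m)"
    by (simp add: diff_op_def algebra_simps)
  ultimately show ?thesis unfolding taylor_rem_def by (simp add: algebra_simps)
qed

text \<open>One step of a shortest path towards 0. Its direction depends on the sign of the chosen
  coordinate, while \<open>taylor_rem_shift\<close> speaks of forward differences, hence the two
  cases.\<close>

lemma l1_step:
  fixes m :: "int ^ 'n::finite"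
  assumes "m \<noteq> 0"
  obtains j m' where "m = m' + axis j 1 \<or> m' = m + axis j 1" and "l1 m = Suc (l1 m')"
proof -
  obtain j where j: "m $ j \<noteq> 0" using assms by (auto simp: vec_eq_iff)
  have split: "l1 v = nat \<bar>v $ j\<bar> + (\<Sum>i\<in>UNIV - {j}. nat \<bar>v $ i\<bar>)" for v :: "int ^ 'n"
    unfolding l1_def by (rule sum.remove) auto
  show ?thesis
  proof (cases "m $ j > 0")
    case True
    have "(\<Sum>i\<in>UNIV - {j}. nat \<bar>(m - axis j 1) $ i\<bar>) = (\<Sum>i\<in>UNIV - {j}. nat \<bar>m $ i\<bar>)"
      by (rule sum.cong) (auto simp: axis_def)
    then have "l1 m = Suc (l1 (m - axis j 1))"
      unfolding split using True by (simp add: axis_def)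
    then show ?thesis by (intro that[of "m - axis j 1" j]) auto
  next
    case False
    have "(\<Sum>i\<in>UNIV - {j}. nat \<bar>(m + axis j 1) $ i\<bar>) = (\<Sum>i\<in>UNIV - {j}. nat \<bar>m $ i\<bar>)"
      by (rule sum.cong) (auto simp: axis_def)
    then have "l1 m = Suc (l1 (m + axis j 1))"
      unfolding split using False j by (simp add: axis_def)
    then show ?thesis by (intro that[of "m + axis j 1" j]) auto
  qed
qed

text \<open>The remainder of order \<open>N + 1\<close> is summed up along a lattice path from \<open>0\<close> to \<open>m\<close> whose
  increments are remainders of order \<open>N\<close> of first differences.\<close>

lemma norm_taylor_rem_le:
  fixes h :: "int ^ 'n::{finite,linorder} \<Rightarrow> complex"
  assumes "\<And>\<alpha> m'. mi_order \<alpha> = N \<Longrightarrow> l1 m' \<le> r \<Longrightarrow> norm (Delta \<alpha> h (k + m')) \<le> B"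
    and "l1 m \<le> r"
  shows "norm (taylor_rem N h k m) \<le> B * real r ^ N"
  using assms
proof (induction N arbitrary: h m)
  case 0
  then show ?case using "0.prems"(1)[of 0 m] by (simp add: taylor_rem_def)
next
  case (Suc N)
  have step: "norm (taylor_rem N (diff_op j h) k m') \<le> B * real r ^ N" if "l1 m' \<le> r" for j m'
  proof (rule Suc.IH[OF _ that])
    fix \<alpha> :: "nat ^ 'n::_" and m'' :: "int ^ 'n::_" assume "mi_order \<alpha> = N" "l1 m'' \<le> r"
    then show "norm (Delta \<alpha> (diff_op j h) (k + m'')) \<le> B"
      using Suc.prems(1)[of "\<alpha> + axis j 1" m''] by (simp add: Delta_axis)
  qed
  \<comment> \<open>Here \<open>r\<close> stays fixed while \<open>m\<close> runs along the path, so
    the bound for order \<open>N\<close> applies at every step; \<open>l1 m\<close> counts the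
    steps.\<close>
  have "norm (taylor_rem (Suc N) h k m) \<le> real (l1 m) * (B * real r ^ N)" if "l1 m \<le> r" for m
    using that
  proof (induction "l1 m" arbitrary: m)
    case 0
    then have "m = 0" by (auto simp: l1_def vec_eq_iff)
    then show ?case by (simp add: taylor_rem_at_0 l1_def)
  next
    case (Suc s)
    then have "m \<noteq> 0" by (auto simp: l1_def)
    then obtain j m' where m': "m = m' + axis j 1 \<or> m' = m + axis j 1" "l1 m = Suc (l1 m')"
      by (rule l1_step)
    have IH: "norm (taylor_rem (Suc N) h k m') \<le> real (l1 m') * (B * real r ^ N)"
      using Suc m' by auto
    \<comment> \<open>The forward difference is based at the end of the edge with the smaller j-th
      coordinate, which is \<open>m'\<close> or \<open>m\<close>; both have \<open>l1\<close> at
      most \<open>r\<close>.\<close>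
    obtain m'' where m'': "l1 m'' \<le> r"
      "norm (taylor_rem (Suc N) h k m - taylor_rem (Suc N) h k m') = norm (taylor_rem N (diff_op j h) k m'')"
    proof (cases "m = m' + axis j 1")
      case True
      show ?thesis
        by (rule that[of m']) (use True Suc.prems m' taylor_rem_shift[of N h k m' j] in auto)
    next
      case False
      then have "m' = m + axis j 1" using m' by simp
      moreover have "norm (taylor_rem (Suc N) h k m - taylor_rem (Suc N) h k m') =
          norm (taylor_rem (Suc N) h k m' - taylor_rem (Suc N) h k m)"
        by (rule norm_minus_commute)
      ultimately show ?thesis
        by (intro that[of m]) (use Suc.prems taylor_rem_shift[of N h k m j] in auto)
    qed
    have "norm (taylor_rem (Suc N) h k m) \<le>
        norm (taylor_rem (Suc N) h k m') + norm (taylor_rem (Suc N) h k m - taylor_rem (Suc N) h k m')"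
      using norm_triangle_sub by blast
    also have "\<dots> \<le> real (l1 m') * (B * real r ^ N) + B * real r ^ N"
      using IH m'' step[OF m''(1)] by (intro add_mono) auto
    finally show ?case using m'(2) by (simp add: algebra_simps)
  qed
  from this[OF Suc.prems(2)] have "norm (taylor_rem (Suc N) h k m) \<le> real (l1 m) * (B * real r ^ N)" .
  also have "\<dots> \<le> real r * (B * real r ^ N)"
  proof (rule mult_right_mono)
    \<comment> \<open>Nonnegativity of \<open>B * real r ^ N\<close> is read off from the step
      estimate in an arbitrary coordinate.\<close>
    have "0 \<le> norm (taylor_rem N (diff_op undefined h) k m)" by simp
    then show "0 \<le> B * real r ^ N" using step[OF Suc.prems(2), of undefined] by linarith
  qed (use Suc.prems in simp)
  finally show ?case by (simp add: algebra_simps)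
qed

subsection \<open>Characters of the torus\<close>

definition echar :: "int ^ 'n::finite \<Rightarrow> real ^ 'n \<Rightarrow> complex" where
  "echar m x = exp (2 * of_real pi * \<i> * of_real (lattice_vec m \<bullet> x))"

lemma echar_0 [simp]: "echar 0 x = 1" "echar m 0 = 1"
  by (simp_all add: echar_def)

lemma echar_add: "echar (k + m) x = echar k x * echar m x"
  by (simp add: echar_def exp_add[symmetric] inner_add_left algebra_simps)

lemma echar_add_right: "echar m (x + y) = echar m x * echar m y"
  by (simp add: echar_def exp_add[symmetric] inner_add_right algebra_simps)

lemma echar_minus_right: "echar m (- x) = echar (- m) x"
  by (simp add: echar_def)

lemma norm_echar [simp]: "norm (echar m x) = 1"
  by (simp add: echar_def)

lemma echar_lattice_vec: "echar m (lattice_vec k) = 1"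
proof -
  have "lattice_vec m \<bullet> lattice_vec k = of_int (\<Sum>j\<in>UNIV. m $ j * k $ j)"
    by (simp add: inner_vec_def)
  then have "echar m (lattice_vec k) =
      exp (2 * of_int (\<Sum>j\<in>UNIV. m $ j * k $ j) * of_real pi * \<i>)"
    by (simp add: echar_def mult_ac)
  also have "\<dots> = 1"
    using exp_integer_2pi[OF Ints_of_int, of "\<Sum>j\<in>UNIV. m $ j * k $ j"]
    by (simp only: of_real_mult of_real_of_int_eq of_real_numeral)
  finally show ?thesis .
qed

lemma echar_periodic: "echar m (x + lattice_vec k) = echar m x"
  by (simp add: echar_add_right echar_lattice_vec)

lemma continuous_on_echar [continuous_intros]: "continuous_on S (echar m)"
  unfolding echar_def by (intro continuous_intros)

text \<open>The exponent is purely imaginary, so the Taylor remainder of the exponential is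
  quadratic for every \<open>h\<close>, however large. Rapidly decreasing coefficients absorb the
  squared weight.\<close>

lemma norm_echar_diff_le:
  "norm (echar m (x + h) - echar m x - 2 * of_real pi * \<i> * of_real (lattice_vec m \<bullet> h) * echar m x)
     \<le> (2 * pi)\<^sup>2 * (weight m)\<^sup>2 * (norm h)\<^sup>2"
proof -
  define z where "z = 2 * of_real pi * \<i> * of_real (lattice_vec m \<bullet> h)"
  have "norm (exp z - (\<Sum>k\<le>Suc 0. z ^ k / fact k)) \<le> exp \<bar>Re z\<bar> * norm z ^ Suc (Suc 0) / fact (Suc 0)"
    by (rule Taylor_exp)
  moreover have "Re z = 0" by (simp add: z_def)
  ultimately have 1: "norm (exp z - 1 - z) \<le> (norm z)\<^sup>2"
    by (simp add: power2_eq_square diff_diff_eq)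
  have "\<bar>lattice_vec m \<bullet> h\<bar> \<le> norm (lattice_vec m) * norm h" by (rule Cauchy_Schwarz_ineq2)
  also have "\<dots> \<le> weight m * norm h" by (intro mult_right_mono) (auto simp: weight_def)
  finally have "norm z \<le> 2 * pi * (weight m * norm h)"
    by (simp add: z_def norm_mult)
  then have "(norm z)\<^sup>2 \<le> (2 * pi * (weight m * norm h))\<^sup>2" by (intro power_mono) auto
  with 1 have 2: "norm (exp z - 1 - z) \<le> (2 * pi)\<^sup>2 * (weight m)\<^sup>2 * (norm h)\<^sup>2"
    by (simp add: power_mult_distrib mult.assoc)
  have "echar m (x + h) - echar m x - z * echar m x = (exp z - 1 - z) * echar m x"
    unfolding echar_add_right by (simp add: echar_def[of m h] z_def algebra_simps)
  then have "norm (echar m (x + h) - echar m x - z * echar m x) = norm (exp z - 1 - z)"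
    by (simp add: norm_mult)
  then show ?thesis using 2 by (simp add: z_def)
qed

subsection \<open>Trigonometric series\<close>

lemma rapidly_decreasing_summable:
  assumes "rapidly_decreasing c"
  shows "(\<lambda>m :: int ^ 'n::finite. norm (c m) * weight m ^ K) summable_on UNIV"
proof -
  obtain C where C: "\<And>m. norm (c m) \<le> C / weight m ^ (K + 2 * CARD('n))"
    using assms unfolding rapidly_decreasing_def by blast
  have "(\<lambda>m :: int ^ 'n. C * (1 / weight m ^ (2 * CARD('n)))) summable_on UNIV"
    by (intro summable_on_cmult_right summable_on_inverse_weight_power)
  then show ?thesis
  proof (rule summable_on_comparison_test)
    fix m
    have "norm (c m) * weight m ^ K \<le> C / weight m ^ (K + 2 * CARD('n)) * weight m ^ K"
      by (intro mult_right_mono C) auto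
    then show "norm (c m) * weight m ^ K \<le> C * (1 / weight m ^ (2 * CARD('n)))"
      by (simp add: power_add)
  qed auto
qed

lemma rapidly_decreasing_abs_summable: "rapidly_decreasing c \<Longrightarrow> (\<lambda>m. norm (c m)) summable_on UNIV"
  using rapidly_decreasing_summable[of c 0] by simp

lemma rapidly_decreasing_mult:
  assumes "rapidly_decreasing c" "\<And>m. norm (P m) \<le> A * weight m ^ K"
  shows "rapidly_decreasing (\<lambda>m. P m * c m)"
  unfolding rapidly_decreasing_def
proof
  fix M
  obtain C where C: "\<And>m. norm (c m) \<le> C / weight m ^ (K + M)"
    using assms unfolding rapidly_decreasing_def by blast
  have "norm (P m * c m) \<le> A * C / weight m ^ M" for m
  proof -
    have "norm (P m * c m) \<le> (A * weight m ^ K) * (C / weight m ^ (K + M))"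
      unfolding norm_mult using assms(2)[of m] by (intro mult_mono C) (auto intro: order_trans[OF norm_ge_zero])
    then show ?thesis by (simp add: power_add)
  qed
  then show "\<exists>C. \<forall>m. norm (P m * c m) \<le> C / weight m ^ M" by blast
qed

lemma rapidly_decreasing_diff:
  assumes "rapidly_decreasing c" "rapidly_decreasing d"
  shows "rapidly_decreasing (\<lambda>m. c m - d m)"
  unfolding rapidly_decreasing_def
proof
  fix M
  obtain C D where C: "\<And>m. norm (c m) \<le> C / weight m ^ M" and D: "\<And>m. norm (d m) \<le> D / weight m ^ M"
    using assms unfolding rapidly_decreasing_def by blast
  have "norm (c m - d m) \<le> (C + D) / weight m ^ M" for m
    using norm_triangle_ineq4[of "c m" "d m"] C[of m] D[of m] by (simp add: add_divide_distrib)
  then show "\<exists>C. \<forall>m. norm (c m - d m) \<le> C / weight m ^ M" by blast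
qed

lemma rapidly_decreasing_cmult:
  "rapidly_decreasing c \<Longrightarrow> rapidly_decreasing (\<lambda>m. a * c m)"
  by (rule rapidly_decreasing_mult[where A = "norm a" and K = 0]) auto

lemma rapidly_decreasing_zero: "rapidly_decreasing (\<lambda>m. 0)"
  unfolding rapidly_decreasing_def by (auto intro: exI[of _ 0])

lemma rapidly_decreasing_add:
  assumes "rapidly_decreasing c" "rapidly_decreasing d"
  shows "rapidly_decreasing (\<lambda>m. c m + d m)"
  using rapidly_decreasing_diff[OF assms(1) rapidly_decreasing_cmult[OF assms(2), of "-1"]] by simp

lemma rapidly_decreasing_sum:
  "(\<And>i. i \<in> I \<Longrightarrow> rapidly_decreasing (c i)) \<Longrightarrow> rapidly_decreasing (\<lambda>m. \<Sum>i\<in>I. c i m)"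
  by (induction I rule: infinite_finite_induct)
     (simp_all add: rapidly_decreasing_zero rapidly_decreasing_add)

lemma rapidly_decreasing_ff: "rapidly_decreasing c \<Longrightarrow> rapidly_decreasing (\<lambda>m. ff \<alpha> m * c m)"
  using norm_ff_le[of \<alpha>] rapidly_decreasing_mult by metis

lemma rapidly_decreasing_uminus: "rapidly_decreasing c \<Longrightarrow> rapidly_decreasing (\<lambda>m. c (- m))"
  unfolding rapidly_decreasing_def by (metis weight_minus)

lemma rapidly_decreasing_Delta:
  assumes "\<And>k. rapidly_decreasing (b k)"
  shows "rapidly_decreasing (\<lambda>m. Delta \<alpha> (\<lambda>l. b l m) k)"
  using assms
proof (induction \<alpha> arbitrary: b k rule: mi_induct)
  case (step \<alpha> j)
  have "rapidly_decreasing (\<lambda>m. Delta \<alpha> (\<lambda>l. b (l + axis j 1) m - b l m) k)"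
    by (rule step(1)) (intro rapidly_decreasing_diff step(2))
  then show ?case by (simp add: Delta_axis diff_op_def[abs_def])
qed simp

definition trig_series :: "(int ^ 'n::finite \<Rightarrow> complex) \<Rightarrow> real ^ 'n \<Rightarrow> complex" where
  "trig_series c x = (\<Sum>\<^sub>\<infinity>m. c m * echar m x)"

lemma trig_series_summable:
  assumes "(\<lambda>m. norm (c m)) summable_on UNIV"
  shows "(\<lambda>m. c m * echar m x) summable_on UNIV"
  by (rule abs_summable_summable) (use assms in \<open>simp add: norm_mult\<close>)

lemma norm_trig_series_le:
  assumes "(\<lambda>m. norm (c m)) summable_on UNIV"
  shows "norm (trig_series c x) \<le> (\<Sum>\<^sub>\<infinity>m. norm (c m))"
  unfolding trig_series_def
  by (rule order_trans[OF norm_infsum_bound]) (use assms in \<open>simp_all add: norm_mult\<close>)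

lemma trig_series_add:
  assumes "rapidly_decreasing c" "rapidly_decreasing d"
  shows "trig_series (\<lambda>m. c m + d m) x = trig_series c x + trig_series d x"
  unfolding trig_series_def
  using assms[THEN rapidly_decreasing_abs_summable, THEN trig_series_summable]
  by (simp add: infsum_add[symmetric] distrib_right)

lemma trig_series_cmult: "trig_series (\<lambda>m. a * c m) x = a * trig_series c x"
  unfolding trig_series_def by (simp add: infsum_cmult_right'[symmetric] mult.assoc)

lemma trig_series_diff:
  assumes "rapidly_decreasing c" "rapidly_decreasing d"
  shows "trig_series (\<lambda>m. c m - d m) x = trig_series c x - trig_series d x"
  using trig_series_add[OF assms(1) rapidly_decreasing_cmult[OF assms(2), of "-1"]]
  by (simp only: trig_series_cmult) simp

lemma trig_series_sum:
  assumes "\<And>i. i \<in> I \<Longrightarrow> rapidly_decreasing (c i)"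
  shows "trig_series (\<lambda>m. \<Sum>i\<in>I. c i m) x = (\<Sum>i\<in>I. trig_series (c i) x)"
  using assms
proof (induction I rule: infinite_finite_induct)
  case (insert i I)
  then show ?case by (simp add: trig_series_add rapidly_decreasing_sum)
qed (simp_all add: trig_series_def)

lemma trig_series_minus_right: "trig_series c (- x) = trig_series (\<lambda>m. c (- m)) x"
proof -
  have "(\<Sum>\<^sub>\<infinity>m. c m * echar m (- x)) = (\<Sum>\<^sub>\<infinity>m. c (- m) * echar (- m) (- x))"
    by (rule infsum_reindex_bij_betw[symmetric]) (rule bij_uminus)
  then show ?thesis by (simp add: trig_series_def echar_minus_right)
qed

lemma Delta_trig_series:
  assumes "\<And>k. rapidly_decreasing (b k)"
  shows "Delta \<alpha> (\<lambda>l. trig_series (b l) x) k = trig_series (\<lambda>m. Delta \<alpha> (\<lambda>l. b l m) k) x"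
  using assms
proof (induction \<alpha> arbitrary: b k rule: mi_induct)
  case (step \<alpha> j)
  have "Delta \<alpha> (\<lambda>l. trig_series (\<lambda>m. b (l + axis j 1) m - b l m) x) k =
      trig_series (\<lambda>m. Delta \<alpha> (\<lambda>l. b (l + axis j 1) m - b l m) k) x"
    by (rule step(1)) (intro rapidly_decreasing_diff step(2))
  then show ?case by (simp add: Delta_axis diff_op_def[abs_def] trig_series_diff step(2))
qed simp

lemma trig_series_periodic: "trig_series c (x + lattice_vec k) = trig_series c x"
  by (simp add: trig_series_def echar_periodic)

text \<open>The factor \<open>u\<close> serves two purposes: the constant 1 gives continuity of the
  sum, a general \<open>u\<close> gives termwise integration against it.\<close>

lemma uniform_limit_trig_series:
  assumes "(\<lambda>m. norm (c m)) summable_on UNIV"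
    and "\<And>x. x \<in> S \<Longrightarrow> norm (u x) \<le> B"
  shows "uniform_limit S (\<lambda>X x. \<Sum>m\<in>X. u x * (c m * echar m x)) (\<lambda>x. u x * trig_series c x)
           (finite_subsets_at_top UNIV)"
proof -
  have "uniform_limit S (\<lambda>X x. \<Sum>m\<in>X. u x * (c m * echar m x)) (\<lambda>x. \<Sum>\<^sub>\<infinity>m. u x * (c m * echar m x))
           (finite_subsets_at_top UNIV)"
  proof (rule Weierstrass_m_test_general)
    show "(\<lambda>m. B * norm (c m)) summable_on UNIV" by (intro summable_on_cmult_right assms)
    show "norm (u x * (c m * echar m x)) \<le> B * norm (c m)" if "x \<in> S" for m x
      using assms(2)[OF that] by (simp add: norm_mult mult_right_mono)
  qed
  then show ?thesis by (simp add: infsum_cmult_right' trig_series_def)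
qed

lemma continuous_on_trig_series:
  assumes "(\<lambda>m. norm (c m)) summable_on UNIV"
  shows "continuous_on S (trig_series c)"
proof (rule uniform_limit_theorem)
  show "uniform_limit S (\<lambda>X x. \<Sum>m\<in>X. 1 * (c m * echar m x)) (trig_series c) (finite_subsets_at_top UNIV)"
    using uniform_limit_trig_series[OF assms, of S "\<lambda>x. 1" 1] by simp
  show "\<forall>\<^sub>F X in finite_subsets_at_top UNIV. continuous_on S (\<lambda>x. \<Sum>m\<in>X. 1 * (c m * echar m x))"
    by (intro always_eventually allI continuous_intros)
qed auto

text \<open>The linearisation errors of the terms are at most a constant times |h|^2 times
  \<open>norm (c m) * (weight m)\<^sup>2\<close>, which is summable, so the total error is
  O(|h|^2).\<close>

lemma has_derivative_trig_series:
  fixes c :: "int ^ 'n::finite \<Rightarrow> complex"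
  assumes rapid: "rapidly_decreasing c"
  shows "(trig_series c has_derivative
           (\<lambda>h. \<Sum>\<^sub>\<infinity>m. 2 * of_real pi * \<i> * of_real (lattice_vec m \<bullet> h) * (c m * echar m x))) (at x)"
proof -
  define L where "L h m = 2 * of_real pi * \<i> * of_real (lattice_vec m \<bullet> h) * (c m * echar m x)" for h m
  have s1: "(\<lambda>m. norm (c m) * weight m) summable_on UNIV"
    using rapidly_decreasing_summable[OF rapid, of 1] by simp
  have s2: "(\<lambda>m. norm (c m) * (weight m)\<^sup>2) summable_on UNIV"
    using rapidly_decreasing_summable[OF rapid, of 2] by simp
  have normL: "norm (L h m) \<le> 2 * pi * norm h * (norm (c m) * weight m)" for h m
  proof -
    have "\<bar>lattice_vec m \<bullet> h\<bar> \<le> norm (lattice_vec m) * norm h" by (rule Cauchy_Schwarz_ineq2)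
    also have "\<dots> \<le> weight m * norm h" by (intro mult_right_mono) (auto simp: weight_def)
    finally have "2 * pi * \<bar>lattice_vec m \<bullet> h\<bar> * norm (c m) \<le> 2 * pi * (weight m * norm h) * norm (c m)"
      by (intro mult_right_mono mult_left_mono) auto
    then show ?thesis by (simp add: L_def norm_mult mult_ac)
  qed
  have sLn: "(\<lambda>m. norm (L h m)) summable_on UNIV" for h
    by (rule summable_on_comparison_test[OF summable_on_cmult_right[OF s1, of "2 * pi * norm h"]])
       (use normL in auto)
  have sL: "(\<lambda>m. L h m) summable_on UNIV" for h
    by (rule abs_summable_summable[OF sLn])
  have sc: "(\<lambda>m. c m * echar m y) summable_on UNIV" for y
    by (intro trig_series_summable rapidly_decreasing_abs_summable rapid)
  have "bounded_linear (\<lambda>h. \<Sum>\<^sub>\<infinity>m. L h m)"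
  proof (rule bounded_linear_intro)
    show "(\<Sum>\<^sub>\<infinity>m. L (h + h') m) = (\<Sum>\<^sub>\<infinity>m. L h m) + (\<Sum>\<^sub>\<infinity>m. L h' m)" for h h'
      unfolding infsum_add[OF sL sL, symmetric] by (simp add: L_def inner_add_right algebra_simps)
    show "(\<Sum>\<^sub>\<infinity>m. L (r *\<^sub>R h) m) = r *\<^sub>R (\<Sum>\<^sub>\<infinity>m. L h m)" for r h
      unfolding infsum_scaleR_right[symmetric] by (simp add: L_def scaleR_conv_of_real[where 'a = complex] mult_ac)
    show "norm (\<Sum>\<^sub>\<infinity>m. L h m) \<le> norm h * (2 * pi * (\<Sum>\<^sub>\<infinity>m. norm (c m) * weight m))" for h
    proof -
      have "norm (\<Sum>\<^sub>\<infinity>m. L h m) \<le> (\<Sum>\<^sub>\<infinity>m. norm (L h m))" by (rule norm_infsum_bound[OF sLn])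
      also have "\<dots> \<le> (\<Sum>\<^sub>\<infinity>m. 2 * pi * norm h * (norm (c m) * weight m))"
        by (rule infsum_mono[OF sLn]) (use normL s1 in \<open>auto intro: summable_on_cmult_right\<close>)
      also have "\<dots> = 2 * pi * norm h * (\<Sum>\<^sub>\<infinity>m. norm (c m) * weight m)"
        by (rule infsum_cmult_right')
      finally show ?thesis by (simp only: mult_ac)
    qed
  qed
  moreover have "(\<lambda>h. norm (trig_series c (x + h) - trig_series c x - (\<Sum>\<^sub>\<infinity>m. L h m)) / norm h) \<midarrow>0\<rightarrow> 0"
  proof (rule tendsto_sandwich[where f = "\<lambda>h. 0"])
    define K where "K = (\<Sum>\<^sub>\<infinity>m. norm (c m) * (weight m)\<^sup>2)"
    show "\<forall>\<^sub>F h in at 0. norm (trig_series c (x + h) - trig_series c x - (\<Sum>\<^sub>\<infinity>m. L h m)) / norm h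
        \<le> (2 * pi)\<^sup>2 * K * norm h"
    proof (intro always_eventually allI)
      fix h :: "real ^ 'n"
      define R where "R m = c m * echar m (x + h) - c m * echar m x - L h m" for m
      have R: "norm (R m) \<le> (2 * pi)\<^sup>2 * (norm h)\<^sup>2 * (norm (c m) * (weight m)\<^sup>2)" for m
      proof -
        have "R m = c m * (echar m (x + h) - echar m x -
            2 * of_real pi * \<i> * of_real (lattice_vec m \<bullet> h) * echar m x)"
          by (simp add: R_def L_def algebra_simps)
        then have "norm (R m) \<le> norm (c m) * ((2 * pi)\<^sup>2 * (weight m)\<^sup>2 * (norm h)\<^sup>2)"
          by (metis norm_mult mult_left_mono norm_ge_zero norm_echar_diff_le)
        then show ?thesis by (simp add: mult_ac)
      qed
      have sR: "(\<lambda>m. norm (R m)) summable_on UNIV"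
        by (rule summable_on_comparison_test[OF summable_on_cmult_right[OF s2, of "(2 * pi)\<^sup>2 * (norm h)\<^sup>2"]])
           (use R in auto)
      have "trig_series c (x + h) - trig_series c x - (\<Sum>\<^sub>\<infinity>m. L h m) = (\<Sum>\<^sub>\<infinity>m. R m)"
      proof -
        have sR': "R summable_on UNIV" by (rule abs_summable_summable[OF sR])
        have "(\<Sum>\<^sub>\<infinity>m. R m) + (\<Sum>\<^sub>\<infinity>m. L h m) + (\<Sum>\<^sub>\<infinity>m. c m * echar m x) = (\<Sum>\<^sub>\<infinity>m. R m + L h m + c m * echar m x)"
          by (simp add: infsum_add summable_on_add sR' sL sc)
        also have "\<dots> = (\<Sum>\<^sub>\<infinity>m. c m * echar m (x + h))" by (simp add: R_def)
        finally show ?thesis by (simp add: trig_series_def algebra_simps)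
      qed
      then have "norm (trig_series c (x + h) - trig_series c x - (\<Sum>\<^sub>\<infinity>m. L h m)) \<le> (\<Sum>\<^sub>\<infinity>m. norm (R m))"
        using norm_infsum_bound[OF sR] by simp
      also have "\<dots> \<le> (\<Sum>\<^sub>\<infinity>m. (2 * pi)\<^sup>2 * (norm h)\<^sup>2 * (norm (c m) * (weight m)\<^sup>2))"
        by (rule infsum_mono[OF sR]) (use R s2 in \<open>auto intro: summable_on_cmult_right\<close>)
      also have "\<dots> = (2 * pi)\<^sup>2 * (norm h)\<^sup>2 * K" by (simp only: infsum_cmult_right' K_def)
      finally show "norm (trig_series c (x + h) - trig_series c x - (\<Sum>\<^sub>\<infinity>m. L h m)) / norm h
        \<le> (2 * pi)\<^sup>2 * K * norm h"
        by (cases "h = 0") (simp_all add: divide_simps power2_eq_square mult_ac)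
    qed
    show "((\<lambda>h. (2 * pi)\<^sup>2 * K * norm h) \<longlongrightarrow> 0) (at (0 :: real ^ 'n))"
      by (rule tendsto_eq_intros refl | simp)+
  qed auto
  ultimately show ?thesis unfolding has_derivative_at L_def by blast
qed

lemma partial_deriv_eq:
  assumes "(g has_derivative g') (at x)"
  shows "partial_deriv j g x = g' (axis j 1)"
proof -
  have "((\<lambda>t. g (x + t *\<^sub>R axis j 1)) has_derivative (\<lambda>t. g' (t *\<^sub>R axis j 1))) (at 0)"
    by (rule has_derivative_compose[of "\<lambda>t. x + t *\<^sub>R axis j 1" "\<lambda>t. t *\<^sub>R axis j 1" 0 UNIV g g', simplified])
       (use assms in \<open>auto intro!: derivative_eq_intros\<close>)
  then have "((\<lambda>t. g (x + t *\<^sub>R axis j 1)) has_vector_derivative g' (axis j 1)) (at 0)"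
    unfolding has_vector_derivative_def
    using linear_scale[OF has_derivative_linear[OF assms]] by simp
  then show ?thesis unfolding partial_deriv_def by (rule vector_derivative_at)
qed

lemma partial_deriv_trig_series:
  assumes "rapidly_decreasing c"
  shows "partial_deriv j (trig_series c) = trig_series (\<lambda>m. 2 * of_real pi * \<i> * of_int (m $ j) * c m)"
  by (rule ext, subst partial_deriv_eq[OF has_derivative_trig_series[OF assms]])
     (simp add: trig_series_def inner_axis mult_ac)

lemma C_order_trig_series:
  "rapidly_decreasing c \<Longrightarrow> C_order M (trig_series c)"
proof (induction M arbitrary: c)
  case 0
  then show ?case by (simp add: continuous_on_trig_series rapidly_decreasing_abs_summable)
next
  case (Suc M)
  have "rapidly_decreasing (\<lambda>m. 2 * of_real pi * \<i> * of_int (m $ j) * c m)" for j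
  proof (rule rapidly_decreasing_mult[OF Suc.prems, where K = 1])
    show "norm (2 * of_real pi * \<i> * of_int (m $ j) :: complex) \<le> 2 * pi * weight m ^ 1" for m
      using abs_component_le_weight[of m j] by (simp add: norm_mult)
  qed
  moreover have "trig_series c differentiable_on UNIV"
    using has_derivative_trig_series[OF Suc.prems]
    by (auto simp: differentiable_on_def differentiable_def)
  ultimately show ?case by (simp add: partial_deriv_trig_series Suc)
qed

lemma smooth_torus_trig_series: "rapidly_decreasing c \<Longrightarrow> smooth_torus (trig_series c)"
  by (simp add: smooth_torus_def trig_series_periodic C_order_trig_series)

subsection \<open>Integration over the torus\<close>

lemma integrable_cube:
  fixes f :: "real ^ 'n::finite \<Rightarrow> complex"
  shows "continuous_on UNIV f \<Longrightarrow> f integrable_on cbox a b"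
  by (rule integrable_continuous) (rule continuous_on_subset, auto)

text \<open>Translating the unit cube along a coordinate axis cuts off a slab on one side and adds its
  integer translate on the other side.\<close>

lemma integral_periodic_translate:
  fixes G :: "real ^ 'n::finite \<Rightarrow> complex"
  assumes cont: "continuous_on UNIV G"
    and per: "\<And>x k. G (x + lattice_vec k) = G x"
    and t: "0 \<le> t" "t \<le> 1"
  shows "integral (cbox 0 1) (\<lambda>x. G (x + t *\<^sub>R axis j 1)) = integral (cbox 0 1) G"
proof -
  define a :: "real ^ 'n" where "a = axis j 1"
  have aB: "a \<in> Basis" by (auto simp: a_def Basis_vec_def)
  have inner_a: "x \<bullet> a = x $ j" for x :: "real ^ 'n" by (simp add: a_def inner_axis)
  have a_nth: "a $ i = (if i = j then 1 else 0)" for i by (simp add: a_def axis_def)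
  have mem: "x \<in> cbox l u \<longleftrightarrow>
      (l $ j \<le> x $ j \<and> x $ j \<le> u $ j) \<and> (\<forall>i. i \<noteq> j \<longrightarrow> l $ i \<le> x $ i \<and> x $ i \<le> u $ i)"
    for x l u :: "real ^ 'n"
    unfolding mem_box_cart by metis
  have "integral (cbox (t *\<^sub>R a - t *\<^sub>R a) (1 + t *\<^sub>R a - t *\<^sub>R a)) (\<lambda>x. G (x + t *\<^sub>R a)) =
      integral (cbox (t *\<^sub>R a) (1 + t *\<^sub>R a)) G"
    by (rule integral_shift_cbox)
  then have "integral (cbox 0 1) (\<lambda>x. G (x + t *\<^sub>R a)) = integral (cbox (t *\<^sub>R a) (1 + t *\<^sub>R a)) G"
    by simp
  also have "\<dots> = integral (cbox (t *\<^sub>R a) (1 + t *\<^sub>R a) \<inter> {x. x \<bullet> a \<le> 1}) G +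
      integral (cbox (t *\<^sub>R a) (1 + t *\<^sub>R a) \<inter> {x. x \<bullet> a \<ge> 1}) G"
    by (rule integral_split[OF integrable_cube[OF cont] aB])
  also have "cbox (t *\<^sub>R a) (1 + t *\<^sub>R a) \<inter> {x. x \<bullet> a \<le> 1} = cbox (t *\<^sub>R a) 1"
    using t by (auto simp: mem inner_a a_nth)
  also have "cbox (t *\<^sub>R a) (1 + t *\<^sub>R a) \<inter> {x. x \<bullet> a \<ge> 1} = cbox a (1 + t *\<^sub>R a)"
    using t by (auto simp: mem inner_a a_nth)
  also have "integral (cbox a (1 + t *\<^sub>R a)) G = integral (cbox (a - a) (1 + t *\<^sub>R a - a)) (\<lambda>x. G (x + a))"
    by (rule integral_shift_cbox[symmetric])
  also have "(\<lambda>x. G (x + a)) = G"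
    using per[of _ "axis j 1"] by (simp add: a_def)
  also have "cbox (a - a) (1 + t *\<^sub>R a - a) = cbox 0 1 \<inter> {x. x \<bullet> a \<le> t}"
    using t by (auto simp: mem inner_a a_nth)
  also have "cbox (t *\<^sub>R a) 1 = cbox 0 1 \<inter> {x. x \<bullet> a \<ge> t}"
    using t by (auto simp: mem inner_a a_nth)
  also have "integral (cbox 0 1 \<inter> {x. x \<bullet> a \<ge> t}) G + integral (cbox 0 1 \<inter> {x. x \<bullet> a \<le> t}) G =
      integral (cbox 0 1) G"
    using integral_split[OF integrable_cube[OF cont, of 0 1] aB, of t] by simp
  finally show ?thesis by (simp add: a_def)
qed

lemma has_vector_derivative_along_axis:
  assumes "g differentiable at (x + t *\<^sub>R axis j 1)"
  shows "((\<lambda>s. g (x + s *\<^sub>R axis j 1)) has_vector_derivative partial_deriv j g (x + t *\<^sub>R axis j 1)) (at t)"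
proof -
  obtain g' where g': "(g has_derivative g') (at (x + t *\<^sub>R axis j 1))"
    using assms by (auto simp: differentiable_def)
  have "((\<lambda>s. g (x + s *\<^sub>R axis j 1)) has_derivative (\<lambda>s. g' (s *\<^sub>R axis j 1))) (at t)"
    by (rule has_derivative_compose[of "\<lambda>s. x + s *\<^sub>R axis j 1" "\<lambda>s. s *\<^sub>R axis j 1" t UNIV g g', simplified])
       (use g' in \<open>auto intro!: derivative_eq_intros\<close>)
  then show ?thesis
    unfolding has_vector_derivative_def partial_deriv_eq[OF g']
    using linear_scale[OF has_derivative_linear[OF g']] by simp
qed

text \<open>The integral of G(x + s e_j) over the cube is the same for all s in [0, 1];
  differentiating under the integral at s = 0 gives the claim. The derivative is one-sided, so
  uniqueness of derivatives within a closed interval is invoked.\<close>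

lemma integral_partial_deriv_zero:
  fixes G :: "real ^ 'n::finite \<Rightarrow> complex"
  assumes diff: "\<And>x. G differentiable at x"
    and cont': "continuous_on UNIV (partial_deriv j G)"
    and per: "\<And>x k. G (x + lattice_vec k) = G x"
  shows "integral (cbox 0 1) (partial_deriv j G) = 0"
proof -
  define U where "U = cbox (0::real) 1"
  define a :: "real ^ 'n" where "a = axis j 1"
  have cont: "continuous_on UNIV G"
    using diff by (simp add: continuous_on_eq_continuous_at differentiable_imp_continuous_within)
  have "((\<lambda>s. integral (cbox 0 1) (\<lambda>x. G (x + s *\<^sub>R a))) has_vector_derivative
      integral (cbox 0 1) (\<lambda>x. partial_deriv j G (x + 0 *\<^sub>R a))) (at 0 within U)"
  proof (rule leibniz_rule_vector_derivative[where fx = "\<lambda>s x. partial_deriv j G (x + s *\<^sub>R a)"])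
    show "((\<lambda>s. G (x + s *\<^sub>R a)) has_vector_derivative partial_deriv j G (x + t *\<^sub>R a)) (at t within U)" for t x
      unfolding a_def
      by (rule has_vector_derivative_at_within, rule has_vector_derivative_along_axis, rule diff)
    show "(\<lambda>x. G (x + s *\<^sub>R a)) integrable_on cbox 0 1" for s
      by (rule integrable_cube, rule continuous_on_compose2[OF cont, of _ "\<lambda>x. x + s *\<^sub>R a"])
         (intro continuous_intros, simp)
    show "continuous_on (U \<times> cbox 0 1) (\<lambda>(s, x). partial_deriv j G (x + s *\<^sub>R a))"
      unfolding split_beta
      by (rule continuous_on_compose2[OF cont', of _ "\<lambda>p. snd p + fst p *\<^sub>R a"]) (intro continuous_intros, simp)
  qed (auto simp: U_def)
  moreover have "((\<lambda>s. integral (cbox 0 1) (\<lambda>x. G (x + s *\<^sub>R a))) has_vector_derivative 0) (at 0 within U)"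
  proof (rule has_vector_derivative_transform[where f = "\<lambda>s. integral (cbox 0 1) G"])
    show "integral (cbox 0 1) (\<lambda>x. G (x + s *\<^sub>R a)) = integral (cbox 0 1) G" if "s \<in> U" for s
      unfolding a_def using that by (intro integral_periodic_translate cont per) (auto simp: U_def)
  qed (auto simp: U_def)
  ultimately have "integral (cbox 0 1) (\<lambda>x. partial_deriv j G (x + 0 *\<^sub>R a)) = 0"
    unfolding U_def by (intro vector_derivative_unique_within_closed_interval[of 0 1 0]) auto
  then show ?thesis by simp
qed

lemma has_derivative_echar:
  "(echar m has_derivative (\<lambda>h. 2 * of_real pi * \<i> * of_real (lattice_vec m \<bullet> h) * echar m x)) (at x)"
proof -
  have "((\<lambda>x. 2 * of_real pi * \<i> * of_real (lattice_vec m \<bullet> x)) has_derivative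
      (\<lambda>h. 2 * of_real pi * \<i> * of_real (lattice_vec m \<bullet> h))) (at x)"
    by (intro derivative_intros)
  from has_derivative_compose[OF this has_field_derivative_imp_has_derivative[OF DERIV_exp]]
  show ?thesis by (simp add: echar_def[abs_def] mult_ac)
qed

lemma partial_deriv_echar: "partial_deriv j (echar m) x = 2 * of_real pi * \<i> * of_int (m $ j) * echar m x"
  by (subst partial_deriv_eq[OF has_derivative_echar]) (simp add: inner_axis)

text \<open>For m \<noteq> 0 the character is a nonzero multiple of its own partial derivative in a
  direction with m_j \<noteq> 0.\<close>

lemma integral_echar:
  fixes m :: "int ^ 'n::finite"
  shows "integral (cbox 0 1) (echar m) = (if m = 0 then 1 else 0)"
proof (cases "m = 0")
  case True
  then have "echar m = (\<lambda>x. 1)" by (simp add: fun_eq_iff)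
  moreover have "measure lborel (cbox 0 (1 :: real ^ 'n)) = 1"
    by (subst content_cbox_cart) (auto simp: interval_eq_empty_cart)
  ultimately show ?thesis using True by simp
next
  case False
  then obtain j where j: "m $ j \<noteq> 0" by (auto simp: vec_eq_iff)
  have "integral (cbox 0 1) (partial_deriv j (echar m)) = 0"
    using has_derivative_echar
    by (intro integral_partial_deriv_zero)
       (auto simp: differentiable_def partial_deriv_echar[abs_def] echar_periodic intro!: continuous_intros)
  then show ?thesis
    using j False by (simp add: partial_deriv_echar[abs_def])
qed

lemma has_sum_integral_mult_trig_series:
  fixes u :: "real ^ 'n::finite \<Rightarrow> complex"
  assumes c: "(\<lambda>m. norm (c m)) summable_on UNIV"
    and u: "continuous_on UNIV u"
  shows "((\<lambda>m. c m * integral (cbox 0 1) (\<lambda>x. u x * echar m x)) has_sum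
           integral (cbox 0 1) (\<lambda>x. u x * trig_series c x)) UNIV"
proof -
  have "bounded (u ` cbox 0 1)"
    by (intro compact_imp_bounded compact_continuous_image continuous_on_subset[OF u]) auto
  then obtain B where B: "\<And>x. x \<in> cbox 0 1 \<Longrightarrow> norm (u x) \<le> B"
    by (auto simp: bounded_iff)
  obtain I J where IJ:
    "\<And>X. ((\<lambda>x. \<Sum>m\<in>X. u x * (c m * echar m x)) has_integral I X) (cbox 0 1)"
    "((\<lambda>x. u x * trig_series c x) has_integral J) (cbox 0 1)"
    "(I \<longlongrightarrow> J) (finite_subsets_at_top UNIV)"
    by (rule uniform_limit_integral_cbox[OF uniform_limit_trig_series[OF c B]])
       (auto intro!: continuous_intros continuous_on_subset[OF u])
  have "I X = (\<Sum>m\<in>X. c m * integral (cbox 0 1) (\<lambda>x. u x * echar m x))" if "finite X" for X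
  proof -
    have "I X = integral (cbox 0 1) (\<lambda>x. \<Sum>m\<in>X. u x * (c m * echar m x))"
      using IJ(1)[of X] by (simp add: integral_unique)
    also have "\<dots> = (\<Sum>m\<in>X. integral (cbox 0 1) (\<lambda>x. u x * (c m * echar m x)))"
      by (intro integral_sum that integrable_cube continuous_intros u)
    also have "\<dots> = (\<Sum>m\<in>X. c m * integral (cbox 0 1) (\<lambda>x. u x * echar m x))"
      by (simp add: mult.left_commute)
    finally show ?thesis .
  qed
  then have "(sum (\<lambda>m. c m * integral (cbox 0 1) (\<lambda>x. u x * echar m x)) \<longlongrightarrow> J) (finite_subsets_at_top UNIV)"
    by (intro Lim_transform_eventually[OF IJ(3)]) (auto intro!: eventually_finite_subsets_at_top_weakI)
  then show ?thesis
    using IJ(2) by (simp add: has_sum_def integral_unique)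
qed

subsection \<open>Fourier coefficients of smooth functions\<close>

definition fcoef :: "(real ^ 'n::finite \<Rightarrow> complex) \<Rightarrow> int ^ 'n \<Rightarrow> complex" where
  "fcoef g m = integral (cbox 0 1) (\<lambda>x. echar (- m) x * g x)"

text \<open>Orthogonality: integrating termwise against \<open>echar (- m)\<close> leaves only the
  term with index \<open>m\<close>.\<close>

lemma fcoef_trig_series:
  assumes "rapidly_decreasing c"
  shows "fcoef (trig_series c) = c"
proof
  fix m
  have "((\<lambda>l. c l * integral (cbox 0 1) (\<lambda>x. echar (- m) x * echar l x)) has_sum fcoef (trig_series c) m) UNIV"
    unfolding fcoef_def
    by (intro has_sum_integral_mult_trig_series rapidly_decreasing_abs_summable assms continuous_intros)
  moreover have "c l * integral (cbox 0 1) (\<lambda>x. echar (- m) x * echar l x) = (if l = m then c m else 0)" for l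
    unfolding echar_add[symmetric] by (auto simp: integral_echar)
  ultimately have "((\<lambda>l. if l = m then c m else 0) has_sum fcoef (trig_series c) m) UNIV" by simp
  moreover have "((\<lambda>l. if l = m then c m else 0) has_sum c m) UNIV"
    using has_sum_finite[of "{m}" "\<lambda>l. if l = m then c m else 0"]
    by (subst has_sum_cong_neutral[where T = "{m}" and g = "\<lambda>l. if l = m then c m else 0"]) auto
  ultimately show "fcoef (trig_series c) m = c m" by (rule has_sum_unique)
qed

lemma smooth_torusD:
  assumes "smooth_torus g"
  shows "g (x + lattice_vec k) = g x" "continuous_on UNIV g" "g differentiable at x" "C_order M g"
proof -
  show C: "C_order M g" and "g (x + lattice_vec k) = g x" for M
    using assms unfolding smooth_torus_def by auto
  from C[of 0] show "continuous_on UNIV g" by simp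
  from C[of "Suc 0"] show "g differentiable at x" by (simp add: differentiable_on_def)
qed

lemma smooth_torus_partial_deriv:
  assumes "smooth_torus g"
  shows "smooth_torus (partial_deriv j g)"
  unfolding smooth_torus_def
proof safe
  fix x k
  have "g (x + lattice_vec k + y) = g (x + y)" for y
    using smooth_torusD(1)[OF assms, of "x + y" k] by (simp add: algebra_simps)
  then show "partial_deriv j g (x + lattice_vec k) = partial_deriv j g x"
    by (simp add: partial_deriv_def)
next
  fix M
  show "C_order M (partial_deriv j g)"
    using smooth_torusD(4)[OF assms, of "Suc M"] by simp
qed

lemma partial_deriv_lincomb:
  assumes "f differentiable at x" "g differentiable at x"
  shows "partial_deriv j (\<lambda>x. a * f x - b * g x) x = a * partial_deriv j f x - b * partial_deriv j g x"
proof -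
  obtain f' g' where f': "(f has_derivative f') (at x)" and g': "(g has_derivative g') (at x)"
    using assms by (auto simp: differentiable_def)
  have "((\<lambda>x. a * f x - b * g x) has_derivative (\<lambda>h. a * f' h - b * g' h)) (at x)"
    by (intro derivative_intros f' g')
  then show ?thesis using f' g' by (simp add: partial_deriv_eq)
qed

lemma C_order_lincomb:
  "C_order M f \<Longrightarrow> C_order M g \<Longrightarrow> C_order M (\<lambda>x. a * f x - b * g x)"
proof (induction M arbitrary: f g)
  case 0
  then show ?case by (auto intro!: continuous_intros)
next
  case (Suc M)
  then have d: "f differentiable at x" "g differentiable at x" for x
    by (auto simp: differentiable_on_def)
  then have "partial_deriv j (\<lambda>x. a * f x - b * g x) =
      (\<lambda>x. a * partial_deriv j f x - b * partial_deriv j g x)" for j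
    by (simp add: fun_eq_iff partial_deriv_lincomb)
  moreover have "(\<lambda>x. a * f x - b * g x) differentiable_on UNIV"
    using d by (auto simp: differentiable_on_def intro!: derivative_intros)
  ultimately show ?case using Suc by simp
qed

lemma smooth_torus_lincomb:
  "smooth_torus f \<Longrightarrow> smooth_torus g \<Longrightarrow> smooth_torus (\<lambda>x. a * f x - b * g x)"
  unfolding smooth_torus_def by (simp add: C_order_lincomb)

lemma fcoef_lincomb:
  assumes "continuous_on UNIV f" "continuous_on UNIV g"
  shows "fcoef (\<lambda>x. a * f x - b * g x) m = a * fcoef f m - b * fcoef g m"
proof -
  have "fcoef (\<lambda>x. a * f x - b * g x) m =
      integral (cbox 0 1) (\<lambda>x. a * (echar (- m) x * f x) - b * (echar (- m) x * g x))"
    by (simp add: fcoef_def algebra_simps)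
  also have "\<dots> = integral (cbox 0 1) (\<lambda>x. a * (echar (- m) x * f x)) -
      integral (cbox 0 1) (\<lambda>x. b * (echar (- m) x * g x))"
    by (intro integral_diff integrable_cube continuous_intros assms)
  finally show ?thesis by (simp add: fcoef_def)
qed

text \<open>Integration by parts: the partial derivative of the periodic product
  \<open>echar (- m) x * g x\<close> has integral 0.\<close>

lemma fcoef_partial_deriv:
  assumes "smooth_torus g"
  shows "fcoef (partial_deriv j g) m = 2 * of_real pi * \<i> * of_int (m $ j) * fcoef g m"
proof -
  define G where "G x = echar (- m) x * g x" for x
  have G': "(G has_derivative (\<lambda>h. echar (- m) x * g' h +
      2 * of_real pi * \<i> * of_real (lattice_vec (- m) \<bullet> h) * echar (- m) x * g x)) (at x)"
    if "(g has_derivative g') (at x)" for g' x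
    unfolding G_def by (intro has_derivative_mult has_derivative_echar that)
  have part: "partial_deriv j G x =
      echar (- m) x * partial_deriv j g x - 2 * of_real pi * \<i> * of_int (m $ j) * (echar (- m) x * g x)" for x
  proof -
    obtain g' where g': "(g has_derivative g') (at x)"
      using smooth_torusD(3)[OF assms] by (auto simp: differentiable_def)
    show ?thesis
      unfolding partial_deriv_eq[OF G'[OF g']] partial_deriv_eq[OF g']
      by (simp add: inner_axis del: lattice_vec_simps(2))
  qed
  have cont: "continuous_on UNIV (partial_deriv j g)" "continuous_on UNIV g"
    using smooth_torusD(2) smooth_torus_partial_deriv assms by blast+
  have "integral (cbox 0 1) (partial_deriv j G) = 0"
  proof (rule integral_partial_deriv_zero)
    show "G differentiable at x" for x
      using smooth_torusD(3)[OF assms, of x] G' unfolding differentiable_def by blast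
    show "continuous_on UNIV (partial_deriv j G)"
      unfolding part[abs_def] by (intro continuous_intros cont)
    show "G (x + lattice_vec k) = G x" for x k
      by (simp add: G_def echar_periodic smooth_torusD(1)[OF assms])
  qed
  also have "integral (cbox 0 1) (partial_deriv j G) =
      integral (cbox 0 1) (\<lambda>x. echar (- m) x * partial_deriv j g x) -
      integral (cbox 0 1) (\<lambda>x. 2 * of_real pi * \<i> * of_int (m $ j) * (echar (- m) x * g x))"
    unfolding part[abs_def] by (intro integral_diff integrable_cube continuous_intros cont)
  finally show ?thesis by (simp add: fcoef_def)
qed

text \<open>The normalised derivative has multiplier m_j and the recursion subtracts
  \<open>l\<close> from it, so each step contributes the next factor m_j - l of the falling
  factorial.\<close>

lemma falling_deriv_fcoef:
  assumes "smooth_torus g"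
  shows "smooth_torus (falling_deriv j l g) \<and>
    (\<forall>m. fcoef (falling_deriv j l g) m = (\<Prod>i<l. of_int (m $ j) - of_nat i) * fcoef g m)"
proof (induction l)
  case 0
  then show ?case using assms by simp
next
  case (Suc l)
  define h where "h = falling_deriv j l g"
  have h: "smooth_torus h" "\<And>m. fcoef h m = (\<Prod>i<l. of_int (m $ j) - of_nat i) * fcoef g m"
    using Suc by (auto simp: h_def)
  have eq: "falling_deriv j (Suc l) g = (\<lambda>x. 1 / (2 * of_real pi * \<i>) * partial_deriv j h x - of_nat l * h x)"
    by (simp add: h_def)
  have "fcoef (falling_deriv j (Suc l) g) m = (\<Prod>i<Suc l. of_int (m $ j) - of_nat i) * fcoef g m" for m
    unfolding eq
    by (subst fcoef_lincomb)
       (use h(1) smooth_torus_partial_deriv smooth_torusD(2) in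
         \<open>auto simp: algebra_simps h(2) fcoef_partial_deriv[OF h(1)]\<close>)
  moreover have "smooth_torus (falling_deriv j (Suc l) g)"
    unfolding eq by (intro smooth_torus_lincomb smooth_torus_partial_deriv h)
  ultimately show ?case by blast
qed

lemma Dx_fcoef:
  fixes g :: "real ^ 'n::{finite,linorder} \<Rightarrow> complex"
  assumes "smooth_torus g"
  shows "smooth_torus (Dx \<beta> g)" "fcoef (Dx \<beta> g) m = ff \<beta> m * fcoef g m"
proof -
  have "smooth_torus (foldr (\<lambda>j. falling_deriv j (\<beta> $ j)) xs g) \<and>
      (\<forall>m. fcoef (foldr (\<lambda>j. falling_deriv j (\<beta> $ j)) xs g) m =
        (\<Prod>j\<in>set xs. \<Prod>i<\<beta> $ j. of_int (m $ j) - of_nat i) * fcoef g m)" if "distinct xs" for xs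
    using that
  proof (induction xs)
    case Nil
    then show ?case using assms by simp
  next
    case (Cons j xs)
    then show ?case using falling_deriv_fcoef[of "foldr (\<lambda>j. falling_deriv j (\<beta> $ j)) xs g" j "\<beta> $ j"]
      by simp
  qed
  from this[of "sorted_list_of_set UNIV"]
  show "smooth_torus (Dx \<beta> g)" "fcoef (Dx \<beta> g) m = ff \<beta> m * fcoef g m"
    by (simp_all add: Dx_def multi_op_def ff_def)
qed

section \<open>Decay of the Fourier coefficients of smooth functions\<close>

lemma norm_fcoef_le:
  assumes "continuous_on UNIV g" "\<And>x. norm (g x) \<le> B"
  shows "norm (fcoef g m) \<le> B"
proof -
  have "norm (integral (cbox 0 1) (\<lambda>x. echar (- m) x * g x)) \<le>
      integral (cbox 0 1) (\<lambda>x :: real ^ 'a. B * norm (echar 0 x))"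
    by (rule integral_norm_bound_integral)
       (use assms in \<open>auto intro!: integrable_cube continuous_intros simp: norm_mult\<close>)
  also have "\<dots> = B * measure lborel (cbox 0 (1 :: real ^ 'a))" by simp
  also have "measure lborel (cbox 0 (1 :: real ^ 'a)) = 1"
    by (subst content_cbox_cart) (auto simp: interval_eq_empty_cart)
  finally show ?thesis by (simp add: fcoef_def)
qed

lemma torus_representative:
  obtains k where "x + lattice_vec k \<in> cbox 0 1"
proof
  show "x + lattice_vec (\<chi> j. - \<lfloor>x $ j\<rfloor>) \<in> cbox 0 1"
    by (auto simp: mem_box_cart) linarith+
qed

lemma smooth_torus_bounded:
  assumes "smooth_torus g"
  obtains B where "\<And>x. norm (g x) \<le> B"
proof -
  have "bounded (g ` cbox 0 1)"
    by (intro compact_imp_bounded compact_continuous_image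
          continuous_on_subset[OF smooth_torusD(2)[OF assms]]) auto
  then obtain B where B: "\<And>x. x \<in> cbox 0 1 \<Longrightarrow> norm (g x) \<le> B"
    by (auto simp: bounded_iff)
  have "norm (g x) \<le> B" for x
  proof -
    obtain k where "x + lattice_vec k \<in> cbox 0 1" by (rule torus_representative)
    from B[OF this] show ?thesis by (simp add: smooth_torusD(1)[OF assms])
  qed
  then show ?thesis by (rule that)
qed

text \<open>The M-fold derivative in direction \<open>j\<close> is bounded, which bounds |m_j|^M
  times the coefficient. \<open>weight_power_le\<close> joins all directions; its constant summand
  is covered by the bound of \<open>g\<close> itself.\<close>

lemma rapidly_decreasing_fcoef:
  fixes g :: "real ^ 'n::finite \<Rightarrow> complex"
  assumes g: "smooth_torus g"
  shows "rapidly_decreasing (fcoef g)"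
  unfolding rapidly_decreasing_def
proof
  fix M
  have it: "smooth_torus ((partial_deriv j ^^ M) g) \<and>
      (\<forall>m. fcoef ((partial_deriv j ^^ M) g) m = (2 * of_real pi * \<i> * of_int (m $ j)) ^ M * fcoef g m)" for j M
    by (induction M) (use g in \<open>simp_all add: smooth_torus_partial_deriv fcoef_partial_deriv\<close>)
  have "\<exists>B. \<forall>m. \<bar>real_of_int (m $ j)\<bar> ^ M * norm (fcoef g m) \<le> B" for j
  proof -
    obtain B where B: "\<And>x. norm ((partial_deriv j ^^ M) g x) \<le> B"
      using smooth_torus_bounded it by blast
    have "\<bar>real_of_int (m $ j)\<bar> ^ M * norm (fcoef g m) \<le> B" for m
    proof -
      have "norm ((2 * of_real pi * \<i> * of_int (m $ j)) ^ M * fcoef g m) \<le> B"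
      proof -
        have "continuous_on UNIV ((partial_deriv j ^^ M) g)" using it smooth_torusD(2) by blast
        from norm_fcoef_le[OF this B, of m] show ?thesis using it[where j = j and M = M] by simp
      qed
      moreover have "\<bar>real_of_int (m $ j)\<bar> ^ M \<le> norm ((2 * of_real pi * \<i> * of_int (m $ j) :: complex) ^ M)"
        unfolding norm_power
      proof (rule power_mono)
        have "1 * \<bar>real_of_int (m $ j)\<bar> \<le> 2 * pi * \<bar>real_of_int (m $ j)\<bar>"
          using pi_ge_two by (intro mult_right_mono) auto
        then show "\<bar>real_of_int (m $ j)\<bar> \<le> norm (2 * of_real pi * \<i> * of_int (m $ j) :: complex)"
          by (simp add: norm_mult)
      qed simp
      ultimately show ?thesis
        unfolding norm_mult by (meson mult_right_mono norm_ge_zero order_trans)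
    qed
    then show ?thesis by blast
  qed
  then obtain B where B: "\<And>j m. \<bar>real_of_int (m $ j)\<bar> ^ M * norm (fcoef g m) \<le> B j" by metis
  obtain B0 where B0: "\<And>x. norm (g x) \<le> B0" using smooth_torus_bounded[OF g] by blast
  have "norm (fcoef g m) \<le> ((1 + real CARD('n)) ^ M * (B0 + (\<Sum>j\<in>UNIV. B j))) / weight m ^ M" for m
  proof -
    have "weight m ^ M * norm (fcoef g m) \<le>
        (1 + real CARD('n)) ^ M * (1 + (\<Sum>j\<in>UNIV. \<bar>real_of_int (m $ j)\<bar> ^ M)) * norm (fcoef g m)"
      by (intro mult_right_mono weight_power_le) auto
    also have "\<dots> = (1 + real CARD('n)) ^ M *
        (norm (fcoef g m) + (\<Sum>j\<in>UNIV. \<bar>real_of_int (m $ j)\<bar> ^ M * norm (fcoef g m)))"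
      unfolding sum_distrib_right[symmetric] by (simp add: distrib_right mult.assoc)
    also have "\<dots> \<le> (1 + real CARD('n)) ^ M * (B0 + (\<Sum>j\<in>UNIV. B j))"
      by (intro mult_left_mono add_mono sum_mono B norm_fcoef_le smooth_torusD(2)[OF g] B0) auto
    finally show ?thesis by (simp add: pos_le_divide_eq mult.commute)
  qed
  then show "\<exists>C. \<forall>m. norm (fcoef g m) \<le> C / weight m ^ M" by blast
qed

subsection \<open>Fourier inversion\<close>

text \<open>The kernels \<open>\<lambda>x. bump y x ^ p\<close> are trigonometric polynomials that concentrate at \<open>y\<close>.\<close>

definition bump :: "real ^ 'n::finite \<Rightarrow> real ^ 'n \<Rightarrow> real" where
  "bump y x = (\<Prod>j\<in>UNIV. (1 + cos (2 * pi * (x $ j - y $ j))) / 2)"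

lemma bump_factor: "0 \<le> (1 + cos t) / 2" "(1 + cos t) / 2 \<le> (1 :: real)"
proof -
  have "- 1 \<le> cos t" "cos t \<le> 1" by (rule cos_ge_minus_one, rule cos_le_one)
  then show "0 \<le> (1 + cos t) / 2" "(1 + cos t) / 2 \<le> 1" by (argo, argo)
qed

lemma bump_nonneg: "0 \<le> bump y x"
  unfolding bump_def by (intro prod_nonneg bump_factor)

lemma bump_self: "bump y y = 1"
  by (simp add: bump_def)

lemma continuous_on_bump: "continuous_on S (bump y)"
  unfolding bump_def by (intro continuous_intros) auto

text \<open>Opposite faces of the cube coincide on the torus, so for \<open>y\<close> on a face the
  value 1 would also be attained at the opposite point. For interior \<open>y\<close> all coordinate
  differences are below 1 in modulus.\<close>

lemma bump_less_1:
  assumes "x \<in> cbox 0 1" "y \<in> box 0 1" "x \<noteq> y"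
  shows "bump y x < 1"
proof -
  obtain j where j: "x $ j \<noteq> y $ j" using assms by (auto simp: vec_eq_iff)
  have "0 < y $ j" "y $ j < 1" "0 \<le> x $ j" "x $ j \<le> 1"
    using assms by (auto simp: mem_box_cart)
  then have lt: "\<bar>x $ j - y $ j\<bar> < 1" by auto
  have "cos (2 * pi * (x $ j - y $ j)) \<noteq> 1"
  proof
    assume "cos (2 * pi * (x $ j - y $ j)) = 1"
    then obtain n :: int where "2 * pi * (x $ j - y $ j) = of_int n * 2 * pi"
      unfolding cos_one_2pi_int by blast
    then have n: "x $ j - y $ j = of_int n" by simp
    with lt have "\<bar>n\<bar> < 1" by linarith
    with n j show False by simp
  qed
  then have c: "(1 + cos (2 * pi * (x $ j - y $ j))) / 2 < 1"
    using bump_factor(2)[of "2 * pi * (x $ j - y $ j)"] by (auto simp: less_le)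
  have "bump y x = (1 + cos (2 * pi * (x $ j - y $ j))) / 2 *
      (\<Prod>i\<in>UNIV - {j}. (1 + cos (2 * pi * (x $ i - y $ i))) / 2)"
    unfolding bump_def by (rule prod.remove) auto
  also have "\<dots> \<le> (1 + cos (2 * pi * (x $ j - y $ j))) / 2 * 1"
    by (intro mult_left_mono prod_le_1 conjI bump_factor)
  finally show ?thesis using c by linarith
qed

text \<open>Since \<open>m\<close> ranges over the whole lattice, the sign convention of the
  character, opposite to that of \<open>fcoef\<close>, is immaterial.\<close>

definition coefs_vanish :: "(real ^ 'n::finite \<Rightarrow> complex) \<Rightarrow> bool" where
  "coefs_vanish g \<longleftrightarrow> continuous_on UNIV g \<and> (\<forall>m. integral (cbox 0 1) (\<lambda>x. echar m x * g x) = 0)"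

text \<open>The factor is a combination of three characters, so multiplication by it only mixes
  integrals that all vanish.\<close>

lemma coefs_vanish_mult_cos:
  fixes g :: "real ^ 'n::finite \<Rightarrow> complex"
  assumes "coefs_vanish g"
  shows "coefs_vanish (\<lambda>x. of_real ((1 + cos (2 * pi * (x $ j - y $ j))) / 2) * g x)"
  unfolding coefs_vanish_def
proof safe
  have cont: "continuous_on UNIV g" and zero: "\<And>m. integral (cbox 0 1) (\<lambda>x. echar m x * g x) = 0"
    using assms by (auto simp: coefs_vanish_def)
  show "continuous_on UNIV (\<lambda>x. of_real ((1 + cos (2 * pi * (x $ j - y $ j))) / 2) * g x)"
    by (intro continuous_intros cont) auto
  fix m :: "int ^ 'n"
  \<comment> \<open>Euler's formula gives half the sum of two characters for the cosine, and the
    factor is halved once more, hence 1/4. Translation by \<open>y\<close> becomes a phase.\<close>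
  define a where "a = echar (axis j 1) (- y) / 4"
  define b where "b = echar (- axis j 1) (- y) / 4"
  have "of_real ((1 + cos (2 * pi * (x $ j - y $ j))) / 2) =
      1 / 2 + a * echar (axis j 1) x + b * echar (- axis j 1) x" for x
  proof -
    define t where "t = 2 * pi * (x $ j - y $ j)"
    have "echar (axis j 1) (x + - y) = exp (\<i> * of_real t)"
      "echar (- axis j 1) (x + - y) = exp (- (\<i> * of_real t))"
      by (simp_all add: echar_def t_def inner_axis' algebra_simps)
    then have "a * echar (axis j 1) x + b * echar (- axis j 1) x =
        (exp (\<i> * of_real t) + exp (- (\<i> * of_real t))) / 4"
      unfolding echar_add_right by (simp add: a_def b_def field_simps)
    also have "\<dots> = of_real (cos t) / 2"
      by (simp add: cos_of_real[symmetric] cos_exp_eq)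
    finally show ?thesis by (simp add: t_def add_divide_distrib)
  qed
  then have "(\<lambda>x. echar m x * (of_real ((1 + cos (2 * pi * (x $ j - y $ j))) / 2) * g x)) =
    (\<lambda>x. 1 / 2 * (echar m x * g x) + a * (echar (m + axis j 1) x * g x) + b * (echar (m + - axis j 1) x * g x))"
    unfolding echar_add by (simp add: fun_eq_iff distrib_left distrib_right mult_ac)
  moreover have "((\<lambda>x. 1 / 2 * (echar m x * g x) + a * (echar (m + axis j 1) x * g x) +
      b * (echar (m + - axis j 1) x * g x)) has_integral 1 / 2 * 0 + a * 0 + b * 0) (cbox 0 1)"
  proof -
    have "((\<lambda>x. echar m x * g x) has_integral 0) (cbox 0 1)" for m
      unfolding zero[of m, symmetric]
      by (intro integrable_integral integrable_cube continuous_intros cont)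
    then show ?thesis by (intro has_integral_add has_integral_mult_right)
  qed
  ultimately show "integral (cbox 0 1) (\<lambda>x. echar m x * (of_real ((1 + cos (2 * pi * (x $ j - y $ j))) / 2) * g x)) = 0"
    by (simp add: integral_unique)
qed

lemma coefs_vanish_mult_bump:
  assumes "coefs_vanish g"
  shows "coefs_vanish (\<lambda>x. of_real (bump y x ^ p) * g x)"
proof (induction p)
  case 0
  then show ?case using assms by simp
next
  case (Suc p)
  have "coefs_vanish (\<lambda>x. of_real (\<Prod>j\<in>J. (1 + cos (2 * pi * (x $ j - y $ j))) / 2) *
      (of_real (bump y x ^ p) * g x))" if "finite J" for J
    using that
  proof induction
    case empty
    then show ?case using Suc by simp
  next
    case (insert j J)
    from coefs_vanish_mult_cos[OF insert.IH, of j y] show ?case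
      using insert.hyps by (simp add: mult.assoc)
  qed
  from this[of UNIV] show ?case by (simp add: bump_def mult.assoc)
qed

text \<open>If \<open>h y\<close> were nonzero, \<open>u\<close> would exceed a positive
  \<open>e\<close> near \<open>y\<close>, while all integrals of \<open>bump y x ^ p * u x\<close>
  vanish. The bump exceeds \<open>c1\<close> on some box near \<open>y\<close> and is at most
  \<open>c2 < c1\<close> outside a ball, so the positive contribution wins for large
  \<open>p\<close>.\<close>

lemma coefs_vanish_imp_zero_interior:
  fixes h :: "real ^ 'n::finite \<Rightarrow> complex"
  assumes h: "coefs_vanish h" and y: "y \<in> box 0 1"
  shows "h y = 0"
proof (rule ccontr)
  assume hy: "h y \<noteq> 0"
  \<comment> \<open>The factor \<open>cnj (h y)\<close> rotates the value at \<open>y\<close> to |h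
    y|^2, so that a real function with a positive value remains.\<close>
  define u where "u x = Re (cnj (h y) * h x)" for x
  have cont_h: "continuous_on UNIV h" using h by (simp add: coefs_vanish_def)
  have cont_u: "continuous_on UNIV u" unfolding u_def by (intro continuous_intros cont_h)
  define e where "e = u y / 2"
  have "u y = (norm (h y))\<^sup>2" unfolding u_def complex_norm_square[symmetric] mult.commute[of "cnj (h y)"]
    by (metis Re_complex_of_real complex_norm_square)
  then have e: "0 < e" "e < u y" using hy by (auto simp: e_def)
  have int0: "integral (cbox 0 1) (\<lambda>x. bump y x ^ p * u x) = 0" for p
  proof -
    have cv: "coefs_vanish (\<lambda>x. of_real (bump y x ^ p) * h x)"
      by (rule coefs_vanish_mult_bump[OF h])
    then have "integral (cbox 0 1) (\<lambda>x. echar 0 x * (of_real (bump y x ^ p) * h x)) = 0"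
      by (simp only: coefs_vanish_def)
    then have z: "integral (cbox 0 1) (\<lambda>x. of_real (bump y x ^ p) * h x) = 0" by simp
    have "((\<lambda>x. of_real (bump y x ^ p) * h x) has_integral 0) (cbox 0 1)"
      unfolding z[symmetric] using cv
      by (intro integrable_integral integrable_cube) (simp add: coefs_vanish_def)
    then have "((\<lambda>x. cnj (h y) * (of_real (bump y x ^ p) * h x)) has_integral cnj (h y) * 0) (cbox 0 1)"
      by (rule has_integral_mult_right)
    from has_integral_Re[OF this]
    have "((\<lambda>x. Re (cnj (h y) * (of_real (bump y x ^ p) * h x))) has_integral 0) (cbox 0 1)"
      by (simp only: mult_zero_right zero_complex.sel)
    moreover have "Re (cnj (h y) * (of_real (bump y x ^ p) * h x)) = bump y x ^ p * u x" for x
    proof -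
      have "Re (z * (of_real r * w)) = r * Re (z * w)" for z w :: complex and r
        by (simp add: algebra_simps)
      then show ?thesis unfolding u_def by blast
    qed
    ultimately show ?thesis by (simp add: integral_unique)
  qed
  have "bounded (u ` cbox 0 1)"
    by (intro compact_imp_bounded compact_continuous_image continuous_on_subset[OF cont_u]) auto
  then obtain B0 where B0: "\<And>x. x \<in> cbox 0 1 \<Longrightarrow> \<bar>u x\<bar> \<le> B0" by (auto simp: bounded_iff)
  define B where "B = max B0 1"
  have B: "\<And>x. x \<in> cbox 0 1 \<Longrightarrow> \<bar>u x\<bar> \<le> B" "0 < B" using B0 by (fastforce simp: B_def)+
  have "open (box 0 1 \<inter> {x. e < u x})"
    by (intro open_Int open_box open_Collect_less continuous_intros cont_u)
  then obtain r where r: "0 < r" "ball y r \<subseteq> box 0 1 \<inter> {x. e < u x}"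
    using y e by (metis (no_types, lifting) Int_iff mem_Collect_eq openE)
  \<comment> \<open>A maximum over a compact set, below 1 by \<open>bump_less_1\<close>. The value
    1/2 keeps \<open>c2\<close> positive for the quotient \<open>c1 / c2\<close>, and serves alone
    if the ball covers the cube.\<close>
  obtain c2 where c2: "0 < c2" "c2 < 1" "\<And>x. x \<in> cbox 0 1 - ball y r \<Longrightarrow> bump y x \<le> c2"
  proof (cases "cbox 0 1 - ball y r = {}")
    case True
    then show ?thesis by (intro that[of "1/2"]) auto
  next
    case False
    have "compact (cbox 0 1 - ball y r)" by (intro compact_diff) auto
    from continuous_attains_sup[OF this False continuous_on_bump[of _ y]]
    obtain z where z: "z \<in> cbox 0 1 - ball y r" "\<And>x. x \<in> cbox 0 1 - ball y r \<Longrightarrow> bump y x \<le> bump y z"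
      by blast
    have "bump y z < 1" using z(1) r(1) y by (intro bump_less_1) auto
    then show ?thesis using z by (intro that[of "max (1/2) (bump y z)"]) (auto simp: le_max_iff_disj)
  qed
  \<comment> \<open>Strictly between \<open>c2\<close> and the value 1 of the bump at
    \<open>y\<close>.\<close>
  define c1 where "c1 = (1 + c2) / 2"
  have c1: "c2 < c1" "c1 < 1" "0 < c1" using c2 by (auto simp: c1_def)
  have "open (ball y r \<inter> {x. c1 < bump y x})"
    by (intro open_Int open_ball open_Collect_less continuous_intros continuous_on_bump)
  moreover have "y \<in> ball y r \<inter> {x. c1 < bump y x}" using r c1 by (simp add: bump_self)
  ultimately obtain a b where ab: "cbox a b \<subseteq> ball y r \<inter> {x. c1 < bump y x}"
      "\<forall>i\<in>Basis. a \<bullet> i < b \<bullet> i"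
    by (rule open_contains_cbox)
  define v where "v = measure lborel (cbox a b)"
  have "0 < v"
    unfolding v_def by (rule content_pos_lt[OF ab(2)])
  have sub: "cbox a b \<subseteq> cbox 0 1" using ab r box_subset_cbox by blast
  have ineq: "e * c1 ^ p * v \<le> B * c2 ^ p" for p
  proof -
    \<comment> \<open>A minorant of the integrand: the gain on the small box minus the worst case
      outside the ball. The loss is subtracted on the whole cube, which keeps the integral
      explicit.\<close>
    define K where "K x = (if x \<in> cbox a b then e * c1 ^ p else 0) - B * c2 ^ p" for x
    have K: "(K has_integral e * c1 ^ p * v - B * c2 ^ p) (cbox 0 1)"
      unfolding K_def
    proof (rule has_integral_diff)
      have "((\<lambda>x. e * c1 ^ p) has_integral v *\<^sub>R (e * c1 ^ p)) (cbox a b)"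
        unfolding v_def by (rule has_integral_const)
      then show "((\<lambda>x. if x \<in> cbox a b then e * c1 ^ p else 0) has_integral e * c1 ^ p * v) (cbox 0 1)"
        by (subst has_integral_restrict[OF sub]) (simp add: mult_ac)
      have "measure lborel (cbox 0 (1 :: real ^ 'n)) = 1"
        by (subst content_cbox_cart) (auto simp: interval_eq_empty_cart)
      then show "((\<lambda>x. B * c2 ^ p) has_integral B * c2 ^ p) (cbox 0 (1 :: real ^ 'n))"
        using has_integral_const[of "B * c2 ^ p" 0 "1 :: real ^ 'n"] by simp
    qed
    have K_le: "K x \<le> bump y x ^ p * u x" if x: "x \<in> cbox 0 1" for x
    proof (cases "x \<in> ball y r")
      case True
      then have ux: "e < u x" using r by auto
      show ?thesis
      proof (cases "x \<in> cbox a b")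
        case True
        then have "c1 ^ p \<le> bump y x ^ p" using ab c1 by (intro power_mono) auto
        then have "c1 ^ p * e \<le> bump y x ^ p * u x"
          using ux e c1 by (intro mult_mono) (auto simp: bump_nonneg)
        moreover have "0 \<le> B * c2 ^ p" using B(2) c2 by simp
        ultimately show ?thesis using True unfolding K_def by (simp add: mult.commute)
      next
        case False
        have "0 \<le> bump y x ^ p * u x" using ux e by (simp add: bump_nonneg)
        moreover have "0 \<le> B * c2 ^ p" using B(2) c2 by simp
        ultimately show ?thesis using False unfolding K_def by simp
      qed
    next
      case False
      then have nab: "x \<notin> cbox a b" using ab by blast
      have "bump y x ^ p \<le> c2 ^ p" using c2(3)[of x] x False by (intro power_mono bump_nonneg) auto
      then have "bump y x ^ p * \<bar>u x\<bar> \<le> c2 ^ p * B"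
        using c2 B(1)[OF x] by (intro mult_mono) auto
      moreover have "- (bump y x ^ p * \<bar>u x\<bar>) \<le> bump y x ^ p * u x"
        using bump_nonneg[of y x] by (metis abs_ge_minus_self minus_le_iff mult_left_mono mult_minus_right zero_le_power)
      ultimately show ?thesis using nab by (simp add: K_def mult.commute)
    qed
    have "((\<lambda>x. bump y x ^ p * u x) has_integral 0) (cbox 0 1)"
      unfolding int0[of p, symmetric]
      by (intro integrable_integral integrable_continuous continuous_intros continuous_on_bump
            continuous_on_subset[OF cont_u]) auto
    from has_integral_le[OF K this K_le] show ?thesis by simp
  qed
  have "1 < c1 / c2" using c1 c2 by simp
  then obtain p where p: "B / (e * v) < (c1 / c2) ^ p"
    using real_arch_pow by blast
  have "B * c2 ^ p < e * c1 ^ p * v"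
    using p e \<open>0 < v\<close> c2 by (simp add: power_divide field_simps)
  with ineq[of p] show False by simp
qed

text \<open>Continuity carries the zeros from the open cube to its closure, periodicity carries them
  everywhere.\<close>

lemma coefs_vanish_imp_zero:
  fixes h :: "real ^ 'n::finite \<Rightarrow> complex"
  assumes h: "coefs_vanish h" and per: "\<And>x k. h (x + lattice_vec k) = h x"
  shows "h x = 0"
proof -
  have cont: "continuous_on UNIV h" using h by (simp add: coefs_vanish_def)
  have ne: "box 0 (1 :: real ^ 'n) \<noteq> {}" by (simp add: interval_eq_empty_cart)
  obtain k where k: "x + lattice_vec k \<in> cbox 0 1" by (rule torus_representative)
  have "h (x + lattice_vec k) = 0"
  proof (rule continuous_constant_on_closure[where S = "box 0 1" and f = h])
    show "continuous_on (closure (box 0 1)) h" by (rule continuous_on_subset[OF cont]) auto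
    show "x + lattice_vec k \<in> closure (box 0 1)" using k by (simp add: closure_box[OF ne])
  qed (rule coefs_vanish_imp_zero_interior[OF h])
  then show ?thesis by (simp add: per)
qed

text \<open>The sum of the Fourier series is smooth with the same coefficients as \<open>g\<close>,
  so the difference has vanishing coefficients.\<close>

lemma trig_series_fcoef:
  assumes g: "smooth_torus g"
  shows "trig_series (fcoef g) = g"
proof
  fix x
  have rapid: "rapidly_decreasing (fcoef g)" by (rule rapidly_decreasing_fcoef[OF g])
  have s: "smooth_torus (trig_series (fcoef g))" by (rule smooth_torus_trig_series[OF rapid])
  define h where "h x = 1 * trig_series (fcoef g) x - 1 * g x" for x
  have sh: "smooth_torus h" unfolding h_def by (rule smooth_torus_lincomb[OF s g])
  have "fcoef h m = 0" for m
    unfolding h_def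
    by (subst fcoef_lincomb[OF smooth_torusD(2)[OF s] smooth_torusD(2)[OF g]])
       (simp add: fcoef_trig_series[OF rapid])
  then have "integral (cbox 0 1) (\<lambda>x. echar m x * h x) = 0" for m
    unfolding fcoef_def by (metis minus_minus)
  then have "coefs_vanish h" using smooth_torusD(2)[OF sh] by (simp add: coefs_vanish_def)
  then have "h x = 0" by (rule coefs_vanish_imp_zero) (rule smooth_torusD(1)[OF sh])
  then show "trig_series (fcoef g) x = g x" by (simp add: h_def)
qed

text \<open>Both sides are smooth with equal Fourier coefficients; inversion replaces a termwise
  differentiation of arbitrary order.\<close>

lemma Dx_trig_series:
  assumes "rapidly_decreasing c"
  shows "Dx \<beta> (trig_series c) = trig_series (\<lambda>m. ff \<beta> m * c m)"
proof -
  have s: "smooth_torus (trig_series c)" by (rule smooth_torus_trig_series[OF assms])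
  have "Dx \<beta> (trig_series c) = trig_series (fcoef (Dx \<beta> (trig_series c)))"
    by (rule trig_series_fcoef[symmetric]) (rule Dx_fcoef(1)[OF s])
  also have "fcoef (Dx \<beta> (trig_series c)) = (\<lambda>m. ff \<beta> m * c m)"
    by (rule ext) (simp add: Dx_fcoef(2)[OF s] fcoef_trig_series[OF assms])
  finally show ?thesis .
qed

subsection \<open>Symbols in terms of their Fourier coefficients\<close>

text \<open>The symbol class transported to Fourier coefficients: the series in the bound is
  \<open>Dx \<beta>\<close> applied to the difference \<open>Delta \<alpha>\<close> of the symbol
  with coefficients \<open>b\<close>.\<close>

definition coef_symbol ::
    "real \<Rightarrow> real \<Rightarrow> real \<Rightarrow> (int ^ 'n::{finite,linorder} \<Rightarrow> int ^ 'n::_ \<Rightarrow> complex) set" where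
  "coef_symbol \<mu> \<rho> \<delta> = {b.
     (\<forall>k. rapidly_decreasing (b k)) \<and>
     (\<forall>\<alpha> \<beta>. \<exists>C>0. \<forall>k x.
        norm (trig_series (\<lambda>m. ff \<beta> m * Delta \<alpha> (\<lambda>l. b l m) k) x)
          \<le> C * weight k powr (\<mu> - \<rho> * real (mi_order \<alpha>) + \<delta> * real (mi_order \<beta>)))}"

lemma coef_symbolI:
  assumes "\<And>k. rapidly_decreasing (b k)"
    and "\<And>\<alpha> \<beta>. \<exists>C>0. \<forall>k x. norm (trig_series (\<lambda>m. ff \<beta> m * Delta \<alpha> (\<lambda>l. b l m) k) x)
          \<le> C * weight k powr (\<mu> - \<rho> * real (mi_order \<alpha>) + \<delta> * real (mi_order \<beta>))"
  shows "b \<in> coef_symbol \<mu> \<rho> \<delta>"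
  using assms by (simp add: coef_symbol_def)

lemma coef_symbolD:
  assumes "b \<in> coef_symbol \<mu> \<rho> \<delta>"
  shows "rapidly_decreasing (b k)"
    and "\<exists>C>0. \<forall>k x. norm (trig_series (\<lambda>m. ff \<beta> m * Delta \<alpha> (\<lambda>l. b l m) k) x)
          \<le> C * weight k powr (\<mu> - \<rho> * real (mi_order \<alpha>) + \<delta> * real (mi_order \<beta>))"
  using assms by (auto simp: coef_symbol_def)

lemma trig_series_symbol_iff:
  assumes "\<And>k. rapidly_decreasing (b k)"
  shows "(\<lambda>k x. trig_series (b k) x) \<in> symbol_class \<mu> \<rho> \<delta> \<longleftrightarrow> b \<in> coef_symbol \<mu> \<rho> \<delta>"
proof -
  have "Dx \<beta> (\<lambda>y. Delta \<alpha> (\<lambda>l. trig_series (b l) y) k) =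
      trig_series (\<lambda>m. ff \<beta> m * Delta \<alpha> (\<lambda>l. b l m) k)" for \<alpha> \<beta> k
    unfolding Delta_trig_series[of b, OF assms]
    by (rule Dx_trig_series[unfolded fun_eq_iff[symmetric]]) (intro rapidly_decreasing_Delta assms)
  then show ?thesis
    using assms smooth_torus_trig_series[OF assms] by (simp add: symbol_class_def coef_symbol_def)
qed

lemma fcoef_coef_symbol:
  assumes "\<sigma> \<in> symbol_class \<mu> \<rho> \<delta>"
  shows "(\<lambda>k. fcoef (\<sigma> k)) \<in> coef_symbol \<mu> \<rho> \<delta>"
proof -
  have s: "smooth_torus (\<sigma> k)" for k using assms by (simp add: symbol_class_def)
  have "(\<lambda>k x. trig_series (fcoef (\<sigma> k)) x) = \<sigma>" by (simp add: trig_series_fcoef[OF s])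
  then show ?thesis
    using trig_series_symbol_iff[of "\<lambda>k. fcoef (\<sigma> k)" \<mu> \<rho> \<delta>] assms rapidly_decreasing_fcoef[OF s] by simp
qed

section \<open>Operations on coefficient families that preserve the symbol estimates\<close>

lemma rapidly_decreasing_ffspan:
  "ffspan d P \<Longrightarrow> rapidly_decreasing c \<Longrightarrow> rapidly_decreasing (\<lambda>m. P m * c m)"
proof (induction rule: ffspan.induct)
  case (add P Q)
  then show ?case by (simp add: distrib_right rapidly_decreasing_add)
next
  case (scale P a)
  then show ?case using rapidly_decreasing_cmult[of "\<lambda>m. P m * c m" a] by (simp add: mult.assoc)
qed (rule rapidly_decreasing_ff)

text \<open>As \<delta> \<ge> 0 and weights are at least 1, multipliers of lower order obey the
  bound for degree \<open>d\<close> too, so orders may be mixed. Products, reflections and plain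
  powers thereby become admissible multipliers.\<close>

lemma coef_symbol_ffspan:
  assumes b: "b \<in> coef_symbol \<mu> \<rho> \<delta>" and "0 \<le> \<delta>" and "ffspan d P"
  shows "\<exists>C>0. \<forall>k x. norm (trig_series (\<lambda>m. P m * Delta \<alpha> (\<lambda>l. b l m) k) x)
           \<le> C * weight k powr (\<mu> - \<rho> * real (mi_order \<alpha>) + \<delta> * real d)"
  using assms(3)
proof induction
  case (base \<gamma>)
  obtain C where C: "C > 0" "\<And>k x. norm (trig_series (\<lambda>m. ff \<gamma> m * Delta \<alpha> (\<lambda>l. b l m) k) x)
          \<le> C * weight k powr (\<mu> - \<rho> * real (mi_order \<alpha>) + \<delta> * real (mi_order \<gamma>))"
    using coef_symbolD(2)[OF b] by blast
  have "norm (trig_series (\<lambda>m. ff \<gamma> m * Delta \<alpha> (\<lambda>l. b l m) k) x)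
          \<le> C * weight k powr (\<mu> - \<rho> * real (mi_order \<alpha>) + \<delta> * real d)" for k x
    using C(1) base \<open>0 \<le> \<delta>\<close>
    by (intro order_trans[OF C(2)] mult_left_mono powr_mono)
       (auto simp: weight_ge_1 intro: mult_left_mono)
  then show ?case using C(1) by blast
next
  case (add P Q)
  have r: "rapidly_decreasing (\<lambda>m. Delta \<alpha> (\<lambda>l. b l m) k)" for k
    by (intro rapidly_decreasing_Delta coef_symbolD(1)[OF b])
  obtain C D where CD: "C > 0" "D > 0"
    "\<And>k x. norm (trig_series (\<lambda>m. P m * Delta \<alpha> (\<lambda>l. b l m) k) x)
       \<le> C * weight k powr (\<mu> - \<rho> * real (mi_order \<alpha>) + \<delta> * real d)"
    "\<And>k x. norm (trig_series (\<lambda>m. Q m * Delta \<alpha> (\<lambda>l. b l m) k) x)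
       \<le> D * weight k powr (\<mu> - \<rho> * real (mi_order \<alpha>) + \<delta> * real d)"
    using add.IH by blast
  have "norm (trig_series (\<lambda>m. (P m + Q m) * Delta \<alpha> (\<lambda>l. b l m) k) x)
       \<le> (C + D) * weight k powr (\<mu> - \<rho> * real (mi_order \<alpha>) + \<delta> * real d)" for k x
  proof -
    have "trig_series (\<lambda>m. (P m + Q m) * Delta \<alpha> (\<lambda>l. b l m) k) x =
        trig_series (\<lambda>m. P m * Delta \<alpha> (\<lambda>l. b l m) k) x + trig_series (\<lambda>m. Q m * Delta \<alpha> (\<lambda>l. b l m) k) x"
      unfolding distrib_right by (intro trig_series_add rapidly_decreasing_ffspan[OF add.hyps(1)]
          rapidly_decreasing_ffspan[OF add.hyps(2)] r)
    then show ?thesis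
      using norm_triangle_le[OF add_mono[OF CD(3)[of k x] CD(4)[of k x]]] by (simp add: distrib_right)
  qed
  then show ?case using CD by (intro exI[of _ "C + D"]) auto
next
  case (scale P a)
  obtain C where C: "C > 0"
    "\<And>k x. norm (trig_series (\<lambda>m. P m * Delta \<alpha> (\<lambda>l. b l m) k) x)
       \<le> C * weight k powr (\<mu> - \<rho> * real (mi_order \<alpha>) + \<delta> * real d)"
    using scale.IH by blast
  have "norm (trig_series (\<lambda>m. a * P m * Delta \<alpha> (\<lambda>l. b l m) k) x)
       \<le> ((norm a + 1) * C) * weight k powr (\<mu> - \<rho> * real (mi_order \<alpha>) + \<delta> * real d)" for k x
  proof -
    have "norm (trig_series (\<lambda>m. a * P m * Delta \<alpha> (\<lambda>l. b l m) k) x) =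
        norm a * norm (trig_series (\<lambda>m. P m * Delta \<alpha> (\<lambda>l. b l m) k) x)"
      unfolding mult.assoc trig_series_cmult by (rule norm_mult)
    also have "\<dots> \<le> (norm a + 1) * (C * weight k powr (\<mu> - \<rho> * real (mi_order \<alpha>) + \<delta> * real d))"
      by (intro mult_mono C(2)) auto
    finally show ?thesis by (simp add: mult.assoc)
  qed
  then show ?case using C(1) by (intro exI[of _ "(norm a + 1) * C"]) (auto intro!: mult_pos_pos add_nonneg_pos)
qed

lemma coef_symbol_add:
  assumes "b \<in> coef_symbol \<mu> \<rho> \<delta>" "b' \<in> coef_symbol \<mu> \<rho> \<delta>"
  shows "(\<lambda>k m. b k m + b' k m) \<in> coef_symbol \<mu> \<rho> \<delta>"
proof (rule coef_symbolI)
  show "rapidly_decreasing (\<lambda>m. b k m + b' k m)" for k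
    by (intro rapidly_decreasing_add coef_symbolD(1)[OF assms(1)] coef_symbolD(1)[OF assms(2)])
  fix \<alpha> \<beta> :: "nat ^ 'a::_"
  have r: "rapidly_decreasing (\<lambda>m. ff \<beta> m * Delta \<alpha> (\<lambda>l. b l m) k)"
    "rapidly_decreasing (\<lambda>m. ff \<beta> m * Delta \<alpha> (\<lambda>l. b' l m) k)" for k
    by (intro rapidly_decreasing_ff rapidly_decreasing_Delta coef_symbolD(1)[OF assms(1)]
        coef_symbolD(1)[OF assms(2)])+
  let ?s = "\<mu> - \<rho> * real (mi_order \<alpha>) + \<delta> * real (mi_order \<beta>)"
  obtain C where C: "C > 0" "\<And>k x. norm (trig_series (\<lambda>m. ff \<beta> m * Delta \<alpha> (\<lambda>l. b l m) k) x) \<le> C * weight k powr ?s"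
    using coef_symbolD(2)[OF assms(1)] by blast
  obtain D where D: "D > 0" "\<And>k x. norm (trig_series (\<lambda>m. ff \<beta> m * Delta \<alpha> (\<lambda>l. b' l m) k) x) \<le> D * weight k powr ?s"
    using coef_symbolD(2)[OF assms(2)] by blast
  have "norm (trig_series (\<lambda>m. ff \<beta> m * Delta \<alpha> (\<lambda>l. b l m + b' l m) k) x) \<le> (C + D) * weight k powr ?s" for k x
  proof -
    have "trig_series (\<lambda>m. ff \<beta> m * Delta \<alpha> (\<lambda>l. b l m + b' l m) k) x =
      trig_series (\<lambda>m. ff \<beta> m * Delta \<alpha> (\<lambda>l. b l m) k) x + trig_series (\<lambda>m. ff \<beta> m * Delta \<alpha> (\<lambda>l. b' l m) k) x"
      unfolding Delta_add distrib_left by (intro trig_series_add r)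
    then show ?thesis
      using norm_triangle_le[OF add_mono[OF C(2)[of k x] D(2)[of k x]]] by (simp add: distrib_right)
  qed
  then show "\<exists>C>0. \<forall>k x. norm (trig_series (\<lambda>m. ff \<beta> m * Delta \<alpha> (\<lambda>l. b l m + b' l m) k) x) \<le> C * weight k powr ?s"
    using C D by (intro exI[of _ "C + D"]) auto
qed

lemma coef_symbol_cmult:
  assumes "b \<in> coef_symbol \<mu> \<rho> \<delta>"
  shows "(\<lambda>k m. a * b k m) \<in> coef_symbol \<mu> \<rho> \<delta>"
proof (rule coef_symbolI)
  show "rapidly_decreasing (\<lambda>m. a * b k m)" for k
    by (intro rapidly_decreasing_cmult coef_symbolD(1)[OF assms])
  fix \<alpha> \<beta> :: "nat ^ 'a::_"
  let ?s = "\<mu> - \<rho> * real (mi_order \<alpha>) + \<delta> * real (mi_order \<beta>)"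
  obtain C where C: "C > 0" "\<And>k x. norm (trig_series (\<lambda>m. ff \<beta> m * Delta \<alpha> (\<lambda>l. b l m) k) x) \<le> C * weight k powr ?s"
    using coef_symbolD(2)[OF assms] by blast
  have "norm (trig_series (\<lambda>m. ff \<beta> m * Delta \<alpha> (\<lambda>l. a * b l m) k) x) \<le> ((norm a + 1) * C) * weight k powr ?s" for k x
  proof -
    have "norm (trig_series (\<lambda>m. ff \<beta> m * Delta \<alpha> (\<lambda>l. a * b l m) k) x) =
        norm a * norm (trig_series (\<lambda>m. ff \<beta> m * Delta \<alpha> (\<lambda>l. b l m) k) x)"
      unfolding Delta_cmult mult.left_commute[of _ a] trig_series_cmult by (rule norm_mult)
    also have "\<dots> \<le> (norm a + 1) * (C * weight k powr ?s)"
      by (intro mult_mono C(2)) auto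
    finally show ?thesis by (simp add: mult.assoc)
  qed
  then show "\<exists>C>0. \<forall>k x. norm (trig_series (\<lambda>m. ff \<beta> m * Delta \<alpha> (\<lambda>l. a * b l m) k) x) \<le> C * weight k powr ?s"
    using C by (intro exI[of _ "(norm a + 1) * C"]) (auto intro!: mult_pos_pos add_nonneg_pos)
qed

lemma Delta_zero: "Delta \<alpha> (\<lambda>l. 0) k = 0"
  using Delta_cmult[of \<alpha> 0 "\<lambda>l. 0" k] by simp

lemma coef_symbol_sum:
  "(\<And>i. i \<in> I \<Longrightarrow> b i \<in> coef_symbol \<mu> \<rho> \<delta>) \<Longrightarrow> (\<lambda>k m. \<Sum>i\<in>I. b i k m) \<in> coef_symbol \<mu> \<rho> \<delta>"
proof (induction I rule: infinite_finite_induct)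
  case (insert i I)
  then show ?case by (simp add: coef_symbol_add)
qed (auto intro!: coef_symbolI exI[of _ 1] simp: rapidly_decreasing_zero Delta_zero trig_series_def)

lemma coef_symbol_mono:
  assumes "b \<in> coef_symbol \<mu> \<rho> \<delta>" "\<mu> \<le> \<mu>'"
  shows "b \<in> coef_symbol \<mu>' \<rho> \<delta>"
proof (rule coef_symbolI)
  show "rapidly_decreasing (b k)" for k by (rule coef_symbolD(1)[OF assms(1)])
  fix \<alpha> \<beta> :: "nat ^ 'a::_"
  let ?s = "\<lambda>\<mu>. \<mu> - \<rho> * real (mi_order \<alpha>) + \<delta> * real (mi_order \<beta>)"
  obtain C where C: "C > 0" "\<And>k x. norm (trig_series (\<lambda>m. ff \<beta> m * Delta \<alpha> (\<lambda>l. b l m) k) x) \<le> C * weight k powr ?s \<mu>"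
    using coef_symbolD(2)[OF assms(1)] by blast
  have "norm (trig_series (\<lambda>m. ff \<beta> m * Delta \<alpha> (\<lambda>l. b l m) k) x) \<le> C * weight k powr ?s \<mu>'" for k x
    using C(1) assms(2) by (intro order_trans[OF C(2)] mult_left_mono powr_mono) (auto simp: weight_ge_1)
  then show "\<exists>C>0. \<forall>k x. norm (trig_series (\<lambda>m. ff \<beta> m * Delta \<alpha> (\<lambda>l. b l m) k) x) \<le> C * weight k powr ?s \<mu>'"
    using C(1) by blast
qed

text \<open>The differences gain \<rho>|\<gamma>| and the multiplier \<open>ff \<gamma>\<close>
  costs \<delta>|\<gamma>|. With \<open>ff \<beta>\<close> it forms a product that need not be a
  falling factorial, hence the detour through \<open>ffspan\<close>.\<close>

lemma coef_symbol_taylor_term: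
  assumes b: "b \<in> coef_symbol \<mu> \<rho> \<delta>" and \<delta>: "0 \<le> \<delta>"
  shows "(\<lambda>k m. taylor_term \<gamma> (\<lambda>l. b l m) k m) \<in> coef_symbol (\<mu> - real (mi_order \<gamma>) * (\<rho> - \<delta>)) \<rho> \<delta>"
  unfolding taylor_term_def
proof (intro coef_symbol_cmult coef_symbolI)
  show "rapidly_decreasing (\<lambda>m. ff \<gamma> m * Delta \<gamma> (\<lambda>l. b l m) k)" for k
    by (intro rapidly_decreasing_ff rapidly_decreasing_Delta coef_symbolD(1)[OF b])
  fix \<alpha> \<beta> :: "nat ^ 'a::_"
  obtain C where C: "C > 0" "\<And>k x. norm (trig_series (\<lambda>m. (ff \<beta> m * ff \<gamma> m) * Delta (\<alpha> + \<gamma>) (\<lambda>l. b l m) k) x)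
      \<le> C * weight k powr (\<mu> - \<rho> * real (mi_order (\<alpha> + \<gamma>)) + \<delta> * real (mi_order \<beta> + mi_order \<gamma>))"
    using coef_symbol_ffspan[OF b \<delta> ffspan_mult_ff[OF ffspan.base[OF order_refl, of \<gamma>], of \<beta>], of "\<alpha> + \<gamma>"] by blast
  have e: "\<mu> - \<rho> * real (mi_order (\<alpha> + \<gamma>)) + \<delta> * real (mi_order \<beta> + mi_order \<gamma>) =
      \<mu> - real (mi_order \<gamma>) * (\<rho> - \<delta>) - \<rho> * real (mi_order \<alpha>) + \<delta> * real (mi_order \<beta>)"
    by (simp add: mi_order_add algebra_simps)
  have eq: "ff \<beta> m * Delta \<alpha> (\<lambda>l. ff \<gamma> m * Delta \<gamma> (\<lambda>l. b l m) l) k =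
      (ff \<beta> m * ff \<gamma> m) * Delta (\<alpha> + \<gamma>) (\<lambda>l. b l m) k" for m k
    by (simp only: Delta_cmult Delta_Delta mult.assoc)
  show "\<exists>C>0. \<forall>k x. norm (trig_series (\<lambda>m. ff \<beta> m * Delta \<alpha> (\<lambda>l. ff \<gamma> m * Delta \<gamma> (\<lambda>l. b l m) l) k) x)
      \<le> C * weight k powr (\<mu> - real (mi_order \<gamma>) * (\<rho> - \<delta>) - \<rho> * real (mi_order \<alpha>) + \<delta> * real (mi_order \<beta>))"
    using C unfolding e eq by blast
qed

text \<open>Reflection replaces \<open>ff \<beta> m\<close> by \<open>ff \<beta> (- m)\<close>, a
  polynomial of the same degree; the bound is uniform in x and therefore holds at \<open>- x\<close>
  as well.\<close>

lemma coef_symbol_uminus: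
  assumes b: "b \<in> coef_symbol \<mu> \<rho> \<delta>" and \<delta>: "0 \<le> \<delta>"
  shows "(\<lambda>k m. b k (- m)) \<in> coef_symbol \<mu> \<rho> \<delta>"
proof (rule coef_symbolI)
  show "rapidly_decreasing (\<lambda>m. b k (- m))" for k
    by (intro rapidly_decreasing_uminus coef_symbolD(1)[OF b])
  fix \<alpha> \<beta> :: "nat ^ 'a::_"
  let ?s = "\<mu> - \<rho> * real (mi_order \<alpha>) + \<delta> * real (mi_order \<beta>)"
  have eq: "trig_series (\<lambda>m. ff \<beta> m * Delta \<alpha> (\<lambda>l. b l (- m)) k) x =
      trig_series (\<lambda>m. ff \<beta> (- m) * Delta \<alpha> (\<lambda>l. b l m) k) (- x)" for k x
    unfolding trig_series_minus_right by simp
  obtain C where C: "C > 0"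
    "\<And>k x. norm (trig_series (\<lambda>m. ff \<beta> (- m) * Delta \<alpha> (\<lambda>l. b l m) k) x) \<le> C * weight k powr ?s"
    using coef_symbol_ffspan[OF b \<delta> ffspan_ff_uminus[of \<beta>], of \<alpha>] by blast
  have "norm (trig_series (\<lambda>m. ff \<beta> m * Delta \<alpha> (\<lambda>l. b l (- m)) k) x) \<le> C * weight k powr ?s" for k x
    unfolding eq by (rule C(2))
  then show "\<exists>C>0. \<forall>k x. norm (trig_series (\<lambda>m. ff \<beta> m * Delta \<alpha> (\<lambda>l. b l (- m)) k) x) \<le> C * weight k powr ?s"
    using C(1) by blast
qed

subsection \<open>Decay of Fourier coefficients\<close>

text \<open>Each power of \<open>weight m\<close> costs \<delta> powers of \<open>weight k\<close>,
  just as each x-derivative does in the symbol class.\<close>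

definition coef_decay ::
    "real \<Rightarrow> real \<Rightarrow> real \<Rightarrow> (int ^ 'n::{finite,linorder} \<Rightarrow> int ^ 'n::_ \<Rightarrow> complex) set" where
  "coef_decay \<mu> \<rho> \<delta> = {b. \<forall>\<alpha> M. \<exists>C>0. \<forall>k m. norm (Delta \<alpha> (\<lambda>l. b l m) k)
     \<le> C * weight k powr (\<mu> - \<rho> * real (mi_order \<alpha>) + \<delta> * real M) / weight m ^ M}"

text \<open>A coefficient is at most the supremum of its function, so the bounds with multipliers 1
  and m_j^M pass to every coefficient with \<mu> unchanged; \<open>weight_power_le\<close> joins the
  coordinates.\<close>

lemma coef_symbol_imp_decay:
  fixes b :: "int ^ 'n::{finite,linorder} \<Rightarrow> int ^ 'n::_ \<Rightarrow> complex"
  assumes b: "b \<in> coef_symbol \<mu> \<rho> \<delta>" and \<delta>: "0 \<le> \<delta>"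
  shows "b \<in> coef_decay \<mu> \<rho> \<delta>"
  unfolding coef_decay_def mem_Collect_eq
proof (intro allI)
  fix \<alpha> :: "nat ^ 'n::_" and M :: nat
  let ?s = "\<mu> - \<rho> * real (mi_order \<alpha>) + \<delta> * real M"
  define c where "c k m = Delta \<alpha> (\<lambda>l. b l m) k" for k m
  have r: "rapidly_decreasing (c k)" for k
    unfolding c_def by (intro rapidly_decreasing_Delta coef_symbolD(1)[OF b])
  have bound: "\<exists>C>0. \<forall>k m. norm (P m * c k m) \<le> C * weight k powr ?s" if P: "ffspan M P" for P
  proof -
    obtain C where C: "C > 0" "\<And>k x. norm (trig_series (\<lambda>m. P m * c k m) x) \<le> C * weight k powr ?s"
      using coef_symbol_ffspan[OF b \<delta> P, of \<alpha>] unfolding c_def by blast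
    have "norm (P m * c k m) \<le> C * weight k powr ?s" for k m
    proof -
      have rP: "rapidly_decreasing (\<lambda>m. P m * c k m)" by (rule rapidly_decreasing_ffspan[OF P r])
      have "norm (fcoef (trig_series (\<lambda>m. P m * c k m)) m) \<le> C * weight k powr ?s"
        by (intro norm_fcoef_le C(2) smooth_torusD(2) smooth_torus_trig_series rP)
      then show ?thesis by (simp add: fcoef_trig_series[OF rP])
    qed
    then show ?thesis using C(1) by blast
  qed
  obtain C0 where C0: "C0 > 0" "\<And>k m. norm (c k m) \<le> C0 * weight k powr ?s"
    using bound[OF ffspan.base[of 0]] by auto
  have "\<exists>C>0. \<forall>k m. norm (of_int (m $ j) ^ M * c k m) \<le> C * weight k powr ?s" for j
    by (rule bound[OF ffspan_component_power])
  then obtain C where C: "\<And>j. C j > 0" "\<And>j k m. norm (of_int (m $ j) ^ M * c k m) \<le> C j * weight k powr ?s"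
    by metis
  have "norm (c k m) \<le> ((1 + real CARD('n)) ^ M * (C0 + (\<Sum>j\<in>UNIV. C j))) * weight k powr ?s / weight m ^ M" for k m
  proof -
    have "weight m ^ M * norm (c k m) \<le>
        (1 + real CARD('n)) ^ M * (1 + (\<Sum>j\<in>UNIV. \<bar>real_of_int (m $ j)\<bar> ^ M)) * norm (c k m)"
      by (intro mult_right_mono weight_power_le) auto
    also have "\<dots> = (1 + real CARD('n)) ^ M *
        (norm (c k m) + (\<Sum>j\<in>UNIV. \<bar>real_of_int (m $ j)\<bar> ^ M * norm (c k m)))"
      unfolding sum_distrib_right[symmetric] by (simp add: distrib_right mult.assoc)
    also have "\<dots> \<le> (1 + real CARD('n)) ^ M * (C0 * weight k powr ?s + (\<Sum>j\<in>UNIV. C j * weight k powr ?s))"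
      using C(2) by (intro mult_left_mono add_mono sum_mono C0) (auto simp: norm_mult norm_power)
    also have "\<dots> = ((1 + real CARD('n)) ^ M * (C0 + (\<Sum>j\<in>UNIV. C j))) * weight k powr ?s"
      unfolding sum_distrib_right[symmetric] by (simp add: distrib_right mult.assoc)
    finally show ?thesis by (simp add: pos_le_divide_eq mult.commute)
  qed
  moreover have "(1 + real CARD('n)) ^ M * (C0 + (\<Sum>j\<in>UNIV. C j)) > 0"
    using C0(1) C(1) by (intro mult_pos_pos add_pos_nonneg sum_nonneg zero_less_power) (auto intro: less_imp_le)
  ultimately show "\<exists>C>0. \<forall>k m. norm (Delta \<alpha> (\<lambda>l. b l m) k) \<le> C * weight k powr ?s / weight m ^ M"
    unfolding c_def by blast
qed

text \<open>Absolute summation over \<open>m\<close>, using decay of order |\<beta>| + 2n: the first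
  part absorbs \<open>ff \<beta>\<close>, the second makes the sum converge and accounts for the
  increase of the order by 2n\<delta>.\<close>

lemma coef_decay_imp_symbol:
  fixes b :: "int ^ 'n::{finite,linorder} \<Rightarrow> int ^ 'n::_ \<Rightarrow> complex"
  assumes b: "b \<in> coef_decay \<mu> \<rho> \<delta>"
  shows "b \<in> coef_symbol (\<mu> + \<delta> * real (2 * CARD('n))) \<rho> \<delta>"
proof (rule coef_symbolI)
  show "rapidly_decreasing (b k)" for k
    unfolding rapidly_decreasing_def
  proof
    fix M
    have "\<exists>C>0. \<forall>k m. norm (Delta 0 (\<lambda>l. b l m) k) \<le> C * weight k powr (\<mu> - \<rho> * real (mi_order (0 :: nat ^ 'n::_)) + \<delta> * real M) / weight m ^ M"
      using b unfolding coef_decay_def by blast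
    then show "\<exists>C. \<forall>m. norm (b k m) \<le> C / weight m ^ M" by auto
  qed
  fix \<alpha> \<beta> :: "nat ^ 'n::_"
  let ?s = "\<mu> + \<delta> * real (2 * CARD('n)) - \<rho> * real (mi_order \<alpha>) + \<delta> * real (mi_order \<beta>)"
  define S where "S = (\<Sum>\<^sub>\<infinity>m :: int ^ 'n::_. 1 / weight m ^ (2 * CARD('n)))"
  have S: "0 \<le> S" unfolding S_def by (intro infsum_nonneg) auto
  obtain A where A: "A > 0" "\<And>m. norm (ff \<beta> m) \<le> A * weight m ^ mi_order \<beta>" using norm_ff_le by blast
  obtain C where C: "C > 0" "\<And>k m. norm (Delta \<alpha> (\<lambda>l. b l m) k) \<le>
      C * weight k powr (\<mu> - \<rho> * real (mi_order \<alpha>) + \<delta> * real (mi_order \<beta> + 2 * CARD('n))) / weight m ^ (mi_order \<beta> + 2 * CARD('n))"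
    using b unfolding coef_decay_def by blast
  have s: "\<mu> - \<rho> * real (mi_order \<alpha>) + \<delta> * real (mi_order \<beta> + 2 * CARD('n)) = ?s"
    by (simp add: algebra_simps)
  have "norm (trig_series (\<lambda>m. ff \<beta> m * Delta \<alpha> (\<lambda>l. b l m) k) x) \<le> (A * C * (S + 1)) * weight k powr ?s" for k x
  proof -
    have le: "norm (ff \<beta> m * Delta \<alpha> (\<lambda>l. b l m) k) \<le> A * C * weight k powr ?s * (1 / weight m ^ (2 * CARD('n)))" for m
    proof -
      have "norm (ff \<beta> m * Delta \<alpha> (\<lambda>l. b l m) k) \<le>
          (A * weight m ^ mi_order \<beta>) * (C * weight k powr ?s / weight m ^ (mi_order \<beta> + 2 * CARD('n)))"
        unfolding norm_mult using A C(2)[of m k] unfolding s by (intro mult_mono) auto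
      also have "\<dots> = A * C * weight k powr ?s * (1 / weight m ^ (2 * CARD('n)))"
        by (simp add: power_add)
      finally show ?thesis .
    qed
    have sm: "(\<lambda>m :: int ^ 'n::_. A * C * weight k powr ?s * (1 / weight m ^ (2 * CARD('n)))) summable_on UNIV"
      by (intro summable_on_cmult_right summable_on_inverse_weight_power)
    have sn: "(\<lambda>m. norm (ff \<beta> m * Delta \<alpha> (\<lambda>l. b l m) k)) summable_on UNIV"
      by (rule summable_on_comparison_test[OF sm]) (use le in auto)
    have "norm (trig_series (\<lambda>m. ff \<beta> m * Delta \<alpha> (\<lambda>l. b l m) k) x) \<le> (\<Sum>\<^sub>\<infinity>m. norm (ff \<beta> m * Delta \<alpha> (\<lambda>l. b l m) k))"
      by (rule norm_trig_series_le[OF sn])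
    also have "\<dots> \<le> (\<Sum>\<^sub>\<infinity>m :: int ^ 'n::_. A * C * weight k powr ?s * (1 / weight m ^ (2 * CARD('n))))"
      by (rule infsum_mono[OF sn sm le])
    also have "\<dots> = A * C * weight k powr ?s * S" unfolding S_def by (rule infsum_cmult_right')
    also have "\<dots> \<le> A * C * weight k powr ?s * (S + 1)" using A C by (intro mult_left_mono) auto
    finally show ?thesis by (simp only: mult_ac)
  qed
  moreover have "0 < A * C * (S + 1)" using A C S by simp
  ultimately show "\<exists>C>0. \<forall>k x. norm (trig_series (\<lambda>m. ff \<beta> m * Delta \<alpha> (\<lambda>l. b l m) k) x) \<le> C * weight k powr ?s"
    by blast
qed

subsection \<open>Remainder estimates\<close>

lemma coef_decay_Delta:
  assumes "b \<in> coef_decay \<mu> \<rho> \<delta>"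
  shows "(\<lambda>k m. Delta \<gamma> (\<lambda>l. b l m) k) \<in> coef_decay (\<mu> - \<rho> * real (mi_order \<gamma>)) \<rho> \<delta>"
  unfolding coef_decay_def mem_Collect_eq
proof (intro allI)
  fix \<alpha> :: "nat ^ 'a::_" and M
  have e: "\<mu> - \<rho> * real (mi_order (\<alpha> + \<gamma>)) + \<delta> * real M =
      \<mu> - \<rho> * real (mi_order \<gamma>) - \<rho> * real (mi_order \<alpha>) + \<delta> * real M"
    by (simp add: mi_order_add algebra_simps)
  have "\<exists>C>0. \<forall>k m. norm (Delta (\<alpha> + \<gamma>) (\<lambda>l. b l m) k) \<le>
      C * weight k powr (\<mu> - \<rho> * real (mi_order (\<alpha> + \<gamma>)) + \<delta> * real M) / weight m ^ M"
    using assms unfolding coef_decay_def by blast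
  then show "\<exists>C>0. \<forall>k m. norm (Delta \<alpha> (\<lambda>l. Delta \<gamma> (\<lambda>l. b l m) l) k) \<le>
      C * weight k powr (\<mu> - \<rho> * real (mi_order \<gamma>) - \<rho> * real (mi_order \<alpha>) + \<delta> * real M) / weight m ^ M"
    unfolding e Delta_Delta .
qed

text \<open>Where both weights are controlled by \<open>weight m\<close>, a high power of \<open>weight m\<close> absorbs every
  power of \<open>weight k\<close>.\<close>

lemma far_bound:
  fixes w z A X C s q e :: real
  assumes X: "X \<le> C * z powr s * w powr q"
    and C: "0 \<le> C" and z: "1 \<le> z" "z \<le> A * w" and v: "1 \<le> v" "v \<le> A * w" and w: "1 \<le> w" and A: "1 \<le> A"
    and le: "\<bar>s\<bar> + \<bar>e\<bar> + q \<le> - real L"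
  shows "X \<le> C * A powr (\<bar>s\<bar> + \<bar>e\<bar>) * v powr e / w ^ L"
proof -
  have "z powr s \<le> z powr \<bar>s\<bar>" using z by (intro powr_mono) auto
  also have "\<dots> \<le> (A * w) powr \<bar>s\<bar>" using z by (intro powr_mono2) auto
  finally have 1: "z powr s \<le> (A * w) powr \<bar>s\<bar>" .
  \<comment> \<open>The target power \<open>v powr e\<close> enters through a factor that is at
    least 1, at the expense of |e| further powers of \<open>w\<close>.\<close>
  have "v powr (- e) \<le> v powr \<bar>e\<bar>" using v by (intro powr_mono) auto
  also have "\<dots> \<le> (A * w) powr \<bar>e\<bar>" using v by (intro powr_mono2) auto
  finally have "v powr e * v powr (- e) \<le> v powr e * (A * w) powr \<bar>e\<bar>" by (intro mult_left_mono) auto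
  then have 2: "1 \<le> v powr e * (A * w) powr \<bar>e\<bar>" using v by (simp add: powr_add[symmetric])
  have "X \<le> C * (A * w) powr \<bar>s\<bar> * w powr q"
    using 1 C by (intro order_trans[OF X] mult_right_mono mult_left_mono) auto
  also have "\<dots> \<le> C * (A * w) powr \<bar>s\<bar> * w powr q * (v powr e * (A * w) powr \<bar>e\<bar>)"
  proof -
    have "0 \<le> C * (A * w) powr \<bar>s\<bar> * w powr q" using C by simp
    from mult_left_mono[OF 2 this] show ?thesis by simp
  qed
  also have "\<dots> = C * A powr (\<bar>s\<bar> + \<bar>e\<bar>) * v powr e * w powr (\<bar>s\<bar> + \<bar>e\<bar> + q)"
    using A w by (simp add: powr_mult powr_add mult_ac)
  also have "\<dots> \<le> C * A powr (\<bar>s\<bar> + \<bar>e\<bar>) * v powr e * w powr (- real L)"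
    using C w le by (intro mult_left_mono powr_mono) auto
  finally show ?thesis using w by (simp add: powr_minus_divide powr_realpow)
qed

text \<open>Decay of order \<open>M\<close> gains \<open>M\<close> powers of \<open>weight m\<close>
  and costs \<delta>M powers of \<open>weight k\<close>. Where the latter are bounded by powers of
  \<open>weight m\<close>, the net gain (1 - \<delta>)M is unbounded.\<close>

lemma exists_large_power:
  assumes "\<delta> < (1 :: real)"
  obtains M :: nat where "a + \<delta> * real M - real M \<le> - real L"
proof -
  obtain M :: nat where "(a + real L) / (1 - \<delta>) \<le> real M" using real_arch_simple by blast
  then have "a + real L \<le> (1 - \<delta>) * real M" using assms by (simp add: field_simps)
  then show ?thesis by (intro that[of M]) (simp add: algebra_simps)
qed

text \<open>All points of the path have weight comparable to \<open>weight k\<close>, so the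
  differences of order \<open>N\<close> are uniformly controlled. Decay of order N + L is used:
  \<open>N\<close> powers of \<open>weight m\<close> pay for the factor \<open>l1 m ^ N\<close> of
  the path, \<open>L\<close> remain.\<close>

lemma taylor_rem_near:
  fixes b :: "int ^ 'n::{finite,linorder} \<Rightarrow> int ^ 'n::_ \<Rightarrow> complex"
  assumes b: "b \<in> coef_decay \<mu> \<rho> \<delta>"
  shows "\<exists>C>0. \<forall>k m. real (l1 m) \<le> norm (lattice_vec k) / 2 \<longrightarrow>
    norm (taylor_rem N (\<lambda>l. b l m) k m) \<le> C * weight k powr (\<mu> - real N * (\<rho> - \<delta>) + \<delta> * real L) / weight m ^ L"
proof -
  define s where "s = \<mu> - \<rho> * real N + \<delta> * real (N + L)"
  have "\<exists>C>0. \<forall>k m. norm (Delta \<alpha> (\<lambda>l. b l m) k) \<le>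
      C * weight k powr (\<mu> - \<rho> * real (mi_order \<alpha>) + \<delta> * real (N + L)) / weight m ^ (N + L)" for \<alpha>
    using b unfolding coef_decay_def by blast
  then obtain C where C: "\<And>\<alpha>. C \<alpha> > 0" "\<And>\<alpha> k m. norm (Delta \<alpha> (\<lambda>l. b l m) k) \<le>
      C \<alpha> * weight k powr (\<mu> - \<rho> * real (mi_order \<alpha>) + \<delta> * real (N + L)) / weight m ^ (N + L)"
    by metis
  \<comment> \<open>One constant for all \<alpha> of order \<open>N\<close>, over a larger index set
    whose finiteness is known; 1 is added for positivity.\<close>
  define D where "D = 1 + (\<Sum>\<alpha> | mi_order \<alpha> < Suc N. C \<alpha>)"
  have D: "D > 0" "\<And>\<alpha>. mi_order \<alpha> = N \<Longrightarrow> C \<alpha> \<le> D"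
  proof -
    show "D > 0" unfolding D_def by (intro add_pos_nonneg sum_nonneg) (auto intro: less_imp_le C(1))
    show "C \<alpha> \<le> D" if "mi_order \<alpha> = N" for \<alpha>
    proof -
      have "C \<alpha> \<le> (\<Sum>\<alpha> | mi_order \<alpha> < Suc N. C \<alpha>)"
        using that by (intro member_le_sum finite_mi_order_less) (auto intro: less_imp_le C(1))
      then show ?thesis by (simp add: D_def)
    qed
  qed
  let ?K = "D * 2 powr \<bar>s\<bar> * real CARD('n) ^ N"
  have "norm (taylor_rem N (\<lambda>l. b l m) k m) \<le> ?K * weight k powr s / weight m ^ L"
    if near: "real (l1 m) \<le> norm (lattice_vec k) / 2" for k m
  proof -
    define B where "B = D * (2 powr \<bar>s\<bar> * weight k powr s) / weight m ^ (N + L)"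
    have B: "0 \<le> B" unfolding B_def using D(1) by simp
    have "norm (taylor_rem N (\<lambda>l. b l m) k m) \<le> B * real (l1 m) ^ N"
    proof (rule norm_taylor_rem_le)
      fix \<alpha> :: "nat ^ 'n::_" and m' :: "int ^ 'n::_" assume \<alpha>: "mi_order \<alpha> = N" and m': "l1 m' \<le> l1 m"
      have "norm (Delta \<alpha> (\<lambda>l. b l m) (k + m')) \<le> C \<alpha> * weight (k + m') powr s / weight m ^ (N + L)"
        using C(2)[of \<alpha> m "k + m'"] \<alpha> by (simp add: s_def)
      also have "\<dots> \<le> D * (2 powr \<bar>s\<bar> * weight k powr s) / weight m ^ (N + L)"
        using D \<alpha> C(1)[of \<alpha>] m' near by (intro divide_right_mono mult_mono weight_powr_near) auto
      finally show "norm (Delta \<alpha> (\<lambda>l. b l m) (k + m')) \<le> B" by (simp add: B_def)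
    qed simp
    also have "\<dots> \<le> B * (real CARD('n) * weight m) ^ N"
      by (intro mult_left_mono power_mono l1_le_weight B) auto
    also have "\<dots> = ?K * weight k powr s / weight m ^ L"
      by (simp add: B_def power_add power_mult_distrib)
    finally show ?thesis .
  qed
  moreover have "?K > 0" using D by simp
  moreover have s_eq: "\<mu> - real N * (\<rho> - \<delta>) + \<delta> * real L = s" by (simp add: s_def algebra_simps)
  ultimately show ?thesis unfolding s_eq by blast
qed

text \<open>Without any cancellation, b(k + m, m) and the finitely many Taylor terms are estimated
  one by one with \<open>far_bound\<close>. Arbitrary decay in \<open>m\<close> makes every exponent
  \<open>e\<close> attainable.\<close>

lemma taylor_rem_far:
  fixes b :: "int ^ 'n::{finite,linorder} \<Rightarrow> int ^ 'n::_ \<Rightarrow> complex"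
  assumes b: "b \<in> coef_decay \<mu> \<rho> \<delta>" and \<delta>: "0 \<le> \<delta>" "\<delta> < 1"
  shows "\<exists>C>0. \<forall>k m. \<not> real (l1 m) \<le> norm (lattice_vec k) / 2 \<longrightarrow>
    norm (taylor_rem N (\<lambda>l. b l m) k m) \<le> C * weight k powr e / weight m ^ L"
proof -
  define A where "A = 1 + 2 * real CARD('n)"
  have A: "1 \<le> A" by (simp add: A_def)
  have far: "weight k \<le> A * weight m" "weight (k + m) \<le> A * weight m"
    if "\<not> real (l1 m) \<le> norm (lattice_vec k) / 2" for k m :: "int ^ 'n::_"
  proof -
    have 1: "weight k \<le> 2 * real CARD('n) * weight m" by (rule weight_le_far[OF that])
    then show "weight k \<le> A * weight m"
      using weight_nonneg[of m] unfolding A_def distrib_right by linarith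
    have "weight (k + m) \<le> weight k + weight m"
      using norm_triangle_ineq[of "lattice_vec k" "lattice_vec m"] by (simp add: weight_def)
    with 1 show "weight (k + m) \<le> A * weight m" unfolding A_def distrib_right by linarith
  qed
  have dec: "\<exists>C>0. \<forall>k m. norm (Delta \<alpha> (\<lambda>l. b l m) k) \<le>
      C * weight k powr (\<mu> - \<rho> * real (mi_order \<alpha>) + \<delta> * real M) / weight m ^ M" for \<alpha> M
    using b unfolding coef_decay_def by blast
  have shifted: "\<exists>C>0. \<forall>k m. \<not> real (l1 m) \<le> norm (lattice_vec k) / 2 \<longrightarrow>
    norm (b (k + m) m) \<le> C * weight k powr e / weight m ^ L"
  proof -
    \<comment> \<open>This implies the exponent condition of \<open>far_bound\<close> for s = \<mu>
      + \<delta>M and q = -M by the triangle inequality.\<close>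
    obtain M :: nat where M: "\<bar>\<mu>\<bar> + \<bar>e\<bar> + \<delta> * real M - real M \<le> - real L"
      using exists_large_power[OF \<delta>(2)] by blast
    obtain C where C: "C > 0" "\<And>k m. norm (b k m) \<le> C * weight k powr (\<mu> + \<delta> * real M) / weight m ^ M"
      using dec[of 0 M] by auto
    have "norm (b (k + m) m) \<le> C * A powr (\<bar>\<mu> + \<delta> * real M\<bar> + \<bar>e\<bar>) * weight k powr e / weight m ^ L"
      if f: "\<not> real (l1 m) \<le> norm (lattice_vec k) / 2" for k m
    proof (rule far_bound)
      show "norm (b (k + m) m) \<le> C * weight (k + m) powr (\<mu> + \<delta> * real M) * weight m powr (- real M)"
        using C(2)[of "k + m" m] by (simp add: powr_minus_divide powr_realpow)
      show "\<bar>\<mu> + \<delta> * real M\<bar> + \<bar>e\<bar> + - real M \<le> - real L"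
        using M \<delta> abs_triangle_ineq[of \<mu> "\<delta> * real M"] by (simp add: abs_mult)
    qed (use C A far[OF f] weight_ge_1 in auto)
    moreover have "C * A powr (\<bar>\<mu> + \<delta> * real M\<bar> + \<bar>e\<bar>) > 0" using C A by simp
    ultimately show ?thesis by blast
  qed
  have "\<exists>C>0. \<forall>k m. \<not> real (l1 m) \<le> norm (lattice_vec k) / 2 \<longrightarrow>
    norm (taylor_term \<alpha> (\<lambda>l. b l m) k m) \<le> C * weight k powr e / weight m ^ L" for \<alpha>
  proof -
    let ?a = "mi_order \<alpha>"
    \<comment> \<open>Compared with the shifted coefficient, the differences add up to
      |\<rho>||\<alpha>| to |s|, and the growth of \<open>ff \<alpha>\<close> adds |\<alpha>| to
      q.\<close>
    obtain M :: nat where M: "\<bar>\<mu>\<bar> + \<bar>\<rho>\<bar> * real ?a + real ?a + \<bar>e\<bar> + \<delta> * real M - real M \<le> - real L"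
      using exists_large_power[OF \<delta>(2)] by blast
    define s where "s = \<mu> - \<rho> * real ?a + \<delta> * real M"
    obtain C where C: "C > 0" "\<And>k m. norm (Delta \<alpha> (\<lambda>l. b l m) k) \<le> C * weight k powr s / weight m ^ M"
      using dec[of \<alpha> M] unfolding s_def by auto
    obtain F where F: "F > 0" "\<And>m. norm (ff \<alpha> m) \<le> F * weight m ^ ?a" using norm_ff_le by blast
    have "norm (taylor_term \<alpha> (\<lambda>l. b l m) k m) \<le> (F * C) * A powr (\<bar>s\<bar> + \<bar>e\<bar>) * weight k powr e / weight m ^ L"
      if f: "\<not> real (l1 m) \<le> norm (lattice_vec k) / 2" for k m
    proof (rule far_bound)
      have "1 \<le> real (mi_fact \<alpha>)" using mi_fact_neq_0[of \<alpha>] by linarith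
      then have "norm (1 / of_nat (mi_fact \<alpha>) :: complex) \<le> 1" by (simp add: norm_divide)
      then have "norm (taylor_term \<alpha> (\<lambda>l. b l m) k m) \<le>
          1 * ((F * weight m ^ ?a) * (C * weight k powr s / weight m ^ M))"
        unfolding taylor_term_def norm_mult using F(1) C(1)
        by (intro mult_mono F(2) C(2)) auto
      then show "norm (taylor_term \<alpha> (\<lambda>l. b l m) k m) \<le>
          F * C * weight k powr s * weight m powr (real ?a - real M)"
        by (simp add: powr_diff powr_realpow mult_ac)
      have "\<bar>s\<bar> \<le> \<bar>\<mu>\<bar> + \<bar>\<rho> * real ?a\<bar> + \<bar>\<delta> * real M\<bar>" unfolding s_def by linarith
      then show "\<bar>s\<bar> + \<bar>e\<bar> + (real ?a - real M) \<le> - real L"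
        using M \<delta> by (simp add: abs_mult)
    qed (use C F A far[OF f] weight_ge_1 in auto)
    moreover have "F * C * A powr (\<bar>s\<bar> + \<bar>e\<bar>) > 0" using C F A by simp
    ultimately show ?thesis by blast
  qed
  then obtain T where T: "\<And>\<alpha>. T \<alpha> > 0" "\<And>\<alpha> k m. \<not> real (l1 m) \<le> norm (lattice_vec k) / 2 \<Longrightarrow>
    norm (taylor_term \<alpha> (\<lambda>l. b l m) k m) \<le> T \<alpha> * weight k powr e / weight m ^ L"
    by metis
  obtain C where C: "C > 0" "\<And>k m. \<not> real (l1 m) \<le> norm (lattice_vec k) / 2 \<Longrightarrow>
    norm (b (k + m) m) \<le> C * weight k powr e / weight m ^ L"
    using shifted by blast
  have "norm (taylor_rem N (\<lambda>l. b l m) k m) \<le> (C + (\<Sum>\<alpha> | mi_order \<alpha> < N. T \<alpha>)) * weight k powr e / weight m ^ L"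
    if f: "\<not> real (l1 m) \<le> norm (lattice_vec k) / 2" for k m
  proof -
    have "norm (taylor_rem N (\<lambda>l. b l m) k m) \<le>
        norm (b (k + m) m) + norm (\<Sum>\<alpha> | mi_order \<alpha> < N. taylor_term \<alpha> (\<lambda>l. b l m) k m)"
      unfolding taylor_rem_def by (rule norm_triangle_ineq4)
    also have "\<dots> \<le> C * weight k powr e / weight m ^ L + (\<Sum>\<alpha> | mi_order \<alpha> < N. T \<alpha> * weight k powr e / weight m ^ L)"
      by (intro add_mono C(2)[OF f] sum_norm_le T(2)[OF f])
    also have "\<dots> = (C + (\<Sum>\<alpha> | mi_order \<alpha> < N. T \<alpha>)) * weight k powr e / weight m ^ L"
      by (simp add: distrib_right sum_distrib_right add_divide_distrib sum_divide_distrib)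
    finally show ?thesis .
  qed
  moreover have "C + (\<Sum>\<alpha> | mi_order \<alpha> < N. T \<alpha>) > 0"
    using C(1) by (intro add_pos_nonneg sum_nonneg) (auto intro: less_imp_le T(1))
  ultimately show ?thesis by blast
qed

text \<open>Differences in \<open>k\<close> commute with the shift by \<open>m\<close> and with the
  differences inside the Taylor terms, while \<open>ff\<close> depends on \<open>m\<close>
  alone.\<close>

lemma Delta_taylor_rem:
  "Delta \<beta> (\<lambda>l. taylor_rem N (\<lambda>k. b k m) l m) k = taylor_rem N (Delta \<beta> (\<lambda>k. b k m)) k m"
proof -
  have "Delta \<beta> (Delta \<alpha> h) = Delta \<alpha> (Delta \<beta> h)" for \<alpha> and h :: "int ^ 'a::{finite,linorder} \<Rightarrow> complex"
    by (simp add: Delta_Delta add.commute)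
  then show ?thesis
    unfolding taylor_rem_def taylor_term_def Delta_diff Delta_sum Delta_cmult
      Delta_shift[of \<beta> "\<lambda>k. b k m" m]
    by simp
qed

text \<open>A difference of the remainder is the remainder of \<open>c\<close>, whose order is lower
  by \<rho>|\<alpha>|, so the undifferenced near and far estimates suffice. The free exponent of the
  far one is set to that of the near one.\<close>

lemma coef_decay_taylor_rem:
  fixes b :: "int ^ 'n::{finite,linorder} \<Rightarrow> int ^ 'n::_ \<Rightarrow> complex"
  assumes b: "b \<in> coef_decay \<mu> \<rho> \<delta>" and \<delta>: "0 \<le> \<delta>" "\<delta> < 1"
  shows "(\<lambda>k m. taylor_rem N (\<lambda>l. b l m) k m) \<in> coef_decay (\<mu> - real N * (\<rho> - \<delta>)) \<rho> \<delta>"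
  unfolding coef_decay_def mem_Collect_eq
proof (intro allI)
  fix \<alpha> :: "nat ^ 'n::_" and L :: nat
  define c where "c k m = Delta \<alpha> (\<lambda>l. b l m) k" for k m
  define e where "e = \<mu> - \<rho> * real (mi_order \<alpha>) - real N * (\<rho> - \<delta>) + \<delta> * real L"
  have c: "c \<in> coef_decay (\<mu> - \<rho> * real (mi_order \<alpha>)) \<rho> \<delta>"
    unfolding c_def by (rule coef_decay_Delta[OF b])
  obtain C where C: "C > 0" "\<And>k m. real (l1 m) \<le> norm (lattice_vec k) / 2 \<Longrightarrow>
      norm (taylor_rem N (\<lambda>l. c l m) k m) \<le> C * weight k powr e / weight m ^ L"
    using taylor_rem_near[OF c, of N L] unfolding e_def by blast
  obtain D where D: "D > 0" "\<And>k m. \<not> real (l1 m) \<le> norm (lattice_vec k) / 2 \<Longrightarrow>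
      norm (taylor_rem N (\<lambda>l. c l m) k m) \<le> D * weight k powr e / weight m ^ L"
    using taylor_rem_far[OF c \<delta>, of N e L] by blast
  have "norm (taylor_rem N (\<lambda>l. c l m) k m) \<le> max C D * weight k powr e / weight m ^ L" for k m
  proof (cases "real (l1 m) \<le> norm (lattice_vec k) / 2")
    case True
    from C(2)[OF this] show ?thesis
      by (rule order_trans) (intro divide_right_mono mult_right_mono, auto)
  next
    case False
    from D(2)[OF this] show ?thesis
      by (rule order_trans) (intro divide_right_mono mult_right_mono, auto)
  qed
  moreover have "Delta \<alpha> (\<lambda>l. taylor_rem N (\<lambda>l. b l m) l m) k = taylor_rem N (\<lambda>l. c l m) k m" for k m
    unfolding Delta_taylor_rem c_def ..
  moreover have "e = \<mu> - real N * (\<rho> - \<delta>) - \<rho> * real (mi_order \<alpha>) + \<delta> * real L"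
    by (simp add: e_def)
  ultimately show "\<exists>C>0. \<forall>k m. norm (Delta \<alpha> (\<lambda>l. taylor_rem N (\<lambda>l. b l m) l m) k)
     \<le> C * weight k powr (\<mu> - real N * (\<rho> - \<delta>) - \<rho> * real (mi_order \<alpha>) + \<delta> * real L) / weight m ^ L"
    using C(1) by (intro exI[of _ "max C D"]) auto
qed

text \<open>Passing from coefficient bounds back to symbols costs a fixed power of the weight, which
  expanding to a sufficiently high order \<open>N'\<close> regains because \<open>\<delta> < \<rho>\<close>.\<close>

lemma coef_symbol_taylor_rem:
  fixes b :: "int ^ 'n::{finite,linorder} \<Rightarrow> int ^ 'n::_ \<Rightarrow> complex"
  assumes b: "b \<in> coef_symbol \<mu> \<rho> \<delta>" and \<delta>: "0 \<le> \<delta>" "\<delta> < \<rho>" "\<rho> \<le> 1"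
  shows "(\<lambda>k m. taylor_rem N (\<lambda>l. b l m) k m) \<in> coef_symbol (\<mu> - real N * (\<rho> - \<delta>)) \<rho> \<delta>"
proof -
  \<comment> \<open>Chosen so that \<open>j\<close> further orders, worth j(\<rho> - \<delta>), make
    up for the loss 2n\<delta>.\<close>
  obtain j :: nat where j: "\<delta> * real (2 * CARD('n)) / (\<rho> - \<delta>) \<le> real j"
    using real_arch_simple by blast
  define N' where "N' = N + j"
  have "\<delta> * real (2 * CARD('n)) \<le> real j * (\<rho> - \<delta>)" using j \<delta> by (simp add: field_simps)
  then have le: "\<mu> - real N' * (\<rho> - \<delta>) + \<delta> * real (2 * CARD('n)) \<le> \<mu> - real N * (\<rho> - \<delta>)"
    by (simp add: N'_def distrib_right)
  have "(\<lambda>k m. taylor_rem N' (\<lambda>l. b l m) k m) \<in> coef_decay (\<mu> - real N' * (\<rho> - \<delta>)) \<rho> \<delta>"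
    using \<delta> by (intro coef_decay_taylor_rem coef_symbol_imp_decay b) auto
  then have high: "(\<lambda>k m. taylor_rem N' (\<lambda>l. b l m) k m) \<in> coef_symbol (\<mu> - real N * (\<rho> - \<delta>)) \<rho> \<delta>"
    by (intro coef_symbol_mono[OF _ le] coef_decay_imp_symbol)
  \<comment> \<open>The terms of orders N to N' - 1 split off in excess. Each is a symbol of the
    required order, so they are added back.\<close>
  define I where "I = {\<alpha> :: nat ^ 'n::_. mi_order \<alpha> < N'} - {\<alpha>. mi_order \<alpha> < N}"
  have mid: "(\<lambda>k m. \<Sum>\<alpha>\<in>I. taylor_term \<alpha> (\<lambda>l. b l m) k m) \<in> coef_symbol (\<mu> - real N * (\<rho> - \<delta>)) \<rho> \<delta>"
  proof (rule coef_symbol_sum)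
    fix \<alpha> assume "\<alpha> \<in> I"
    then have "real N * (\<rho> - \<delta>) \<le> real (mi_order \<alpha>) * (\<rho> - \<delta>)"
      using \<delta> by (intro mult_right_mono) (auto simp: I_def)
    then show "(\<lambda>k m. taylor_term \<alpha> (\<lambda>l. b l m) k m) \<in> coef_symbol (\<mu> - real N * (\<rho> - \<delta>)) \<rho> \<delta>"
      by (intro coef_symbol_mono[OF coef_symbol_taylor_term[OF b \<delta>(1)]]) simp
  qed
  have "taylor_rem N (\<lambda>l. b l m) k m = taylor_rem N' (\<lambda>l. b l m) k m + (\<Sum>\<alpha>\<in>I. taylor_term \<alpha> (\<lambda>l. b l m) k m)" for k m
  proof -
    have "(\<Sum>\<alpha>\<in>I. taylor_term \<alpha> (\<lambda>l. b l m) k m) =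
        (\<Sum>\<alpha> | mi_order \<alpha> < N'. taylor_term \<alpha> (\<lambda>l. b l m) k m) - (\<Sum>\<alpha> | mi_order \<alpha> < N. taylor_term \<alpha> (\<lambda>l. b l m) k m)"
      unfolding I_def by (rule sum_diff) (auto simp: finite_mi_order_less N'_def)
    then show ?thesis by (simp add: taylor_rem_def)
  qed
  then show ?thesis using coef_symbol_add[OF high mid] by simp
qed

subsection \<open>The transpose\<close>

lemma fourier_eq_trig_series: "fourier f x = trig_series (\<lambda>l. f (- l)) x"
proof -
  have "fourier f x = (\<Sum>\<^sub>\<infinity>k. echar (- k) x * f k)"
    by (simp add: fourier_def echar_def)
  also have "\<dots> = (\<Sum>\<^sub>\<infinity>k. echar k x * f (- k))"
    using infsum_reindex_bij_betw[OF bij_uminus, of "\<lambda>k. echar (- k) x * f k"] by simp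
  finally show ?thesis by (simp add: trig_series_def mult.commute)
qed

text \<open>The series of \<open>fourier f\<close> is integrated termwise; \<open>echar k\<close>
  shifts the frequency, and the reflection caused by the sign in \<open>fourier\<close> is undone by
  reindexing.\<close>

lemma Op_kernel:
  assumes \<sigma>: "continuous_on UNIV (\<sigma> k)" and f: "rapidly_decreasing f"
  shows "Op \<sigma> f k = (\<Sum>\<^sub>\<infinity>l. f l * fcoef (\<sigma> k) (l - k))"
proof -
  define c where "c l = f (- l)" for l
  have c: "(\<lambda>l. norm (c l)) summable_on UNIV"
    unfolding c_def by (intro rapidly_decreasing_abs_summable rapidly_decreasing_uminus f)
  define u where "u x = echar k x * \<sigma> k x" for x
  have u: "continuous_on UNIV u" unfolding u_def by (intro continuous_intros \<sigma>)
  have cont: "continuous_on UNIV (\<lambda>x. u x * trig_series c x)"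
    by (intro continuous_intros u continuous_on_trig_series c)
  have "Op \<sigma> f k = (LINT x:cbox 0 1|lborel. u x * trig_series c x)"
    by (simp add: Op_def u_def echar_def fourier_eq_trig_series c_def[abs_def])
  \<comment> \<open>From the Lebesgue integral in \<open>Op\<close> to the gauge integral in which
    \<open>fcoef\<close> is defined.\<close>
  also have "\<dots> = integral (cbox 0 1) (\<lambda>x. u x * trig_series c x)"
    by (rule set_borel_integral_eq_integral(2))
       (auto simp: set_integrable_def intro!: borel_integrable_compact continuous_on_subset[OF cont])
  also have "\<dots> = (\<Sum>\<^sub>\<infinity>l. c l * integral (cbox 0 1) (\<lambda>x. u x * echar l x))"
    by (rule infsumI[symmetric]) (rule has_sum_integral_mult_trig_series[OF c u])
  also have "\<dots> = (\<Sum>\<^sub>\<infinity>l. f (- l) * fcoef (\<sigma> k) (- l - k))"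
    by (simp add: c_def fcoef_def u_def echar_add mult_ac)
  also have "\<dots> = (\<Sum>\<^sub>\<infinity>l. f l * fcoef (\<sigma> k) (l - k))"
    using infsum_reindex_bij_betw[OF bij_uminus, of "\<lambda>l. f l * fcoef (\<sigma> k) (l - k)"] by simp
  finally show ?thesis .
qed

text \<open>The matrix of \<open>Op \<sigma>\<close> has entry
  \<open>fcoef (\<sigma> l) (k - l)\<close> in row \<open>l\<close> and column \<open>k\<close>, and
  \<open>kernel\<close> says that \<open>\<sigma>t\<close> has the transposed matrix. The decay of
  \<open>f\<close> absorbs the growth in the row index and that of \<open>g\<close> sums the
  columns, so the double series converges absolutely and may be rearranged.\<close>

lemma is_transpose_Op:
  fixes \<sigma> \<sigma>t :: "int ^ 'n::finite \<Rightarrow> real ^ 'n \<Rightarrow> complex"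
  assumes \<sigma>: "\<And>k. continuous_on UNIV (\<sigma> k)" and \<sigma>t: "\<And>k. continuous_on UNIV (\<sigma>t k)"
    and kernel: "\<And>k m. fcoef (\<sigma>t k) m = fcoef (\<sigma> (k + m)) (- m)"
    and growth: "\<And>k m. norm (fcoef (\<sigma> k) m) \<le> C * weight k ^ K"
  shows "is_transpose (Op \<sigma>) (Op \<sigma>t)"
  unfolding is_transpose_def
proof (intro allI impI)
  fix f g :: "int ^ 'n \<Rightarrow> complex"
  assume f: "rapidly_decreasing f" and g: "rapidly_decreasing g"
  define \<Phi> where "\<Phi> = (\<lambda>(l, k). f l * fcoef (\<sigma> l) (k - l) * g k)"
  have \<Phi>: "\<Phi> summable_on UNIV \<times> UNIV"
  proof (rule abs_summable_summable, rule summable_on_comparison_test)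
    have s: "(\<lambda>l. norm (f l) * weight l ^ K) summable_on UNIV" "(\<lambda>k. norm (g k)) summable_on UNIV"
      by (intro rapidly_decreasing_summable rapidly_decreasing_abs_summable f g)+
    have "(\<lambda>(l, k). (norm (f l) * weight l ^ K) * norm (g k)) summable_on UNIV \<times> UNIV"
      by (rule summable_on_SigmaI[where g = "\<lambda>l. (norm (f l) * weight l ^ K) * (\<Sum>\<^sub>\<infinity>k. norm (g k))"])
         (auto intro!: has_sum_cmult_right has_sum_infsum s summable_on_cmult_left)
    from summable_on_cmult_right[OF this, of C]
    show "(\<lambda>(l, k). C * ((norm (f l) * weight l ^ K) * norm (g k))) summable_on UNIV \<times> UNIV"
      by (simp add: case_prod_unfold)
    show "norm (\<Phi> p) \<le> (case p of (l, k) \<Rightarrow> C * ((norm (f l) * weight l ^ K) * norm (g k)))" for p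
    proof (cases p)
      case (Pair l k)
      have "norm (f l) * norm (fcoef (\<sigma> l) (k - l)) * norm (g k) \<le> norm (f l) * (C * weight l ^ K) * norm (g k)"
        by (intro mult_right_mono mult_left_mono growth) auto
      then show ?thesis by (simp add: Pair \<Phi>_def norm_mult mult_ac)
    qed
  qed auto
  have \<Phi>': "(\<lambda>(k, l). \<Phi> (l, k)) summable_on UNIV \<times> UNIV"
    using \<Phi> summable_on_reindex_bij_betw[OF bij_swap, of \<Phi>]
    by (simp add: case_prod_unfold prod.swap_def)
  have row: "f l * Op \<sigma> g l = (\<Sum>\<^sub>\<infinity>k. \<Phi> (l, k))" for l
    unfolding Op_kernel[OF \<sigma> g] by (simp add: \<Phi>_def infsum_cmult_right'[symmetric] mult_ac)
  have col: "Op \<sigma>t f k * g k = (\<Sum>\<^sub>\<infinity>l. \<Phi> (l, k))" for k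
    unfolding Op_kernel[OF \<sigma>t f] by (simp add: \<Phi>_def kernel infsum_cmult_left'[symmetric])
  have "(\<lambda>k. Op \<sigma>t f k * g k) summable_on UNIV"
    unfolding col using summable_on_Sigma_banach[OF \<Phi>'] by simp
  moreover have "(\<lambda>k. f k * Op \<sigma> g k) summable_on UNIV"
    unfolding row using summable_on_Sigma_banach[of "\<lambda>l k. \<Phi> (l, k)" UNIV "\<lambda>_. UNIV"] \<Phi> by simp
  moreover have "(\<Sum>\<^sub>\<infinity>k. Op \<sigma>t f k * g k) = (\<Sum>\<^sub>\<infinity>k. f k * Op \<sigma> g k)"
    unfolding row col by (rule infsum_swap_banach) (rule \<Phi>')
  ultimately show "(\<lambda>k. Op \<sigma>t f k * g k) summable_on UNIV \<and> (\<lambda>k. f k * Op \<sigma> g k) summable_on UNIV \<and>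
      (\<Sum>\<^sub>\<infinity>k. Op \<sigma>t f k * g k) = (\<Sum>\<^sub>\<infinity>k. f k * Op \<sigma> g k)" by blast
qed

theorem theorem3p3:
  fixes \<mu> \<rho> \<delta> :: real
    and \<sigma> :: "int ^ 'n::{finite,linorder} \<Rightarrow> real ^ 'n::_ \<Rightarrow> complex"
  assumes "0 \<le> \<delta>" and "\<delta> < \<rho>" and "\<rho> \<le> 1"
    and "\<sigma> \<in> symbol_class \<mu> \<rho> \<delta>"
  shows "\<exists>\<sigma>t \<in> symbol_class \<mu> \<rho> \<delta>.
           is_transpose (Op \<sigma>) (Op \<sigma>t) \<and>
           (\<forall>N::nat.
              (\<lambda>k x. \<sigma>t k x -
                 (\<Sum>\<alpha> | mi_order \<alpha> < N.
                    1 / of_nat (mi_fact \<alpha>) *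
                    Delta \<alpha> (\<lambda>l. Dx \<alpha> (\<lambda>y. \<sigma> l (- y)) x) k))
              \<in> symbol_class (\<mu> - real N * (\<rho> - \<delta>)) \<rho> \<delta>)"
proof -
  have smooth: "smooth_torus (\<sigma> k)" for k using assms(4) by (simp add: symbol_class_def)
  \<comment> \<open>The coefficients of the reflected function in the asserted expansion.\<close>
  define b where "b k m = fcoef (\<sigma> k) (- m)" for k m
  have b: "b \<in> coef_symbol \<mu> \<rho> \<delta>"
    unfolding b_def by (intro coef_symbol_uminus fcoef_coef_symbol assms)
  have rapid: "rapidly_decreasing (b k)" for k by (rule coef_symbolD(1)[OF b])
  define r where "r N k m = taylor_rem N (\<lambda>l. b l m) k m" for N k m
  have r: "r N \<in> coef_symbol (\<mu> - real N * (\<rho> - \<delta>)) \<rho> \<delta>" for N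
    unfolding r_def by (rule coef_symbol_taylor_rem[OF b assms(1-3)])
  have r0: "r 0 k m = b (k + m) m" for k m by (simp add: r_def taylor_rem_def)
  have r_rapid: "rapidly_decreasing (r N k)" for N k by (rule coef_symbolD(1)[OF r])
  define \<sigma>t where "\<sigma>t k x = trig_series (r 0 k) x" for k x
  have \<sigma>t_smooth: "smooth_torus (\<sigma>t k)" for k
    unfolding \<sigma>t_def[abs_def] by (rule smooth_torus_trig_series[OF r_rapid])
  have symb: "(\<lambda>k x. trig_series (r N k) x) \<in> symbol_class (\<mu> - real N * (\<rho> - \<delta>)) \<rho> \<delta>" for N
    using trig_series_symbol_iff[of "r N", OF r_rapid] r by simp
  have "is_transpose (Op \<sigma>) (Op \<sigma>t)"
  proof -
    \<comment> \<open>Decay of order 0 bounds all coefficients uniformly in \<open>m\<close>, which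
      is the growth condition of \<open>is_transpose_Op\<close>.\<close>
    have "\<exists>C>0. \<forall>k m. norm (Delta 0 (\<lambda>l. b l m) k) \<le>
        C * weight k powr (\<mu> - \<rho> * real (mi_order (0 :: nat ^ 'n::_)) + \<delta> * real 0) / weight m ^ 0"
      using coef_symbol_imp_decay[OF b assms(1)] unfolding coef_decay_def by blast
    then obtain C where C: "C > 0" "\<And>k m. norm (b k m) \<le> C * weight k powr \<mu>" by auto
    obtain K :: nat where K: "\<mu> \<le> real K" using real_arch_simple by blast
    have "norm (fcoef (\<sigma> k) m) \<le> C * weight k ^ K" for k m
    proof -
      have "norm (fcoef (\<sigma> k) m) \<le> C * weight k powr \<mu>" using C(2)[of k "- m"] by (simp add: b_def)
      also have "\<dots> \<le> C * weight k powr real K"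
        using C(1) K by (intro mult_left_mono powr_mono) (auto simp: weight_ge_1)
      finally show ?thesis by (simp add: powr_realpow)
    qed
    moreover have "fcoef (\<sigma>t k) m = fcoef (\<sigma> (k + m)) (- m)" for k m
      unfolding \<sigma>t_def[abs_def] by (simp add: fcoef_trig_series[OF r_rapid] r0 b_def)
    ultimately show ?thesis
      using smooth_torusD(2)[OF smooth] smooth_torusD(2)[OF \<sigma>t_smooth] by (intro is_transpose_Op)
  qed
  moreover have "\<sigma>t \<in> symbol_class \<mu> \<rho> \<delta>" using symb[of 0] by (simp add: \<sigma>t_def[abs_def])
  moreover have "(\<lambda>k x. \<sigma>t k x - (\<Sum>\<alpha> | mi_order \<alpha> < N. 1 / of_nat (mi_fact \<alpha>) *
      Delta \<alpha> (\<lambda>l. Dx \<alpha> (\<lambda>y. \<sigma> l (- y)) x) k)) \<in> symbol_class (\<mu> - real N * (\<rho> - \<delta>)) \<rho> \<delta>" for N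
  proof -
    have Dx_refl: "Dx \<alpha> (\<lambda>y. \<sigma> l (- y)) = trig_series (\<lambda>m. ff \<alpha> m * b l m)" for \<alpha> l
    proof -
      have "(\<lambda>y. \<sigma> l (- y)) = trig_series (b l)"
        using trig_series_minus_right[of "fcoef (\<sigma> l)"]
        by (simp add: fun_eq_iff b_def[abs_def] trig_series_fcoef[OF smooth])
      then show ?thesis by (simp add: Dx_trig_series[OF rapid])
    qed
    \<comment> \<open>\<open>Dx\<close> multiplies coefficients by \<open>ff\<close> and differences
      in \<open>k\<close> act on them directly, so the summands of the expansion are the series of
      the Taylor terms.\<close>
    have term_eq: "1 / of_nat (mi_fact \<alpha>) * Delta \<alpha> (\<lambda>l. Dx \<alpha> (\<lambda>y. \<sigma> l (- y)) x) k =
        trig_series (\<lambda>m. taylor_term \<alpha> (\<lambda>l. b l m) k m) x" for \<alpha> k x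
      unfolding Dx_refl taylor_term_def trig_series_cmult
      by (subst Delta_trig_series[where b = "\<lambda>l m. ff \<alpha> m * b l m"])
         (simp_all add: rapidly_decreasing_ff rapid Delta_cmult)
    have term_rapid: "rapidly_decreasing (\<lambda>m. taylor_term \<alpha> (\<lambda>l. b l m) k m)" for \<alpha> k
      by (rule coef_symbolD(1)[OF coef_symbol_taylor_term[OF b assms(1)]])
    have "\<sigma>t k x - (\<Sum>\<alpha> | mi_order \<alpha> < N. 1 / of_nat (mi_fact \<alpha>) *
        Delta \<alpha> (\<lambda>l. Dx \<alpha> (\<lambda>y. \<sigma> l (- y)) x) k) = trig_series (r N k) x" for k x
    proof -
      have "r N k = (\<lambda>m. r 0 k m - (\<Sum>\<alpha> | mi_order \<alpha> < N. taylor_term \<alpha> (\<lambda>l. b l m) k m))"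
        by (rule ext) (simp only: r0, simp add: r_def taylor_rem_def)
      then show ?thesis
        unfolding term_eq \<sigma>t_def
        by (simp add: trig_series_diff trig_series_sum r_rapid term_rapid rapidly_decreasing_sum)
    qed
    then show ?thesis using symb[of N] by simp
  qed
  ultimately show ?thesis by blast
qed

end
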